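(* The candidate surface branched covers of degree $d$ inducing a candidate 2-orbifold cover $S(2,2,2,2)\dashrightarrow S(2,4,4)$ are the following, with $\widetilde\Sigma=\Sigma=S$ and $k\geq 1$: \begin{enumerate} \item $d=4k+4$, partitions $(2^{2k},1,1,1,1),(4^{k+1}),(4^{k+1})$; \item $d=4k+4$, partitions $(2^{2k+1},1,1),(4^k,2,2),(4^{k+1})$; \item $d=4k+2$, partitions $(2^{2k},1,1),(4^k,2),(4^k,2)$; \item $d=4k+4$, partitions $(2^{2k+2}),(4^k,2,2),(4^k,2,2)$; \item $d=4k+6$, partitions $(2^{2k+3}),(4^k,2,2,2),(4^{k+1},2)$; \item $d=4k+8$, partitions $(2^{2k+4}),(4^k,2,2,2,2),(4^{k+2})$. \end{enumerate} Those of types 1, 2, 3 and 4 are always realizable, those of type 5 are never realizable, and one of type 6 is realizable if and only if $d$ is a multiple of $8$.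
   Context: $S$ is the 2-sphere. A partition of $d$ is a finite unordered list (multiset) of positive integers with sum $d$; $\ell(\Pi)$ is the number of entries of $\Pi$; $(a^m,b,\ldots)$ means that $a$ is repeated $m$ times. For closed connected orientable surfaces $\widetilde\Sigma,\Sigma$, a branched cover $f:\widetilde\Sigma\to\Sigma$ is a map locally modelled on $(\mathbb{C},0)\to(\mathbb{C},0)$, $z\mapsto z^k$ with $k\geq 1$; $k$ is the local degree at the source point, and a point of $\Sigma$ having a preimage with local degree $>1$ is a branching point. The degree $d$ of $f$ is the degree of the genuine cover obtained by removing the branching points and their preimages; the local degrees at the preimages of a branching point form a partition of $d$. A candidate surface branched cover consists of closed connected orientable surfaces $\widetilde\Sigma,\Sigma$ (up to homeomorphism), integers $d\geq 2$ and $n\geq 1$, and an unordered collection (repetitions allowed) $\Pi_1,\ldots,\Pi_n$ of partitions of $d$, each with at least one entry $>1$, satisfying the Riemann-Hurwitz condition $\chi(\widetilde\Sigma)-\sum_i\ell(\Pi_i)=d\,(\chi(\Sigma)-n)$. It is realizable if there is a degree-$d$ branched cover $f:\widetilde\Sigma\to\Sigma$ with $n$ branching points whose associated partitions of local degrees are $\Pi_1,\ldots,\Pi_n$. A 2-orbifold $\Sigma(p_1,\ldots,p_n)$ is a closed connected orientable surface $\Sigma$ with $n$ cone points of orders $p_i\geq 2$. With $\Pi_i=(d_{ij})_j$, set $p_i=\mathrm{lcm}_j\, d_{ij}$ and $p_{ij}=p_i/d_{ij}$. The induced candidate 2-orbifold cover is $\widetilde X\dashrightarrow X$ with $X=\Sigma(p_1,\ldots,p_n)$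 and $\widetilde X=\widetilde\Sigma((p_{ij})_{i,j})$, where orders equal to $1$ are dropped. *)

theory Defs
  imports
    "HOL-Homology.Homology"
    "HOL-Complex_Analysis.Complex_Analysis"
    "HOL-Library.Multiset"
begin

section \<open>Closed connected orientable surfaces\<close>

definition surface_chart :: "'a topology \<Rightarrow> 'a set \<Rightarrow> ('a \<Rightarrow> complex) \<Rightarrow> bool" where
  "surface_chart X U \<phi> \<longleftrightarrow>
     openin X U \<and> open (\<phi> ` U) \<and>
     homeomorphic_map (subtopology X U) (top_of_set (\<phi> ` U)) \<phi>"

text \<open>For an injective continuous map \<open>h\<close> on an open set \<open>U\<close> of the plane: small positively
  oriented circles around a point are sent to loops of winding number \<open>1\<close> around its image.\<close>

definition orientation_preserving_on :: "complex set \<Rightarrow> (complex \<Rightarrow> complex) \<Rightarrow> bool" where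
  "orientation_preserving_on U h \<longleftrightarrow>
     (\<forall>z r. 0 < r \<and> cball z r \<subseteq> U \<longrightarrow> winding_number (h \<circ> circlepath z r) (h z) = 1)"

definition oriented_atlas :: "'a topology \<Rightarrow> ('a set \<times> ('a \<Rightarrow> complex)) set \<Rightarrow> bool" where
  "oriented_atlas X A \<longleftrightarrow>
     (\<forall>(U, \<phi>) \<in> A. surface_chart X U \<phi>) \<and>
     (\<Union>(U, \<phi>) \<in> A. U) = topspace X \<and>
     (\<forall>(U, \<phi>) \<in> A. \<forall>(V, \<psi>) \<in> A.
        orientation_preserving_on (\<phi> ` (U \<inter> V)) (\<psi> \<circ> inv_into U \<phi>))"

text \<open>The atlas makes the space a 2-manifold; second countability follows from compactness.
  Nonemptiness is explicit because \<^const>\<open>connected_space\<close> admits the empty space.\<close>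

definition closed_orientable_surface :: "'a topology \<Rightarrow> bool" where
  "closed_orientable_surface X \<longleftrightarrow>
     topspace X \<noteq> {} \<and> connected_space X \<and> compact_space X \<and> Hausdorff_space X \<and>
     (\<exists>A. oriented_atlas X A)"

text \<open>Rank of an abelian group: the maximal cardinality of an independent set over the integers.
  (The supremum is meaningful for groups of finite rank only.)\<close>

definition independent_in :: "('g, 'm) monoid_scheme \<Rightarrow> 'g set \<Rightarrow> bool" where
  "independent_in G B \<longleftrightarrow>
     finite B \<and> B \<subseteq> carrier G \<and>
     (\<forall>c :: 'g \<Rightarrow> int. finprod G (\<lambda>b. b [^]\<^bsub>G\<^esub> c b) B = \<one>\<^bsub>G\<^esub> \<longrightarrow> (\<forall>b\<in>B. c b = 0))"

definition group_rank :: "('g, 'm) monoid_scheme \<Rightarrow> nat" where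
  "group_rank G = Sup (card ` {B. independent_in G B})"

text \<open>The homology of a surface vanishes above degree \<open>2\<close>.\<close>

definition euler_char :: "'a topology \<Rightarrow> int" where
  "euler_char X =
     int (group_rank (homology_group 0 X)) - int (group_rank (homology_group 1 X))
       + int (group_rank (homology_group 2 X))"

section \<open>Branched covers\<close>

definition locally_power_map ::
  "'a topology \<Rightarrow> 'b topology \<Rightarrow> ('a \<Rightarrow> 'b) \<Rightarrow> 'a \<Rightarrow> nat \<Rightarrow> bool" where
  "locally_power_map X Y f x k \<longleftrightarrow>
     1 \<le> k \<and>
     (\<exists>U V \<phi> \<psi>.
        openin X U \<and> x \<in> U \<and> openin Y V \<and> f ` U \<subseteq> V \<and>
        homeomorphic_map (subtopology X U) (euclidean :: complex topology) \<phi> \<and>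
        homeomorphic_map (subtopology Y V) (euclidean :: complex topology) \<psi> \<and>
        \<phi> x = 0 \<and> \<psi> (f x) = 0 \<and> (\<forall>u\<in>U. \<psi> (f u) = \<phi> u ^ k))"

definition branched_cover :: "'a topology \<Rightarrow> 'b topology \<Rightarrow> ('a \<Rightarrow> 'b) \<Rightarrow> bool" where
  "branched_cover X Y f \<longleftrightarrow>
     closed_orientable_surface X \<and> closed_orientable_surface Y \<and> continuous_map X Y f \<and>
     (\<forall>x \<in> topspace X. \<exists>k. locally_power_map X Y f x k)"

definition local_degree :: "'a topology \<Rightarrow> 'b topology \<Rightarrow> ('a \<Rightarrow> 'b) \<Rightarrow> 'a \<Rightarrow> nat" where
  "local_degree X Y f x = (THE k. locally_power_map X Y f x k)"

definition fibre :: "'a topology \<Rightarrow> ('a \<Rightarrow> 'b) \<Rightarrow> 'b \<Rightarrow> 'a set" where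
  "fibre X f y = {x \<in> topspace X. f x = y}"

definition branching_points :: "'a topology \<Rightarrow> 'b topology \<Rightarrow> ('a \<Rightarrow> 'b) \<Rightarrow> 'b set" where
  "branching_points X Y f =
     {y \<in> topspace Y. \<exists>x \<in> fibre X f y. local_degree X Y f x > 1}"

definition has_cover_degree :: "'a topology \<Rightarrow> 'b topology \<Rightarrow> ('a \<Rightarrow> 'b) \<Rightarrow> nat \<Rightarrow> bool" where
  "has_cover_degree X Y f d \<longleftrightarrow>
     (\<forall>y \<in> topspace Y - branching_points X Y f. finite (fibre X f y) \<and> card (fibre X f y) = d)"

definition local_degrees_over ::
  "'a topology \<Rightarrow> 'b topology \<Rightarrow> ('a \<Rightarrow> 'b) \<Rightarrow> 'b \<Rightarrow> nat multiset" where
  "local_degrees_over X Y f y = image_mset (local_degree X Y f) (mset_set (fibre X f y))"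

section \<open>Candidate surface branched covers\<close>

definition is_partition :: "nat \<Rightarrow> nat multiset \<Rightarrow> bool" where
  "is_partition d p \<longleftrightarrow> (\<forall>e \<in># p. 0 < e) \<and> sum_mset p = d"

definition candidate_cover ::
  "'a topology \<Rightarrow> 'b topology \<Rightarrow> nat \<Rightarrow> nat multiset multiset \<Rightarrow> bool" where
  "candidate_cover X Y d P \<longleftrightarrow>
     closed_orientable_surface X \<and> closed_orientable_surface Y \<and>
     2 \<le> d \<and> 1 \<le> size P \<and>
     (\<forall>p \<in># P. is_partition d p \<and> (\<exists>e \<in># p. 1 < e)) \<and>
     euler_char X - (\<Sum>p \<in># P. int (size p)) = int d * (euler_char Y - int (size P))"

definition realizable ::
  "'a topology \<Rightarrow> 'b topology \<Rightarrow> nat \<Rightarrow> nat multiset multiset \<Rightarrow> bool" where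
  "realizable X Y d P \<longleftrightarrow>
     (\<exists>f. branched_cover X Y f \<and> has_cover_degree X Y f d \<and>
          finite (branching_points X Y f) \<and>
          image_mset (local_degrees_over X Y f) (mset_set (branching_points X Y f)) = P)"

section \<open>The induced candidate 2-orbifold cover\<close>

text \<open>A 2-orbifold is given by its underlying surface and the multiset of its cone orders.\<close>

type_synonym 'a orbifold = "'a topology \<times> nat multiset"

definition same_orbifold :: "'a orbifold \<Rightarrow> 'b orbifold \<Rightarrow> bool" where
  "same_orbifold O1 O2 \<longleftrightarrow> fst O1 homeomorphic_space fst O2 \<and> snd O1 = snd O2"

definition cone_order :: "nat multiset \<Rightarrow> nat" where
  "cone_order p = Lcm (set_mset p)"

definition induced_target :: "'b topology \<Rightarrow> nat multiset multiset \<Rightarrow> 'b orbifold" where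
  "induced_target Y P = (Y, image_mset cone_order P)"

definition induced_source :: "'a topology \<Rightarrow> nat multiset multiset \<Rightarrow> 'a orbifold" where
  "induced_source X P =
     (X, filter_mset (\<lambda>q. q \<noteq> 1) (\<Sum>p \<in># P. image_mset (\<lambda>e. cone_order p div e) p))"

definition induces_orbifold_cover ::
  "'a topology \<Rightarrow> 'b topology \<Rightarrow> nat multiset multiset \<Rightarrow> 'c orbifold \<Rightarrow> 'd orbifold \<Rightarrow> bool" where
  "induces_orbifold_cover X Y P O1 O2 \<longleftrightarrow>
     same_orbifold (induced_source X P) O1 \<and> same_orbifold (induced_target Y P) O2"

abbreviation S2 :: "(nat \<Rightarrow> real) topology" where
  "S2 \<equiv> nsphere 2"

section \<open>The six families\<close>

abbreviation rep :: "nat \<Rightarrow> nat \<Rightarrow> nat multiset" where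
  "rep a m \<equiv> replicate_mset m a"

definition type1 :: "nat \<Rightarrow> nat \<Rightarrow> nat multiset multiset \<Rightarrow> bool" where
  "type1 k d P \<longleftrightarrow> d = 4*k+4 \<and>
     P = {# rep 2 (2*k) + {#1, 1, 1, 1#}, rep 4 (k+1), rep 4 (k+1) #}"

definition type2 :: "nat \<Rightarrow> nat \<Rightarrow> nat multiset multiset \<Rightarrow> bool" where
  "type2 k d P \<longleftrightarrow> d = 4*k+4 \<and>
     P = {# rep 2 (2*k+1) + {#1, 1#}, rep 4 k + {#2, 2#}, rep 4 (k+1) #}"

definition type3 :: "nat \<Rightarrow> nat \<Rightarrow> nat multiset multiset \<Rightarrow> bool" where
  "type3 k d P \<longleftrightarrow> d = 4*k+2 \<and>
     P = {# rep 2 (2*k) + {#1, 1#}, rep 4 k + {#2#}, rep 4 k + {#2#} #}"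

definition type4 :: "nat \<Rightarrow> nat \<Rightarrow> nat multiset multiset \<Rightarrow> bool" where
  "type4 k d P \<longleftrightarrow> d = 4*k+4 \<and>
     P = {# rep 2 (2*k+2), rep 4 k + {#2, 2#}, rep 4 k + {#2, 2#} #}"

definition type5 :: "nat \<Rightarrow> nat \<Rightarrow> nat multiset multiset \<Rightarrow> bool" where
  "type5 k d P \<longleftrightarrow> d = 4*k+6 \<and>
     P = {# rep 2 (2*k+3), rep 4 k + {#2, 2, 2#}, rep 4 (k+1) + {#2#} #}"

definition type6 :: "nat \<Rightarrow> nat \<Rightarrow> nat multiset multiset \<Rightarrow> bool" where
  "type6 k d P \<longleftrightarrow> d = 4*k+8 \<and>
     P = {# rep 2 (2*k+4), rep 4 k + {#2, 2, 2, 2#}, rep 4 (k+2) #}"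

end

theory Submission
  imports Defs
begin

text \<open>Realizations of the positive cases descend from the plane. The sphere \<open>S(2,2,2,2)\<close> is the quotient of \<open>\<complex>\<close> by
  \<open>\<int>[\<i>] \<rtimes> {1, -1}\<close> and \<open>S(2,4,4)\<close> its quotient by \<open>\<int>[\<i>] \<rtimes> \<langle>\<i>\<rangle>\<close>; an integral matrix followed by a half-integral
  translation induces a branched cover whose local degrees are read off from the images of the four half-lattice points.
  For the negative cases, every local degree over the two cone points of order 4 is even, so, the source being simply
  connected, the map has a continuous square root \<open>u\<close> in a coordinate that puts these two points at \<open>0\<close> and \<open>\<infinity>\<close>.
  The weighted number of preimages is the same at the two square roots \<open>a\<close>, \<open>-a\<close> of the third branching value, hence
  the fibre over it splits into halves of equal size and has even cardinality. In type 6 all local degrees over \<open>\<infinity>\<close> are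
  4, so \<open>u - a\<close> has a square root as well, and the fibre \<open>u = - a\<close> splits once more.\<close>

section \<open>The sphere as an oriented surface\<close>

text \<open>The source carries no complex structure: a branched cover is only locally a power map in
  topological charts, so neither meromorphic functions nor analytic continuation are at hand. Square
  roots are obtained by topology alone. A nonvanishing function on a punctured disc is a power of
  the coordinate times an exponential; if it is even in the chart, the exponent is even and a root
  exists, and local roots at finitely many punctures of the plane combine to a global one. One
  puncture sits at infinity and is exempt, which is why a point \<open>q\<close> over
  \<open>B\<close> is singled out. Preimages under the roots \<open>u\<close> and \<open>v\<close>
  are counted with a chart-free multiplicity; it agrees with that of \<open>f\<close> because
  \<open>f\<close> is locally an injective function of \<open>u\<close> or \<open>v\<close>. On the
  realizable side the matrix contributes its determinant \<open>a * b\<close> to the degree and the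
  passage from \<open>{1, -1}\<close> to the rotations of order 4 a factor 2; the distribution of
  the exceptional local degrees depends only on the parities of \<open>a\<close>, \<open>b\<close>,
  \<open>s\<close>, \<open>g\<close>, \<open>h\<close>.\<close>

lemma group_rank_trivial:
  assumes "trivial_group G"
  shows "group_rank G = 0"
proof -
  have G: "group G" "carrier G = {\<one>\<^bsub>G\<^esub>}"
    using assms by (auto simp: trivial_group_def)
  have "B = {}" if "independent_in G B" for B
  proof (rule ccontr)
    assume "B \<noteq> {}"
    with that G have B: "B = {\<one>\<^bsub>G\<^esub>}"
      by (auto simp: independent_in_def)
    have cm: "comm_monoid G"
      using G by (intro group.group_comm_groupI[THEN comm_group.axioms(1)]) auto
    interpret comm_monoid G by (rule cm)
    \<comment> \<open>The coefficient 1 on the identity is a nontrivial relation, so even this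
      singleton is dependent.\<close>
    have "finprod G (\<lambda>b. b [^]\<^bsub>G\<^esub> (1::int)) B = \<one>\<^bsub>G\<^esub>"
      using B G by (simp add: group.int_pow_one)
    then show False
      using that B unfolding independent_in_def by force
  qed
  moreover have "independent_in G {}"
    by (auto simp: independent_in_def)
  ultimately have "{B. independent_in G B} = {{}}" by auto
  then show ?thesis by (simp add: group_rank_def)
qed

text \<open>Two integers \<open>h b1\<close> and \<open>h b2\<close> always satisfy a linear
  relation, with the two values exchanged and one sign changed, so no independent set has two
  elements.\<close>

lemma group_rank_iso_int:
  fixes G (structure)
  assumes "comm_group G" and "G \<cong> integer_group"
  shows "group_rank G = 1"
proof -
  interpret comm_group G by fact
  obtain h where h: "h \<in> iso G integer_group"
    using assms(2) by (auto simp: is_iso_def)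
  then have hom: "h \<in> hom G integer_group" and inj: "inj_on h (carrier G)" and surj: "h ` carrier G = UNIV"
    by (auto simp: iso_def bij_betw_def)
  have hpow: "h (x [^] (n::int)) = n * h x" if "x \<in> carrier G" for x n
    using hom_int_pow[OF hom that is_group group_integer_group, of n] by simp
  have hmult: "h (x \<otimes> y) = h x + h y" if "x \<in> carrier G" "y \<in> carrier G" for x y
    using hom that by (simp add: hom_def)
  have hone: "h \<one> = 0"
    using hom_one[OF hom is_group group_integer_group] by simp
  have le: "card B \<le> 1" if B: "independent_in G B" for B
  proof (rule ccontr)
    assume "\<not> card B \<le> 1"
    then obtain b1 b2 where b: "b1 \<in> B" "b2 \<in> B" "b1 \<noteq> b2"
      using B card_le_Suc0_iff_eq[of B] by (auto simp: independent_in_def)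
    then have bc: "b1 \<in> carrier G" "b2 \<in> carrier G" using B by (auto simp: independent_in_def)
    have fin: "finite B" and sub: "B \<subseteq> carrier G" using B by (auto simp: independent_in_def)
    define c where "c b = (if b = b1 then h b2 else if b = b2 then - h b1 else 0)" for b
    have "finprod G (\<lambda>b. b [^] c b) B = finprod G (\<lambda>b. b [^] c b) {b1,b2}"
      by (rule finprod_mono_neutral_cong_right) (use fin b sub in \<open>auto simp: c_def\<close>)
    also have "\<dots> = b1 [^] h b2 \<otimes> b2 [^] (- h b1)"
      using b sub by (subst finprod_insert) (auto simp: c_def)
    finally have "h (finprod G (\<lambda>b. b [^] c b) B) = 0"
      using bc by (simp add: hmult hpow)
    then have "finprod G (\<lambda>b. b [^] c b) B = \<one>"
      using sub hone by (intro inj_onD[OF inj]) (auto intro!: finprod_closed)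
    then have "c b1 = 0" "c b2 = 0"
      using B b unfolding independent_in_def by blast+
    then have "h b1 = 0" "h b2 = 0" using b by (auto simp: c_def)
    then show False using inj b sub by (metis inj_onD subsetD)
  qed
  obtain g where g: "g \<in> carrier G" "h g = 1"
    using surj by (metis UNIV_I imageE)
  have ind: "independent_in G {g}"
  proof -
    have "c g = 0" if "finprod G (\<lambda>b. b [^] c b) {g} = \<one>" for c :: "'a \<Rightarrow> int"
    proof -
      have "g [^] c g = \<one>" using that g by simp
      then have "c g * h g = 0" using hpow[of g "c g"] g hone by simp
      then show ?thesis using g by simp
    qed
    then show ?thesis using g by (auto simp: independent_in_def)
  qed
  show ?thesis
    unfolding group_rank_def
  proof (rule cSup_eq_maximum)
    show "1 \<in> card ` {B. independent_in G B}"
      using ind by (intro image_eqI[of _ _ "{g}"]) auto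
  qed (use le in auto)
qed

section \<open>The round sphere and its Euler characteristic\<close>

text \<open>Modelled in \<open>real \<times> complex\<close> so that stereographic projection lands
  in \<open>complex\<close> and the half-turn about the first axis is a sign change of the second
  coordinate.\<close>

abbreviation sph :: "(real \<times> complex) set" where "sph \<equiv> sphere 0 1"

lemma S2_sph: "S2 homeomorphic_space top_of_set sph"
proof -
  obtain f :: "(nat \<Rightarrow> real) \<Rightarrow> real \<times> complex" and g
    where "homeomorphic_maps (nsphere(DIM(real \<times> complex) - 1)) (top_of_set (sphere 0 1 \<inter> span Basis)) f g"
    using homeomorphic_maps_nsphere_euclidean_sphere[of "Basis :: (real \<times> complex) set" "DIM(real \<times> complex)"]
      independent_Basis orthogonal_Basis norm_Basis by (metis DIM_positive less_irrefl)
  moreover have "nsphere(DIM(real \<times> complex) - 1) = S2" by (simp add: numeral_2_eq_2)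
  ultimately show ?thesis
    unfolding homeomorphic_space_def by auto
qed

lemma path_connected_space_homeomorphic_S2:
  assumes "X homeomorphic_space S2" 
  shows "path_connected_space X"
proof -
  have "path_connected sph"
    by (rule path_connected_sphere) simp
  moreover have "X homeomorphic_space top_of_set sph"
    using assms S2_sph homeomorphic_space_trans by blast
  ultimately show ?thesis
    using homeomorphic_path_connected_space path_connectedin_euclidean
    by (metis path_connectedin_def)
qed

text \<open>Reduced and ordinary homology agree in degrees 1 and 2, and path connectedness settles
  degree 0; the ranks are 1, 0, 1.\<close>

lemma euler_char_S2:
  assumes "X homeomorphic_space S2"
  shows "euler_char X = 2"
proof -
  have iso: "reduced_homology_group p X \<cong> reduced_homology_group p S2" for p
    by (rule homeomorphic_space_imp_isomorphic_reduced_homology_groups[OF assms])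
  have "topspace X \<noteq> {}"
    using assms homeomorphic_empty_space nonempty_nsphere by fastforce
  then have "homology_group 0 X \<cong> integer_group"
    by (intro isomorphic_integer_zeroth_homology_group path_connected_space_homeomorphic_S2[OF assms])
  then have "group_rank (homology_group 0 X) = 1"
    by (intro group_rank_iso_int) auto
  moreover have "homology_group 2 X \<cong> integer_group"
    using iso_trans[OF iso[of 2] ] reduced_homology_group_nsphere(1)[of 2] by (simp add: un_reduced_homology_group)
  then have "group_rank (homology_group 2 X) = 1"
    by (intro group_rank_iso_int) auto
  moreover have "trivial_group (reduced_homology_group 1 S2)"
    by (rule reduced_homology_group_nsphere(2)) simp
  then have "trivial_group (homology_group 1 X)"
    using iso[of 1] isomorphic_group_triviality
    by (metis group_reduced_homology_group un_reduced_homology_group zero_neq_one)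
  then have "group_rank (homology_group 1 X) = 0"
    by (rule group_rank_trivial)
  ultimately show ?thesis by (simp add: euler_char_def)
qed

section \<open>Continuous logarithms, winding numbers and the orientation of inversion\<close>

text \<open>Two logarithms of one number differ by a multiple of \<open>2 * pi * \<i>\<close>, so
  distinct values of \<open>q\<close> are at least \<open>2 * pi\<close> apart, and a continuous
  function with such a discrete range is constant on a connected set.\<close>

lemma exp_constant_imp_constant_on:
  fixes q :: "'a::topological_space \<Rightarrow> complex"
  assumes "connected S" "continuous_on S q" and e: "\<And>x. x \<in> S \<Longrightarrow> exp (q x) = e"
  shows "q constant_on S"
proof (rule continuous_discrete_range_constant[OF assms(1,2)])
  show "\<exists>e>0. \<forall>y. y \<in> S \<and> q y \<noteq> q x \<longrightarrow> e \<le> cmod (q y - q x)" if x: "x \<in> S" for x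
  proof (intro exI[of _ "2*pi"] conjI allI impI)
    fix y assume y: "y \<in> S \<and> q y \<noteq> q x"
    then have "exp (q y) = exp (q x)" using e x by simp
    then obtain n :: int where n: "q y = q x + of_real (real_of_int (2 * n) * pi) * \<i>"
      unfolding exp_eq by blast
    have "cmod (q y - q x) = \<bar>real_of_int n\<bar> * (2 * pi)"
      unfolding n by (simp add: norm_mult abs_mult)
    moreover have "n \<noteq> 0" using y n by auto
    then have "\<bar>real_of_int n\<bar> \<ge> 1" by linarith
    ultimately show "2 * pi \<le> cmod (q y - q x)" by simp
  qed simp
qed

text \<open>Any continuous logarithm of \<open>p - \<zeta>\<close> computes the winding number,
  because it differs by a constant from the one supplied by
  \<open>winding_number_as_continuous_log\<close>.\<close>

lemma winding_number_exp:
  assumes "path p" "\<zeta> \<notin> path_image p" "continuous_on {0..1} q"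
    and "\<And>t. t \<in> {0..1} \<Longrightarrow> p t = \<zeta> + exp (q t)"
  shows "winding_number p \<zeta> = (q 1 - q 0) / (2 * pi * \<i>)"
proof -
  obtain q' where q': "path q'" "pathfinish q' - pathstart q' = 2 * of_real pi * \<i> * winding_number p \<zeta>"
    "\<And>t. t \<in> {0..1} \<Longrightarrow> p t = \<zeta> + exp(q' t)"
    using winding_number_as_continuous_log[OF assms(1,2)] by metis
  have ex: "exp (q' t - q t) = 1" if "t \<in> {0..1}" for t
    using q'(3)[OF that] assms(4)[OF that] by (simp add: exp_diff)
  have "(\<lambda>t. q' t - q t) constant_on {0..1}"
  proof (rule exp_constant_imp_constant_on)
    show "continuous_on {0..1} (\<lambda>t. q' t - q t)"
      using q'(1) assms(3) by (auto simp: path_def intro!: continuous_intros)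
  qed (use ex in auto)
  then have "q' 1 - q 1 = q' 0 - q 0"
    unfolding constant_on_def by (metis atLeastAtMost_iff order_refl zero_le_one)
  then have "q' 1 - q' 0 = q 1 - q 0" by (simp add: algebra_simps)
  then show ?thesis
    using q'(2) by (simp add: pathfinish_def pathstart_def field_simps)
qed

lemma orientation_preserving_id:
  assumes "\<And>z. z \<in> U \<Longrightarrow> h z = z"
  shows "orientation_preserving_on U h"
  unfolding orientation_preserving_on_def
proof (intro allI impI)
  fix z r assume r: "0 < r \<and> cball z r \<subseteq> U"
  have "h \<circ> circlepath z r = circlepath z r"
  proof
    fix t
    have "circlepath z r t \<in> cball z r"
      using r by (auto simp: circlepath dist_norm norm_mult)
    then show "(h \<circ> circlepath z r) t = circlepath z r t"
      using assms r by auto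
  qed
  moreover have "h z = z" using r assms by (metis centre_in_cball less_le subsetD)
  ultimately show "winding_number (h \<circ> circlepath z r) (h z) = 1"
    using r winding_number_circlepath_centre[of r z] by simp
qed

text \<open>This is the transition between the two stereographic charts. The winding number is read
  off from \<open>1/w - 1/z = (z - w)/(z * w)\<close> with an explicit logarithm.\<close>

lemma orientation_preserving_inverse:
  assumes "\<And>z. z \<in> U \<Longrightarrow> z \<noteq> 0 \<and> h z = inverse z"
  shows "orientation_preserving_on U h"
  unfolding orientation_preserving_on_def
proof (intro allI impI)
  fix z r assume r: "0 < r \<and> cball z r \<subseteq> U"
  let ?c = "circlepath z r"
  have cin: "?c t \<in> cball z r" for t
    using r by (auto simp: circlepath dist_norm norm_mult)
  have cU: "?c t \<in> U" for t by (rule subsetD[OF _ cin]) (use r in simp)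
  have hc: "h \<circ> ?c = (\<lambda>t. inverse (?c t))"
  proof (rule ext)
    fix t
    show "(h \<circ> ?c) t = inverse (?c t)" using assms[OF cU[of t]] by simp
  qed
  have zU: "z \<in> U" by (rule subsetD[of "cball z r"]) (use r in auto)
  have z0: "z \<noteq> 0" "h z = inverse z" using assms[OF zU] by auto
  have rz: "r < cmod z"
  proof (rule ccontr)
    assume "\<not> r < cmod z"
    then have "0 \<in> cball z r" by (simp add: dist_norm)
    then have "0 \<in> U" using r by blast
    then show False using assms by blast
  qed
  have c0: "?c t \<noteq> 0" for t using assms[OF cU] by blast
  define u where "u t = ?c t / z" for t
  have u: "u t = 1 + of_real r / z * exp (2 * of_real pi * \<i> * of_real t)" for t
    using z0 by (simp add: u_def circlepath field_simps)
  \<comment> \<open>Since \<open>r < cmod z\<close>, the path \<open>u\<close> stays in the right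
    half-plane, so \<open>Ln\<close> is continuous along it and returns to its initial
    value.\<close>
  have reu: "Re (u t) > 0" for t
  proof -
    have "cmod (of_real r / z * exp (2 * of_real pi * \<i> * of_real t)) < 1"
      using rz r z0 by (simp add: norm_mult norm_divide divide_less_eq)
    then have "Re (of_real r / z * exp (2 * of_real pi * \<i> * of_real t)) > -1"
      using abs_Re_le_cmod by (metis abs_le_iff dual_order.strict_trans2 minus_less_iff)
    then show ?thesis by (simp add: u)
  qed
  have pc: "path (\<lambda>t. inverse (?c t))"
    unfolding path_def using path_circlepath[of z r] c0 by (intro continuous_intros) (auto simp: path_def)
  \<comment> \<open>A logarithm of \<open>inverse (?c t) - inverse z\<close>; only its middle term
    changes over one turn, which gives winding number 1.\<close>
  define q where "q t = Ln (- of_real r / z^2) + 2 * of_real pi * \<i> * of_real t - Ln (u t)" for t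
  have "winding_number (\<lambda>t. inverse (?c t)) (inverse z) = (q 1 - q 0) / (2 * pi * \<i>)"
  proof (rule winding_number_exp[OF pc])
    show "inverse z \<notin> path_image (\<lambda>t. inverse (?c t))"
    proof
      assume "inverse z \<in> path_image (\<lambda>t. inverse (?c t))"
      then obtain t where "inverse z = inverse (?c t)" by (auto simp: path_image_def)
      then have "z = ?c t" by simp
      then have "of_real r * exp (2 * of_real pi * \<i> * of_real t) = 0" by (simp add: circlepath)
      then show False using r by simp
    qed
    show "continuous_on {0..1} q"
      unfolding q_def u
    proof (intro continuous_intros)
      fix t :: real
      have "Re (u t) > 0" by (rule reu)
      then show "1 + of_real r / z * exp (2 * of_real pi * \<i> * of_real t) \<notin> \<real>\<^sub>\<le>\<^sub>0" 
        unfolding u[symmetric] using complex_nonpos_Reals_iff by force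
    qed
    fix t :: real
    have u0: "u t \<noteq> 0" using reu[of t] by force
    have "exp (q t) = (- of_real r / z^2) * exp (2 * of_real pi * \<i> * of_real t) / u t"
      using u0 z0 r by (simp add: q_def exp_diff exp_add)
    also have "\<dots> = inverse (?c t) - inverse z"
    proof -
      have e: "of_real r * exp (2 * of_real pi * \<i> * of_real t) = ?c t - z" by (simp add: circlepath)
      have "(- of_real r / z^2) * exp (2 * of_real pi * \<i> * of_real t) / u t = - (of_real r * exp (2 * of_real pi * \<i> * of_real t)) / (z^2 * u t)"
        by simp
      also have "\<dots> = inverse (?c t) - inverse z"
        unfolding e using z0 c0[of t] by (simp add: u_def field_simps power2_eq_square)
      finally show ?thesis .
    qed
    finally show "inverse (?c t) = inverse z + exp (q t)" by simp
  qed
  also have "\<dots> = 1"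
  proof -
    have "u 1 = u 0" by (simp add: u)
    then show ?thesis by (simp add: q_def)
  qed
  finally show "winding_number (h \<circ> ?c) (h z) = 1" using hc z0 by simp
qed



section \<open>Stereographic charts and the oriented atlas\<close>

lemma mem_sph: "p \<in> sph \<longleftrightarrow> (fst p)\<^sup>2 + (cmod (snd p))\<^sup>2 = 1"
  by (cases p) (simp add: norm_Pair)

lemma homeomorphic_map_chart_pullback:
  assumes f: "homeomorphic_map Y (top_of_set S) f" and "homeomorphism V T \<phi> \<psi>" "V \<subseteq> S"
  shows "homeomorphic_map (subtopology Y {y \<in> topspace Y. f y \<in> V}) (top_of_set T) (\<lambda>y. \<phi> (f y))"
proof -
  have "f ` topspace Y = S" using f by (auto simp: homeomorphic_map_def quotient_map_def)
  then have "f ` (topspace Y \<inter> {y \<in> topspace Y. f y \<in> V}) = topspace (top_of_set S) \<inter> V"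
    using assms(3) by auto
  from homeomorphic_map_subtopologies[OF f this]
  have 1: "homeomorphic_map (subtopology Y {y \<in> topspace Y. f y \<in> V}) (top_of_set V) f"
    using assms(3) by (simp add: subtopology_subtopology Int_absorb1)
  have 2: "homeomorphic_map (top_of_set V) (top_of_set T) \<phi>"
    using assms(2) by (meson homeomorphic_map_maps homeomorphic_maps_iff_homeomorphism)
  show ?thesis using homeomorphic_map_compose[OF 1 2] by (simp add: o_def)
qed

text \<open>Inverse of stereographic projection from the pole \<open>(1, 0)\<close>.\<close>

definition stereo_inv :: "complex \<Rightarrow> real \<times> complex" where
  "stereo_inv w = (((cmod w)\<^sup>2 - 1) / ((cmod w)\<^sup>2 + 1), (2 / ((cmod w)\<^sup>2 + 1)) *\<^sub>R w)"

lemma sph_fst_ne_1: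
  assumes "p \<in> sph" "p \<noteq> (1, 0)"
  shows "fst p < 1"
proof -
  have e: "(fst p)\<^sup>2 + (cmod (snd p))\<^sup>2 = 1" using assms mem_sph by blast
  have "fst p \<noteq> 1"
  proof
    assume "fst p = 1"
    with e have "snd p = 0" by simp
    with \<open>fst p = 1\<close> assms(2) show False by (cases p) auto
  qed
  moreover have "(fst p)\<^sup>2 \<le> 1" using e by (smt (verit) zero_le_power2)
  then have "fst p \<le> 1" using power2_le_imp_le[of "fst p" 1] by simp
  ultimately show ?thesis by simp
qed

lemma stereo_homeomorphism:
  "homeomorphism (sph - {(1, 0)}) UNIV (\<lambda>p. snd p /\<^sub>R (1 - fst p)) stereo_inv"
proof (rule homeomorphismI)
  show "continuous_on (sph - {(1, 0)}) (\<lambda>p. snd p /\<^sub>R (1 - fst p))"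
    using sph_fst_ne_1 by (intro continuous_intros) force
  have pos: "(cmod w)\<^sup>2 + 1 > 0" for w by (smt (verit) zero_le_power2)
  then have ne: "(cmod w)\<^sup>2 + 1 \<noteq> 0" for w by (metis less_irrefl)
  show "continuous_on UNIV stereo_inv"
    unfolding stereo_inv_def by (intro continuous_intros) (use ne in auto)
  show "stereo_inv ` UNIV \<subseteq> sph - {(1, 0)}"
  proof clarsimp
    fix w
    have "(((cmod w)\<^sup>2 - 1) / ((cmod w)\<^sup>2 + 1))\<^sup>2 + (2 / ((cmod w)\<^sup>2 + 1) * cmod w)\<^sup>2 = 1"
      using ne[of w] by (simp add: divide_simps power_mult_distrib) (simp add: algebra_simps power2_eq_square)
    then have "stereo_inv w \<in> sph"
      unfolding mem_sph stereo_inv_def using pos[of w] by (simp add: abs_of_pos)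
    moreover have "fst (stereo_inv w) \<noteq> 1" using ne[of w] by (simp add: stereo_inv_def)
    ultimately show "norm (stereo_inv w) = 1 \<and> stereo_inv w \<noteq> (1, 0)" by auto
  qed
  show "stereo_inv (snd p /\<^sub>R (1 - fst p)) = p" if "p \<in> sph - {(1, 0)}" for p
  proof (cases p)
    case (Pair s c)
    have s: "s < 1" using sph_fst_ne_1[of p] that Pair by auto
    have c: "(cmod c)\<^sup>2 = 1 - s\<^sup>2" using that mem_sph[of p] Pair by simp
    have "(cmod (c /\<^sub>R (1 - s)))\<^sup>2 = (1 - s\<^sup>2) / (1 - s)\<^sup>2"
      using s by (simp add: power_mult_distrib c power_divide divide_inverse_commute power_inverse)
    also have "\<dots> = (1 + s) / (1 - s)" using s by (simp add: divide_simps) (simp add: algebra_simps power2_eq_square)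
    finally have n: "(cmod (c /\<^sub>R (1 - s)))\<^sup>2 = (1 + s) / (1 - s)" .
    have n1: "(1 + s) / (1 - s) + 1 = 2 / (1 - s)" and n2: "(1 + s) / (1 - s) - 1 = 2 * s / (1 - s)"
      using s by (simp_all add: field_simps)
    have "2 / (2 / (1 - s)) * inverse (1 - s) = 1" "2 * s / (1 - s) / (2 / (1 - s)) = s"
      using s by (simp_all add: divide_simps)
    then show ?thesis
      unfolding stereo_inv_def Pair fst_conv snd_conv n n1 n2 scaleR_scaleR by simp
  qed
  show "snd (stereo_inv w) /\<^sub>R (1 - fst (stereo_inv w)) = w" if "w \<in> UNIV" for w
  proof -
    have "1 - ((cmod w)\<^sup>2 - 1) / ((cmod w)\<^sup>2 + 1) = 2 / ((cmod w)\<^sup>2 + 1)"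
      using ne[of w] by (simp add: field_simps)
    moreover have "inverse (2 / ((cmod w)\<^sup>2 + 1)) * (2 / ((cmod w)\<^sup>2 + 1)) = 1"
      using ne[of w] by (simp add: divide_simps)
    ultimately show ?thesis unfolding stereo_inv_def fst_conv snd_conv scaleR_scaleR by (simp only: scaleR_one)
  qed
qed simp

text \<open>A half-turn exchanging the poles. The conjugation is essential: it makes the transition
  between the charts \<open>1/z\<close> rather than its conjugate, which would reverse
  orientation.\<close>

definition flip_sph :: "real \<times> complex \<Rightarrow> real \<times> complex" where "flip_sph p = (- fst p, cnj (snd p))"

lemma flip_homeomorphism: "homeomorphism (sph - {(-1, 0)}) (sph - {(1, 0)}) flip_sph flip_sph"
proof (rule homeomorphismI)
  show "continuous_on (sph - {(-1, 0)}) flip_sph" "continuous_on (sph - {(1, 0)}) flip_sph"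
    unfolding flip_sph_def by (intro continuous_intros)+
  have "flip_sph p \<in> sph \<longleftrightarrow> p \<in> sph" for p unfolding mem_sph by (simp add: flip_sph_def)
  then show "flip_sph ` (sph - {(-1, 0)}) \<subseteq> sph - {(1, 0)}" "flip_sph ` (sph - {(1, 0)}) \<subseteq> sph - {(-1, 0)}"
    by (auto simp: flip_sph_def)
qed (auto simp: flip_sph_def)

lemma homeomorphic_S2_sph:
  assumes "Y homeomorphic_space S2"
  obtains f where "homeomorphic_map Y (top_of_set sph) f"
  using homeomorphic_space_trans[OF assms S2_sph] by (auto simp: homeomorphic_space)

lemma S2_closed_orientable_surface:
  assumes Y: "Y homeomorphic_space S2"
  shows "closed_orientable_surface Y"
proof -
  obtain f where f: "homeomorphic_map Y (top_of_set sph) f"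
    using homeomorphic_S2_sph[OF Y] .
  have fim: "f ` topspace Y = sph" using f by (auto simp: homeomorphic_map_def quotient_map_def)
  have hs: "Y homeomorphic_space top_of_set sph" using f homeomorphic_space by blast
  have ctf: "continuous_map Y (top_of_set sph) f" using f homeomorphic_imp_continuous_map by blast
  define U1 where "U1 = {y \<in> topspace Y. f y \<in> sph - {(1, 0)}}"
  define U2 where "U2 = {y \<in> topspace Y. f y \<in> sph - {(-1, 0)}}"
  define \<phi>1 where "\<phi>1 y = snd (f y) /\<^sub>R (1 - fst (f y))" for y
  define \<phi>2 where "\<phi>2 y = snd (flip_sph (f y)) /\<^sub>R (1 - fst (flip_sph (f y)))" for y
  have h1: "homeomorphic_map (subtopology Y U1) (top_of_set UNIV) \<phi>1"
    unfolding U1_def \<phi>1_def by (rule homeomorphic_map_chart_pullback[OF f stereo_homeomorphism]) auto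
  have h2: "homeomorphic_map (subtopology Y U2) (top_of_set UNIV) \<phi>2"
    using homeomorphic_map_chart_pullback[OF f homeomorphism_compose[OF flip_homeomorphism stereo_homeomorphism]]
    unfolding U2_def \<phi>2_def by (auto simp: o_def)
  have im: "\<phi>1 ` U1 = UNIV" "\<phi>2 ` U2 = UNIV"
    using h1 h2 by (auto simp: homeomorphic_map_def quotient_map_def U1_def U2_def)
  have "topspace Y \<inter> U1 = U1" "topspace Y \<inter> U2 = U2" by (auto simp: U1_def U2_def)
  then have inj: "inj_on \<phi>1 U1" "inj_on \<phi>2 U2"
    using h1 h2 by (simp_all add: homeomorphic_map_def)
  have op: "openin Y U1" "openin Y U2"
    unfolding U1_def U2_def
    by (rule openin_continuous_map_preimage[OF ctf]; simp add: openin_open_eq open_delete openin_delete)+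
  have ch: "surface_chart Y U1 \<phi>1" "surface_chart Y U2 \<phi>2"
    unfolding surface_chart_def im using op h1 h2 by auto
  \<comment> \<open>With \<open>f y = (s, c)\<close> the charts are \<open>c / (1 - s)\<close> and
    \<open>cnj c / (1 + s)\<close>, and their product is
    \<open>(cmod c)\<^sup>2 / (1 - s\<^sup>2) = 1\<close>.\<close>
  have inv: "\<phi>1 y \<noteq> 0 \<and> \<phi>2 y = inverse (\<phi>1 y)" if "y \<in> U1 \<inter> U2" for y
  proof -
    obtain s c where sc: "f y = (s, c)" by (cases "f y")
    have p: "f y \<in> sph" "f y \<noteq> (1,0)" "f y \<noteq> (-1, 0)" using that by (auto simp: U1_def U2_def)
    have s1: "s < 1" using sph_fst_ne_1[OF p(1,2)] sc by simp
    have "flip_sph (f y) \<in> sph - {(1, 0)}" using p flip_homeomorphism unfolding homeomorphism_def by blast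
    then have s2: "s > -1" using sph_fst_ne_1[of "flip_sph (f y)"] sc by (auto simp: flip_sph_def)
    have c2: "(cmod c)\<^sup>2 = 1 - s\<^sup>2" using p(1) mem_sph[of "f y"] sc by simp
    have "1 - s\<^sup>2 = (1 - s) * (1 + s)" by (simp add: power2_eq_square algebra_simps)
    then have "1 - s\<^sup>2 \<noteq> 0" using s1 s2 by simp
    then have c0: "c \<noteq> 0" using c2 by auto
    have ph: "\<phi>1 y = c / of_real (1 - s)" "\<phi>2 y = cnj c / of_real (1 + s)"
      by (simp_all add: \<phi>1_def \<phi>2_def sc flip_sph_def scaleR_conv_of_real divide_inverse mult.commute)
    have "\<phi>1 y * \<phi>2 y = of_real ((cmod c)\<^sup>2) / of_real ((1 - s) * (1 + s))"
      unfolding ph by (simp add: complex_norm_square flip: of_real_power)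
    also have "\<dots> = 1" unfolding c2 \<open>1 - s\<^sup>2 = (1 - s) * (1 + s)\<close> 
      using s1 s2 by (intro divide_self) (simp only: of_real_eq_0_iff, simp)
    finally have "\<phi>1 y * \<phi>2 y = 1" .
    then show ?thesis by (metis inverse_unique mult_zero_left zero_neq_one)
  qed
  have inv': "\<phi>2 y \<noteq> 0 \<and> \<phi>1 y = inverse (\<phi>2 y)" if "y \<in> U1 \<inter> U2" for y
    using inv[OF that] by simp
  have self: "orientation_preserving_on (\<phi> ` (U \<inter> U)) (\<phi> \<circ> inv_into U \<phi>)" for U and \<phi> :: "'a \<Rightarrow> complex"
    by (rule orientation_preserving_id) (auto simp: f_inv_into_f)
  have t12: "orientation_preserving_on (\<phi>1 ` (U1 \<inter> U2)) (\<phi>2 \<circ> inv_into U1 \<phi>1)"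
    by (rule orientation_preserving_inverse) (use inv inj in \<open>auto simp: inv_into_f_f\<close>)
  have t21: "orientation_preserving_on (\<phi>2 ` (U2 \<inter> U1)) (\<phi>1 \<circ> inv_into U2 \<phi>2)"
    by (rule orientation_preserving_inverse) (use inv' inj in \<open>auto simp: inv_into_f_f\<close>)
  have cov: "U1 \<union> U2 = topspace Y" using fim by (auto simp: U1_def U2_def)
  have "oriented_atlas Y {(U1, \<phi>1), (U2, \<phi>2)}"
    unfolding oriented_atlas_def using ch cov self t12 t21 by auto
  moreover have "(1, 0) \<in> sph" by (simp add: norm_Pair)
  then have "topspace Y \<noteq> {}" using fim by (metis empty_iff image_is_empty)
  moreover have "connected_space Y"
    using path_connected_space_homeomorphic_S2[OF Y] path_connected_imp_connected_space by blast
  moreover have "compact_space Y"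
    using homeomorphic_compact_space[OF hs] by (simp add: compact_space_subtopology)
  moreover have "Hausdorff_space Y"
    using homeomorphic_Hausdorff_space[OF hs] by (simp add: Hausdorff_space_subtopology)
  ultimately show ?thesis unfolding closed_orientable_surface_def by blast
qed

lemma S2_openin_delete:
  assumes "Y homeomorphic_space S2"
  shows "openin Y (topspace Y - {b})"
proof -
  have "t1_space Y"
    using S2_closed_orientable_surface[OF assms] by (simp add: closed_orientable_surface_def Hausdorff_imp_t1_space)
  then show ?thesis by (metis openin_topspace t1_space_openin_delete_alt)
qed

text \<open>Supplies a complex coordinate off any chosen point, used both to put a branching value
  at infinity and to turn the source minus one point into a plane.\<close>

lemma S2_punctured:
  assumes Y: "Y homeomorphic_space S2" and b: "b \<in> topspace Y"
  obtains c where "homeomorphic_map (subtopology Y (topspace Y - {b})) (euclidean :: complex topology) c"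
proof -
  obtain f where f: "homeomorphic_map Y (top_of_set sph) f"
    using homeomorphic_S2_sph[OF Y] .
  have fim: "f ` topspace Y = sph" and inj: "inj_on f (topspace Y)"
    using f by (auto simp: homeomorphic_map_def quotient_map_def)
  have "(sph - {f b}) homeomorphic (UNIV :: complex set)"
    by (rule homeomorphic_punctured_sphere_affine) (use fim b in auto)
  then obtain \<phi> \<psi> where "homeomorphism (sph - {f b}) (UNIV :: complex set) \<phi> \<psi>"
    by (auto simp: homeomorphic_def)
  from homeomorphic_map_chart_pullback[OF f this]
  have "homeomorphic_map (subtopology Y {y \<in> topspace Y. f y \<in> sph - {f b}}) euclidean (\<lambda>y. \<phi> (f y))"
    by auto
  moreover have "{y \<in> topspace Y. f y \<in> sph - {f b}} = topspace Y - {b}"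
    using inj b fim by (auto dest: inj_onD)
  ultimately show ?thesis using that by auto
qed

section \<open>Continuous square roots in the plane\<close>

text \<open>Pulled back by \<open>exp\<close>, the punctured disc becomes a half-plane, where a
  logarithm \<open>L\<close> exists. Its increment over the period \<open>2 * pi * \<i>\<close> is a
  constant multiple \<open>m\<close> of the period, the winding number about the puncture;
  subtracting \<open>m * \<zeta>\<close> makes \<open>L\<close> periodic, so that it
  descends.\<close>

lemma continuous_root_punctured_log:
  fixes p :: "complex \<Rightarrow> complex"
  assumes "0 < r" "continuous_on (ball 0 r - {0}) p" "\<And>w. w \<in> ball 0 r - {0} \<Longrightarrow> p w \<noteq> 0"
  obtains m :: int and l where "continuous_on (ball 0 r - {0}) l"
    "\<And>w. w \<in> ball 0 r - {0} \<Longrightarrow> p w = w powi m * exp (l w)"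
proof -
  define S where "S = {\<zeta>::complex. Re \<zeta> < ln r}"
  have S: "exp \<zeta> \<in> ball 0 r - {0}" if "\<zeta> \<in> S" for \<zeta>
    using that assms(1) by (simp add: S_def) (metis exp_less_cancel_iff exp_ln)
  have "convex S" unfolding S_def by (rule convex_halfspace_Re_lt)
  then have "contractible S" by (rule convex_imp_contractible)
  moreover have "continuous_on S (\<lambda>\<zeta>. p (exp \<zeta>))"
    by (rule continuous_on_compose2[OF assms(2)]) (auto intro!: continuous_intros S)
  ultimately obtain L where L: "continuous_on S L" "\<And>\<zeta>. \<zeta> \<in> S \<Longrightarrow> p (exp \<zeta>) = exp (L \<zeta>)"
    using continuous_logarithm_on_contractible[of S "\<lambda>\<zeta>. p (exp \<zeta>)"] S assms(3) by metis
  let ?T = "2 * of_real pi * \<i>"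
  have ST: "\<zeta> + of_int k * ?T \<in> S \<longleftrightarrow> \<zeta> \<in> S" for \<zeta> k by (simp add: S_def)
  have ST1: "\<zeta> + ?T \<in> S \<longleftrightarrow> \<zeta> \<in> S" for \<zeta> by (simp add: S_def)
  have int: "\<exists>n::int. L (\<zeta> + ?T) - L \<zeta> = of_int n * ?T" if "\<zeta> \<in> S" for \<zeta>
  proof -
    have "exp (L (\<zeta> + ?T)) = exp (L \<zeta>)"
      using L(2)[of \<zeta>] L(2)[of "\<zeta> + ?T"] that ST1 by (simp add: exp_add exp_two_pi_i')
    then show ?thesis
      unfolding exp_eq by (auto simp: algebra_simps)
  qed
  have "(\<lambda>\<zeta>. L (\<zeta> + ?T) - L \<zeta>) constant_on S"
  proof (rule exp_constant_imp_constant_on)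
    show "connected S" using \<open>convex S\<close> by (rule convex_connected)
    show "continuous_on S (\<lambda>\<zeta>. L (\<zeta> + ?T) - L \<zeta>)"
      by (intro continuous_intros L continuous_on_compose2[OF L(1)]) (auto simp: ST1)
    show "exp (L (\<zeta> + ?T) - L \<zeta>) = 1" if "\<zeta> \<in> S" for \<zeta>
      using L(2)[of \<zeta>] L(2)[of "\<zeta> + ?T"] that ST1 by (simp add: exp_add exp_diff exp_two_pi_i')
  qed
  then obtain C where C: "\<And>\<zeta>. \<zeta> \<in> S \<Longrightarrow> L (\<zeta> + ?T) - L \<zeta> = C"
    unfolding constant_on_def by (metis (no_types, lifting))
  have S0: "of_real (ln r - 1) \<in> S" by (simp add: S_def)
  obtain m where m: "C = of_int m * ?T" using int[OF S0] C[OF S0] by auto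
  define M where "M \<zeta> = L \<zeta> - of_int m * \<zeta>" for \<zeta>
  have M1: "M (\<zeta> + ?T) = M \<zeta>" if "\<zeta> \<in> S" for \<zeta>
    using C[OF that] m by (simp add: M_def algebra_simps)
  have Mnat: "M (\<zeta> + of_nat k * ?T) = M \<zeta>" if "\<zeta> \<in> S" for \<zeta> k
  proof (induction k)
    case (Suc k)
    have "\<zeta> + of_nat k * ?T \<in> S" using ST[of \<zeta> "int k"] that by simp
    from M1[OF this] Suc show ?case by (simp add: algebra_simps)
  qed simp
  have Mper: "M (\<zeta> + of_int k * ?T) = M \<zeta>" if "\<zeta> \<in> S" for \<zeta> k
  proof (cases "k \<ge> 0")
    case True
    then show ?thesis using Mnat[OF that, of "nat k"] by simp
  next
    case False
    have "\<zeta> + of_int k * ?T \<in> S" using ST that by simp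
    from Mnat[OF this, of "nat (-k)"] False show ?thesis by simp
  qed
  have Mexp: "M \<zeta> = M \<xi>" if "\<zeta> \<in> S" "exp \<zeta> = exp \<xi>" for \<zeta> \<xi>
  proof -
    obtain n :: int where "\<zeta> = \<xi> + of_real (real_of_int (2 * n) * pi) * \<i>" using \<open>exp \<zeta> = exp \<xi>\<close> unfolding exp_eq by blast
    then have "\<xi> = \<zeta> + of_int (-n) * ?T" by (simp add: algebra_simps)
    then show ?thesis using Mper[OF \<open>\<zeta> \<in> S\<close>, of "-n"] by simp
  qed
  have Mcont: "continuous_on S M" unfolding M_def by (intro continuous_intros L)
  define l where "l w = M (Ln w)" for w
  have LnS: "Ln w \<in> S" if "w \<in> ball 0 r - {0}" for w
    using that assms(1) by (simp add: S_def)
  show ?thesis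
  proof
    show "p w = w powi m * exp (l w)" if w: "w \<in> ball 0 r - {0}" for w
    proof -
      have "p w = exp (L (Ln w))" using L(2)[OF LnS[OF w]] w by simp
      also have "L (Ln w) = of_int m * Ln w + l w" by (simp add: l_def M_def)
      also have "exp \<dots> = w powi m * exp (l w)"
        using w by (simp add: exp_add exp_power_int[symmetric] mult.commute)
      finally show ?thesis .
    qed
    have "isCont l w0" if w0: "cmod w0 < r" "w0 \<noteq> 0" for w0
    proof -
      \<comment> \<open>\<open>Ln\<close> jumps on the negative axis. Near \<open>w0\<close> the
        branch \<open>h\<close> is continuous, and periodicity of \<open>M\<close> makes
        \<open>M \<circ> h\<close> agree with \<open>l\<close> there.\<close>
      define h where "h w = Ln w0 + Ln (w / w0)" for w
      have hw0: "h w0 = Ln w0" using w0 by (simp add: h_def)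
      have "isCont h w0" unfolding h_def using w0 by (intro continuous_intros) auto
      moreover have "isCont M (h w0)"
        using Mcont LnS[of w0] w0 unfolding hw0
        by (simp add: continuous_on_eq_continuous_at S_def open_halfspace_Re_lt)
      ultimately have "isCont (\<lambda>w. M (h w)) w0" by (rule isCont_o2)
      moreover have "\<forall>\<^sub>F w in nhds w0. M (h w) = l w"
      proof -
        have "\<forall>\<^sub>F w in nhds w0. w \<in> ball 0 r - {0}"
          using w0 by (intro eventually_nhds_in_open) (auto simp: open_delete)
        then show ?thesis
        proof eventually_elim
          case (elim w)
          have "exp (Ln w) = exp (h w)"
            using elim w0 by (simp add: h_def exp_add)
          then show ?case unfolding l_def using Mexp[OF LnS[OF elim]] by simp
        qed
      qed
      ultimately show ?thesis using isCont_cong[of "\<lambda>w. M (h w)" l w0] by blast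
    qed
    then show "continuous_on (ball 0 r - {0}) l"
      by (simp add: continuous_on_eq_continuous_at open_delete)
  qed
qed

lemma powi_double: "(w::complex) powi (2 * m) = (w powi m) ^ 2"
  by (metis power_int_mult power_int_numeral mult.commute)

lemma continuous_on_powi [continuous_intros]:
  fixes f :: "'a::topological_space \<Rightarrow> complex"
  assumes "continuous_on S f" "\<And>x. x \<in> S \<Longrightarrow> f x \<noteq> 0"
  shows "continuous_on S (\<lambda>x. f x powi m)"
  using assms by (intro continuous_on_power_int) auto

text \<open>The exponent \<open>m\<close> cannot be odd: otherwise \<open>l (- w) - l w\<close>
  would be a constant logarithm of -1 that is negated by exchanging \<open>w\<close> and
  \<open>- w\<close>. An even exponent is halved together with the logarithm.\<close>

lemma even_punctured_has_root:
  fixes g :: "complex \<Rightarrow> complex"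
  assumes "0 < r" "continuous_on (ball 0 r - {0}) g" "\<And>w. w \<in> ball 0 r - {0} \<Longrightarrow> g w \<noteq> 0"
    and even: "\<And>w. w \<in> ball 0 r - {0} \<Longrightarrow> g (- w) = g w"
  obtains s where "continuous_on (ball 0 r - {0}) s" "\<And>w. w \<in> ball 0 r - {0} \<Longrightarrow> s w ^ 2 = g w"
proof -
  let ?B = "ball 0 r - {0} :: complex set"
  obtain m l where l: "continuous_on ?B l" "\<And>w. w \<in> ?B \<Longrightarrow> g w = w powi m * exp (l w)"
    using continuous_root_punctured_log[OF assms(1-3)] by metis
  have "even m"
  proof (rule ccontr)
    assume odd: "odd m"
    have neg: "- w \<in> ?B" if "w \<in> ?B" for w using that by auto
    have conn: "connected ?B"
      by (intro connected_open_delete) (auto simp: convex_connected)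
    have ex: "exp (l (- w) - l w) = -1" if "w \<in> ?B" for w
    proof -
      have "(- w) powi m * exp (l (- w)) = w powi m * exp (l w)"
        using l(2)[OF that] l(2)[OF neg[OF that]] even[OF that] by simp
      moreover have "(- w) powi m = - (w powi m)" using odd by (rule power_int_minus_left_odd)
      ultimately have "w powi m * (- exp (l (- w))) = w powi m * exp (l w)" by simp
      then have "- exp (l (- w)) = exp (l w)" using that by (subst (asm) mult_cancel_left) auto
      then have "exp (l (- w)) = - exp (l w)" by (metis minus_minus)
      then show ?thesis by (simp add: exp_diff)
    qed
    have "(\<lambda>w. l (- w) - l w) constant_on ?B"
    proof (rule exp_constant_imp_constant_on[OF conn _ ex])
      show "continuous_on ?B (\<lambda>w. l (- w) - l w)"
        by (intro continuous_intros l continuous_on_compose2[OF l(1)]) auto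
    qed
    then obtain C where C: "\<And>w. w \<in> ?B \<Longrightarrow> l (- w) - l w = C"
      unfolding constant_on_def by blast
    have w0: "of_real (r/2) \<in> ?B" using assms(1) by auto
    have "C = - C" using C[OF w0] C[OF neg[OF w0]] by (simp add: algebra_simps)
    then have "C = 0" by simp
    then show False using ex[OF w0] C[OF w0] by simp
  qed
  then obtain j where j: "m = 2 * j" by blast
  show ?thesis
  proof
    show "continuous_on ?B (\<lambda>w. w powi j * exp (l w / 2))"
      by (intro continuous_intros l) auto
    show "(w powi j * exp (l w / 2)) ^ 2 = g w" if "w \<in> ?B" for w
      using l(2)[OF that] by (simp add: j powi_double power_mult_distrib flip: exp_double)
  qed
qed

text \<open>One puncture at a time: near \<open>a\<close> a local root is \<open>(z - a) powi m * exp l\<close>, and multiplying \<open>l\<close> by a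
  bump function turns it into a function \<open>t\<close> on the whole plane punctured at \<open>a\<close>, so that
  \<open>g / t\<^sup>2\<close> extends over \<open>a\<close>.\<close>

lemma global_square_root:
  fixes g :: "complex \<Rightarrow> complex"
  assumes "finite Q" "continuous_on (- Q) g" "\<And>z. z \<notin> Q \<Longrightarrow> g z \<noteq> 0"
    and "\<And>a. a \<in> Q \<Longrightarrow> \<exists>r>0. \<exists>s. continuous_on (ball a r - {a}) s \<and> (\<forall>z \<in> ball a r - {a}. s z ^ 2 = g z)"
  obtains s where "continuous_on (- Q) s" "\<And>z. z \<notin> Q \<Longrightarrow> s z ^ 2 = g z"
proof -
  have "\<exists>s. continuous_on (- Q) s \<and> (\<forall>z. z \<notin> Q \<longrightarrow> s z ^ 2 = g z)"
    using assms
  proof (induction Q arbitrary: g rule: finite_induct)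
    case empty
    have "contractible (UNIV :: complex set)" by (rule convex_imp_contractible) simp
    then obtain l where l: "continuous_on UNIV l" "\<And>z. g z = exp (l z)"
      using continuous_logarithm_on_contractible[of UNIV g] empty by auto
    show ?case
      by (rule exI[of _ "\<lambda>z. exp (l z / 2)"])
        (auto simp: l(2) intro!: continuous_intros l(1) simp flip: exp_double)
  next
    case (insert a Q)
    obtain r0 s where r0: "r0 > 0" "continuous_on (ball a r0 - {a}) s" "\<forall>z \<in> ball a r0 - {a}. s z ^ 2 = g z"
      using insert.prems(3)[of a] by blast
    have "open (- Q)" using insert by (simp add: finite_imp_closed open_Compl)
    then obtain r1 where r1: "r1 > 0" "ball a r1 \<subseteq> - Q"
      using insert.hyps by (metis ComplI open_contains_ball)
    define r where "r = min r0 r1"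
    have r: "r > 0" "ball a r \<subseteq> ball a r0" "ball a r \<subseteq> - Q"
      using r0 r1 by (auto simp: r_def)
    define p where "p w = s (a + w)" for w
    have pb: "a + w \<in> ball a r - {a}" if "w \<in> ball 0 r - {0}" for w
      using that by (auto simp: dist_norm)
    have g0: "g z \<noteq> 0" if "z \<in> ball a r - {a}" for z
      using insert.prems(2)[of z] that r by auto
    have "continuous_on (ball 0 r - {0}) p"
      unfolding p_def using pb r by (intro continuous_on_compose2[OF r0(2)] continuous_intros) auto
    moreover have "p w \<noteq> 0" if "w \<in> ball 0 r - {0}" for w
    proof -
      have "p w ^ 2 = g (a + w)" unfolding p_def using pb[OF that] r r0(3) by blast
      then show ?thesis using g0[OF pb[OF that]] by auto
    qed
    ultimately obtain m l where l: "continuous_on (ball 0 r - {0}) l"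
      "\<And>w. w \<in> ball 0 r - {0} \<Longrightarrow> p w = w powi m * exp (l w)"
      using continuous_root_punctured_log[OF r(1)] by metis
    \<comment> \<open>Equal to 1 within \<open>r / 3\<close> of \<open>a\<close> and to 0 beyond
      \<open>2 * r / 3\<close>, so that \<open>e\<close> is the true logarithm near \<open>a\<close>
      and vanishes before the rim of the disc.\<close>
    define bump :: "complex \<Rightarrow> real" where "bump z = max 0 (min 1 (2 - 3 * cmod (z - a) / r))" for z
    have bump_cont: "continuous_on UNIV bump" unfolding bump_def using r by (intro continuous_intros) auto
    have bump_0: "bump z = 0" if "cmod (z - a) \<ge> 2 * r / 3" for z
    proof -
      have "2 - 3 * cmod (z - a) / r \<le> 0" using that r by (simp add: field_simps)
      then show ?thesis by (simp add: bump_def)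
    qed
    have bump_1: "bump z = 1" if "cmod (z - a) \<le> r / 3" for z
    proof -
      have "2 - 3 * cmod (z - a) / r \<ge> 1" using that r by (simp add: field_simps)
      then show ?thesis by (simp add: bump_def)
    qed
    define e where "e z = (if z \<in> ball a r then bump z * l (z - a) else 0)" for z
    define t where "t z = (z - a) powi m * exp (e z)" for z
    have lc: "continuous_on (ball a r - {a}) (\<lambda>z. l (z - a))"
      by (rule continuous_on_compose2[OF l(1)]) (auto intro!: continuous_intros simp: dist_norm norm_minus_commute)
    have ec: "continuous_on (- {a}) e"
    proof -
      have "continuous_on (ball a r - {a} \<union> - cball a (2*r/3)) e"
      proof (rule continuous_on_open_Un)
        show "open (ball a r - {a})" by (simp add: open_delete)
        show "open (- cball a (2*r/3))" by (simp add: open_Compl)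
        have "continuous_on (ball a r - {a}) (\<lambda>z. bump z * l (z - a))"
          by (intro continuous_intros lc continuous_on_subset[OF bump_cont]) auto
        then show "continuous_on (ball a r - {a}) e"
          by (rule continuous_on_eq) (auto simp: e_def)
        have "continuous_on (- cball a (2*r/3)) (\<lambda>z. 0)" by simp
        then show "continuous_on (- cball a (2*r/3)) e"
          by (rule continuous_on_eq) (auto simp: e_def dist_norm norm_minus_commute bump_0)
      qed
      moreover have "- {a} \<subseteq> ball a r - {a} \<union> - cball a (2*r/3)"
        using r by (auto simp: dist_norm)
      ultimately show ?thesis by (rule continuous_on_subset)
    qed
    have tc: "continuous_on (- {a}) t"
      unfolding t_def by (intro continuous_intros ec) auto
    have t0: "t z \<noteq> 0" if "z \<noteq> a" for z using that by (simp add: t_def)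
    have gt: "t z ^ 2 = g z" if "z \<in> ball a (r/3) - {a}" for z
    proof -
      have z: "z - a \<in> ball 0 r - {0}" "cmod (z - a) \<le> r / 3" "z \<in> ball a r - {a}"
        using that r by (auto simp: dist_norm norm_minus_commute)
      have "t z = p (z - a)" using l(2)[OF z(1)] z by (simp add: t_def e_def bump_1)
      then show ?thesis using r0(3) r z by (auto simp: p_def)
    qed
    \<comment> \<open>Near \<open>a\<close> the quotient is identically 1, so the value 1 fills the
      puncture continuously.\<close>
    define G where "G z = (if z = a then 1 else g z / t z ^ 2)" for z
    have G1: "G z = 1" if "z \<in> ball a (r/3)" for z
    proof (cases "z = a")
      case False
      then have "G z = g z / g z" using gt[of z] that by (simp add: G_def)
      moreover have "g z \<noteq> 0" using g0[of z] that False r by auto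
      ultimately show ?thesis by simp
    qed (simp add: G_def)
    have Gc: "continuous_on (- Q) G"
    proof -
      have "continuous_on (ball a (r/3) \<union> - insert a Q) G"
      proof (rule continuous_on_open_Un)
        have "continuous_on (ball a (r/3)) (\<lambda>z. 1)" by simp
        then show "continuous_on (ball a (r/3)) G"
          by (rule continuous_on_eq) (auto simp: G1)
        show "open (- insert a Q)" using insert.hyps by (simp add: finite_imp_closed open_Compl)
        have "continuous_on (- insert a Q) (\<lambda>z. g z / t z ^ 2)"
          using t0 by (intro continuous_intros insert.prems continuous_on_subset[OF tc]) auto
        then show "continuous_on (- insert a Q) G"
          by (rule continuous_on_eq) (auto simp: G_def)
      qed simp
      then show ?thesis by (rule continuous_on_subset) (use r in auto)
    qed
    have G0: "G z \<noteq> 0" if "z \<notin> Q" for z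
      using that insert.prems(2)[of z] t0[of z] by (auto simp: G_def)
    have "\<exists>r>0. \<exists>s. continuous_on (ball b r - {b}) s \<and> (\<forall>z \<in> ball b r - {b}. s z ^ 2 = G z)" if b: "b \<in> Q" for b
    proof -
      obtain rb sb where rb: "rb > 0" "continuous_on (ball b rb - {b}) sb" "\<forall>z \<in> ball b rb - {b}. sb z ^ 2 = g z"
        using insert.prems(3)[of b] b by blast
      have ba: "b \<noteq> a" using b insert.hyps by auto
      \<comment> \<open>Staying closer to \<open>b\<close> than \<open>a\<close> is keeps
        \<open>t\<close> continuous and nonzero, so the old local root divided by \<open>t\<close>
        is one for \<open>G\<close>.\<close>
      define r' where "r' = min rb (dist b a)"
      have "continuous_on (ball b r' - {b}) (\<lambda>z. sb z / t z)"
        by (intro continuous_intros continuous_on_subset[OF rb(2)] continuous_on_subset[OF tc] ballI t0)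
          (auto simp: r'_def)
      moreover have "\<forall>z \<in> ball b r' - {b}. (sb z / t z) ^ 2 = G z"
        using rb(3) by (auto simp: r'_def G_def power_divide)
      moreover have "r' > 0" using rb ba by (simp add: r'_def)
      ultimately show ?thesis by blast
    qed
    then obtain S where S: "continuous_on (- Q) S" "\<And>z. z \<notin> Q \<Longrightarrow> S z ^ 2 = G z"
      using insert.IH[OF Gc G0] by blast
    have "continuous_on (- insert a Q) (\<lambda>z. S z * t z)"
      by (intro continuous_intros continuous_on_subset[OF S(1)] continuous_on_subset[OF tc]) auto
    moreover have "(S z * t z) ^ 2 = g z" if "z \<notin> insert a Q" for z
      using that S(2)[of z] t0[of z] by (auto simp: power_mult_distrib G_def)
    ultimately show ?case by blast
  qed
  then show ?thesis using that by blast
qed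

section \<open>Topological multiplicity\<close>

text \<open>A purely topological multiplicity: arbitrarily small neighbourhoods of \<open>x\<close> are \<open>k\<close>-to-one onto a
  punctured neighbourhood of \<open>h x\<close>. Unlike \<^const>\<open>locally_power_map\<close> it needs no charts and so passes
  easily to square roots of the map.\<close>

definition k_to_one_at :: "'a topology \<Rightarrow> 'b topology \<Rightarrow> ('a \<Rightarrow> 'b) \<Rightarrow> 'a \<Rightarrow> nat \<Rightarrow> 'a set \<Rightarrow> 'b set \<Rightarrow> bool" where
  "k_to_one_at X Y h x k U V \<longleftrightarrow>
     openin X U \<and> x \<in> U \<and> openin Y V \<and> h x \<in> V \<and> {u \<in> U. h u = h x} = {x} \<and>
     (\<forall>y \<in> V - {h x}. finite {u \<in> U. h u = y} \<and> card {u \<in> U. h u = y} = k)"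

definition multiplicity_at :: "'a topology \<Rightarrow> 'b topology \<Rightarrow> ('a \<Rightarrow> 'b) \<Rightarrow> 'a \<Rightarrow> nat \<Rightarrow> bool" where
  "multiplicity_at X Y h x k \<longleftrightarrow>
     (\<forall>W. openin X W \<and> x \<in> W \<longrightarrow> (\<exists>U V. U \<subseteq> W \<and> k_to_one_at X Y h x k U V))"

lemma multiplicity_atE:
  assumes "multiplicity_at X Y h x k" "openin X W" "x \<in> W"
  obtains U V where "U \<subseteq> W" "k_to_one_at X Y h x k U V"
  using assms unfolding multiplicity_at_def by meson

lemma k_to_one_atD:
  assumes "k_to_one_at X Y h x k U V"
  shows "openin X U" "x \<in> U" "openin Y V" "h x \<in> V" "{u \<in> U. h u = h x} = {x}"
    and "\<And>y. y \<in> V \<Longrightarrow> y \<noteq> h x \<Longrightarrow> finite {u \<in> U. h u = y}"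
    and "\<And>y. y \<in> V \<Longrightarrow> y \<noteq> h x \<Longrightarrow> card {u \<in> U. h u = y} = k"
  using assms by (simp_all add: k_to_one_at_def)

text \<open>Shrinking the neighbourhood for \<open>k'\<close> into the one for \<open>k\<close>
  makes its fibres subsets; a single point \<open>y\<close> near \<open>h x\<close> but different
  from it then compares the two numbers. \<open>perfect\<close> supplies that point.\<close>

lemma multiplicity_at_le:
  assumes "multiplicity_at X Y h x k" "multiplicity_at X Y h x k'" "x \<in> topspace X"
    and perfect: "\<And>V. openin Y V \<Longrightarrow> h x \<in> V \<Longrightarrow> V - {h x} \<noteq> {}"
  shows "k' \<le> k"
proof -
  obtain U V where "k_to_one_at X Y h x k U V"
    using multiplicity_atE[OF assms(1) openin_topspace assms(3)] by metis
  note U = k_to_one_atD[OF this]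
  obtain U' V' where "U' \<subseteq> U" "k_to_one_at X Y h x k' U' V'"
    using multiplicity_atE[OF assms(2) U(1,2)] by metis
  note U' = \<open>U' \<subseteq> U\<close> k_to_one_atD[OF this(2)]
  have "openin Y (V \<inter> V')" using U(3) U'(4) by blast
  then obtain y where y: "y \<in> V" "y \<in> V'" "y \<noteq> h x"
    using perfect[of "V \<inter> V'"] U(4) U'(5) by auto
  have "card {u \<in> U'. h u = y} \<le> card {u \<in> U. h u = y}"
    by (rule card_mono[OF U(6)[OF y(1,3)]]) (use U'(1) in auto)
  then show ?thesis using U(7)[OF y(1,3)] U'(8)[OF y(2,3)] by simp
qed

lemma multiplicity_at_unique:
  assumes "multiplicity_at X Y h x k" "multiplicity_at X Y h x k'" "x \<in> topspace X"
    and "\<And>V. openin Y V \<Longrightarrow> h x \<in> V \<Longrightarrow> V - {h x} \<noteq> {}"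
  shows "k = k'"
  using multiplicity_at_le[OF assms] multiplicity_at_le[OF assms(2,1,3,4)] by simp

lemma multiplicity_at_subtopology:
  assumes "multiplicity_at X Y h x k" "openin X X'" "x \<in> X'"
  shows "multiplicity_at (subtopology X X') Y h x k"
  unfolding multiplicity_at_def
proof (intro allI impI)
  fix W assume "openin (subtopology X X') W \<and> x \<in> W"
  then have W: "openin X W" "x \<in> W" "W \<subseteq> X'"
    using assms(2) by (auto simp: openin_open_subtopology)
  obtain U V where UV: "U \<subseteq> W" "k_to_one_at X Y h x k U V"
    by (rule multiplicity_atE[OF assms(1) W(1,2)])
  have "openin (subtopology X X') U"
    using k_to_one_atD(1)[OF UV(2)] UV(1) W(3) assms(2) by (auto simp: openin_open_subtopology)
  then have "k_to_one_at (subtopology X X') Y h x k U V" using UV(2) by (simp add: k_to_one_at_def)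
  with UV(1) show "\<exists>U V. U \<subseteq> W \<and> k_to_one_at (subtopology X X') Y h x k U V" by blast
qed

text \<open>Where \<open>g\<close> is injective, \<open>h u = y\<close> and \<open>f u = g y\<close>
  say the same, so \<open>h\<close> inherits the multiplicity of \<open>f\<close>. This transfers
  multiplicities from the cover to its square roots.\<close>

lemma multiplicity_at_factor:
  assumes f: "multiplicity_at X Z f x k" and "x \<in> topspace X" and h: "continuous_map X Y h"
    and g: "continuous_map Y Z g" and O1: "openin Y O1" "h x \<in> O1" "inj_on g O1"
    and fgh: "\<And>x. x \<in> topspace X \<Longrightarrow> f x = g (h x)"
  shows "multiplicity_at X Y h x k"
  unfolding multiplicity_at_def
proof (intro allI impI)
  fix W assume W: "openin X W \<and> x \<in> W"
  define W' where "W' = W \<inter> {u \<in> topspace X. h u \<in> O1}"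
  have W': "openin X W'" "x \<in> W'"
    using W O1 assms(2) openin_continuous_map_preimage[OF h O1(1)] by (auto simp: W'_def)
  obtain U V where "U \<subseteq> W'" "k_to_one_at X Z f x k U V" by (rule multiplicity_atE[OF f W'])
  note UV = \<open>U \<subseteq> W'\<close> k_to_one_atD[OF this(2)]
  define V' where "V' = O1 \<inter> {y \<in> topspace Y. g y \<in> V}"
  have fx: "f x = g (h x)" using fgh assms(2) by simp
  have hY: "h u \<in> O1" "u \<in> topspace X" if "u \<in> U" for u using that UV(1) by (auto simp: W'_def)
  have eq: "{u \<in> U. h u = y} = {u \<in> U. f u = g y}" if "y \<in> O1" for y
    using that hY fgh inj_on_eq_iff[OF O1(3)] by auto
  have gne: "g y \<noteq> f x" if "y \<in> O1" "y \<noteq> h x" for y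
    using that inj_on_eq_iff[OF O1(3) that(1) O1(2)] fx by simp
  have "openin Y V'" using O1(1) openin_continuous_map_preimage[OF g UV(4)] by (auto simp: V'_def)
  moreover have "h x \<in> V'" using O1 UV(5) fx openin_subset[OF O1(1)] by (auto simp: V'_def)
  moreover have "{u \<in> U. h u = h x} = {x}" using eq[OF O1(2)] fx UV(6) by simp
  ultimately have "k_to_one_at X Y h x k U V'"
    unfolding k_to_one_at_def using UV eq gne by (auto simp: V'_def)
  moreover have "U \<subseteq> W" using UV(1) by (auto simp: W'_def)
  ultimately show "\<exists>U V. U \<subseteq> W \<and> k_to_one_at X Y h x k U V" by blast
qed

text \<open>The weighted number of preimages is locally constant: it equals the cardinality of all nearby
  fibres, hence, comparing at a common nearby point, the weighted number at nearby points.\<close>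

lemma weighted_fibre_constant:
  assumes X: "Hausdorff_space X" and Y: "connected_space Y" "t1_space Y"
    and perfect: "\<And>V. openin Y V \<Longrightarrow> V \<noteq> {} \<Longrightarrow> infinite V"
    and h: "proper_map X Y h"
    and m: "\<And>x. x \<in> topspace X \<Longrightarrow> multiplicity_at X Y h x (k x)"
    and yz: "y \<in> topspace Y" "z \<in> topspace Y"
  shows "finite {x \<in> topspace X. h x = y}"
    "(\<Sum>x | x \<in> topspace X \<and> h x = y. k x) = (\<Sum>x | x \<in> topspace X \<and> h x = z. k x)"
proof -
  let ?F = "\<lambda>y. {x \<in> topspace X. h x = y}"
  have hX: "h ` topspace X \<subseteq> topspace Y" using proper_map_imp_subset_topspace[OF h] by blast
  \<comment> \<open>The fibre is compact by properness, and discrete because each of its points is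
    the only one in a suitable \<open>U\<close>.\<close>
  have fin: "finite (?F y)" if "y \<in> topspace Y" for y
  proof -
    have cpt: "compactin X (?F y)" using h that by (auto simp: proper_map_def)
    have "\<forall>x\<in>?F y. \<exists>U. openin X U \<and> x \<in> U \<and> U \<inter> ?F y \<subseteq> {x}"
    proof
      fix x assume "x \<in> ?F y"
      then have x: "x \<in> topspace X" "h x = y" by auto
      obtain U V where "k_to_one_at X Y h x (k x) U V"
        using multiplicity_atE[OF m[OF x(1)] openin_topspace x(1)] by metis
      note UV = k_to_one_atD[OF this]
      have "u = x" if "u \<in> U" "h u = y" for u
      proof -
        have "u \<in> {u \<in> U. h u = h x}" using that x(2) by simp
        then show ?thesis unfolding UV(5) by simp
      qed
      then have "U \<inter> ?F y \<subseteq> {x}" by auto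
      then show "\<exists>U. openin X U \<and> x \<in> U \<and> U \<inter> ?F y \<subseteq> {x}" using UV(1,2) by blast
    qed
    from bchoice[OF this] obtain U where U': "\<forall>x\<in>?F y. openin X (U x) \<and> x \<in> U x \<and> U x \<inter> ?F y \<subseteq> {x}"
      by (rule exE)
    note U = bspec[OF U']
    have "\<exists>\<F>. finite \<F> \<and> \<F> \<subseteq> U ` ?F y \<and> ?F y \<subseteq> \<Union>\<F>"
      by (rule compactinD[OF cpt]) (use U in auto)
    then obtain \<F> where F: "finite \<F>" "\<F> \<subseteq> U ` ?F y" "?F y \<subseteq> \<Union>\<F>" by blast
    have "finite (\<Union>A\<in>\<F>. A \<inter> ?F y)"
    proof (intro finite_UN_I F(1))
      fix A assume "A \<in> \<F>"
      then obtain x where "x \<in> ?F y" "A = U x" using F(2) by auto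
      then have "A \<inter> ?F y \<subseteq> {x}" using U by blast
      then show "finite (A \<inter> ?F y)" by (rule finite_subset) simp
    qed
    moreover have "?F y \<subseteq> (\<Union>A\<in>\<F>. A \<inter> ?F y)" using F(3) by blast
    ultimately show ?thesis by (rule rev_finite_subset)
  qed
  define N where "N y = (\<Sum>x\<in>?F y. k x)" for y
  have punct: "\<exists>V. openin Y V \<and> y \<in> V \<and> (\<forall>w \<in> V - {y}. card (?F w) = N y)" if y: "y \<in> topspace Y" for y
  proof -
    let ?P = "?F y"
    have finP: "finite ?P" by (rule fin[OF y])
    have "\<exists>D. (\<forall>x\<in>?P. openin X (D x) \<and> x \<in> D x) \<and> disjoint_family_on D ?P"
    proof -
      have ex: "\<exists>P. x \<noteq> x' \<longrightarrow> openin X (fst P) \<and> openin X (snd P) \<and> x \<in> fst P \<and> x' \<in> snd P \<and> fst P \<inter> snd P = {}"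
        if x: "x \<in> topspace X" "x' \<in> topspace X" for x x'
      proof (cases "x = x'")
        case False
        then obtain A B where "openin X A" "openin X B" "x \<in> A" "x' \<in> B" "disjnt A B"
          using X[unfolded Hausdorff_space_def, rule_format, OF conjI[OF x(1) conjI[OF x(2) False]]] by blast
        then show ?thesis by (intro exI[of _ "(A, B)"]) (simp add: disjnt_def)
      qed simp
      define Q where "Q x x' = (SOME P. x \<noteq> x' \<longrightarrow> openin X (fst P) \<and> openin X (snd P) \<and> x \<in> fst P \<and> x' \<in> snd P \<and> fst P \<inter> snd P = {})" for x x'
      define A where "A x x' = fst (Q x x')" for x x'
      define B where "B x x' = snd (Q x x')" for x x'
      have AB: "openin X (A x x') \<and> openin X (B x x') \<and> x \<in> A x x' \<and> x' \<in> B x x' \<and> A x x' \<inter> B x x' = {}"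
        if "x \<in> ?P" "x' \<in> ?P" "x \<noteq> x'" for x x'
      proof -
        have "x \<in> topspace X" "x' \<in> topspace X" using that by auto
        from someI_ex[OF ex[OF this]] that(3) show ?thesis unfolding A_def B_def Q_def by blast
      qed
      \<comment> \<open>Both orders of every pair are intersected, so that \<open>D x\<close> lies
        in \<open>A x x'\<close> while \<open>D x'\<close> lies in \<open>B x x'\<close>.\<close>
      define D where "D x = (\<Inter>x'\<in>?P - {x}. A x x' \<inter> B x' x) \<inter> topspace X" for x
      have "openin X (D x) \<and> x \<in> D x" if "x \<in> ?P" for x
      proof
        have "openin X (A x x' \<inter> B x' x)" if "x' \<in> ?P - {x}" for x' using AB \<open>x \<in> ?P\<close> that by auto
        then show "openin X (D x)"
          unfolding D_def using finP by (intro openin_INT) auto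
        show "x \<in> D x" using AB that by (auto simp: D_def)
      qed
      moreover have "disjoint_family_on D ?P"
        unfolding disjoint_family_on_def
      proof (intro ballI impI)
        fix x x' assume xx: "x \<in> ?P" "x' \<in> ?P" "x \<noteq> x'"
        have "D x \<subseteq> A x x'" "D x' \<subseteq> B x x'" using xx by (auto simp: D_def)
        then show "D x \<inter> D x' = {}" using AB[OF xx] by blast
      qed
      ultimately show ?thesis by blast
    qed
    then obtain D where D: "\<And>x. x \<in> ?P \<Longrightarrow> openin X (D x) \<and> x \<in> D x" "disjoint_family_on D ?P" by blast
    have "\<forall>x\<in>?P. \<exists>P. fst P \<subseteq> D x \<and> k_to_one_at X Y h x (k x) (fst P) (snd P)"
    proof
      fix x assume "x \<in> ?P"
      with m have "multiplicity_at X Y h x (k x)" by blast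
      moreover have "openin X (D x)" "x \<in> D x" using D(1) \<open>x \<in> ?P\<close> by blast+
      ultimately obtain U V where "U \<subseteq> D x" "k_to_one_at X Y h x (k x) U V"
        by (rule multiplicity_atE)
      then show "\<exists>P. fst P \<subseteq> D x \<and> k_to_one_at X Y h x (k x) (fst P) (snd P)"
        by (intro exI[of _ "(U, V)"]) simp
    qed
    from bchoice[OF this] obtain P where P: "\<And>x. x \<in> ?P \<Longrightarrow> fst (P x) \<subseteq> D x \<and> k_to_one_at X Y h x (k x) (fst (P x)) (snd (P x))"
      by blast
    define U where "U x = fst (P x)" for x
    define V where "V x = snd (P x)" for x
    have UV: "openin X (U x) \<and> x \<in> U x \<and> U x \<subseteq> D x \<and> openin Y (V x) \<and> y \<in> V x \<and>
         (\<forall>w\<in>V x - {y}. finite {u \<in> U x. h u = w} \<and> card {u \<in> U x. h u = w} = k x)" if "x \<in> ?P" for x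
      using P[OF that] that unfolding k_to_one_at_def U_def V_def by auto
    \<comment> \<open>A proper map is closed, so the image of what lies outside the chosen
      neighbourhoods is closed and misses \<open>y\<close>; all preimages of a nearby point
      therefore lie in some \<open>U x\<close>.\<close>
    define C where "C = topspace X - (\<Union>x\<in>?P. U x)"
    have "closedin X C" unfolding C_def using UV by (intro closedin_diff openin_Union) auto
    then have "closedin Y (h ` C)" using h by (simp add: proper_map_def closed_map_def)
    moreover have "y \<notin> h ` C" using UV by (auto simp: C_def)
    ultimately have V0: "openin Y (topspace Y - h ` C)" "y \<in> topspace Y - h ` C" using y by auto
    define V' where "V' = (topspace Y - h ` C) \<inter> ((\<Inter>x\<in>?P. V x) \<inter> topspace Y)"
    have "openin Y V'"
      unfolding V'_def using V0 finP UV by (intro openin_Int openin_INT) auto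
    moreover have "y \<in> V'" using V0 UV y by (auto simp: V'_def)
    moreover have "card (?F w) = N y" if w: "w \<in> V' - {y}" for w
    proof -
      have wV: "w \<in> V x - {y}" if "x \<in> ?P" for x using w that unfolding V'_def by blast
      have "?F w = (\<Union>x\<in>?P. {u \<in> U x. h u = w})"
      proof
        show "?F w \<subseteq> (\<Union>x\<in>?P. {u \<in> U x. h u = w})"
          using w by (auto simp: V'_def C_def)
        show "(\<Union>x\<in>?P. {u \<in> U x. h u = w}) \<subseteq> ?F w" using UV openin_subset by fastforce
      qed
      also have "card \<dots> = (\<Sum>x\<in>?P. card {u \<in> U x. h u = w})"
      proof (rule card_UN_disjoint[OF finP])
        show "\<forall>x\<in>?P. finite {u \<in> U x. h u = w}" using UV wV by blast
        show "\<forall>x\<in>?P. \<forall>x'\<in>?P. x \<noteq> x' \<longrightarrow> {u \<in> U x. h u = w} \<inter> {u \<in> U x'. h u = w} = {}"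
        proof (intro ballI impI)
          fix x x' assume xx: "x \<in> ?P" "x' \<in> ?P" "x \<noteq> x'"
          have "U x \<subseteq> D x" "U x' \<subseteq> D x'" "D x \<inter> D x' = {}"
            using UV xx D(2) by (auto simp: disjoint_family_on_def)
          then show "{u \<in> U x. h u = w} \<inter> {u \<in> U x'. h u = w} = {}" by blast
        qed
      qed
      also have "\<dots> = N y" unfolding N_def by (rule sum.cong) (use UV wV in auto)
      finally show ?thesis .
    qed
    ultimately show ?thesis by blast
  qed
  have loc: "\<exists>V. openin Y V \<and> y \<in> V \<and> (\<forall>w\<in>V. N w = N y)" if y: "y \<in> topspace Y" for y
  proof -
    obtain V where V: "openin Y V" "y \<in> V" "\<forall>w \<in> V - {y}. card (?F w) = N y" using punct[OF y] by blast
    have "N w = N y" if w: "w \<in> V" for w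
    proof (cases "w = y")
      case False
      have "w \<in> topspace Y" using V w openin_subset by blast
      then obtain V' where V': "openin Y V'" "w \<in> V'" "\<forall>v \<in> V' - {w}. card (?F v) = N w" using punct by blast
      \<comment> \<open>Two points have to be avoided at once, which is why \<open>perfect\<close>
        asks for infinite open sets.\<close>
      have "infinite (V \<inter> V')" using V V' w perfect[of "V \<inter> V'"] by auto
      then have "V \<inter> V' - {y, w} \<noteq> {}" by (metis finite.emptyI finite_Diff2 finite_insert)
      then obtain v where "v \<in> V - {y}" "v \<in> V' - {w}" by blast
      then show ?thesis using V V' by metis
    qed simp
    then show ?thesis using V by blast
  qed
  have "continuous_map Y (discrete_topology UNIV) N"
    unfolding continuous_map_def
  proof (intro conjI allI impI)
    fix T :: "nat set"
    show "openin Y {x \<in> topspace Y. N x \<in> T}"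
    proof (subst openin_subopen, clarify)
      fix x assume x: "x \<in> topspace Y" "N x \<in> T"
      obtain V where V: "openin Y V" "x \<in> V" "\<forall>w\<in>V. N w = N x" using loc[OF x(1)] by blast
      have "w \<in> topspace Y \<and> N w \<in> T" if "w \<in> V" for w
        using V(3) that x(2) subsetD[OF openin_subset[OF V(1)]] by simp
      then have "V \<subseteq> {x \<in> topspace Y. N x \<in> T}" by blast
      with V(1,2) show "\<exists>Ta. openin Y Ta \<and> x \<in> Ta \<and> Ta \<subseteq> {x \<in> topspace Y. N x \<in> T}" by blast
    qed
  qed simp
  then have "connectedin (discrete_topology UNIV) (N ` topspace Y)"
    using Y(1) connectedin_continuous_map_image connectedin_topspace by blast
  then have "N y = N z"
    using yz by (auto simp: connectedin_discrete_topology)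
  then show "(\<Sum>x | x \<in> topspace X \<and> h x = y. k x) = (\<Sum>x | x \<in> topspace X \<and> h x = z. k x)"
    by (simp add: N_def)
  show "finite (?F y)" by (rule fin[OF yz(1)])
qed

text \<open>In the charts the map is \<open>z ^ k\<close>, with exactly \<open>k\<close> roots over
  each nonzero value and a single one over 0.\<close>

lemma locally_power_map_multiplicity:
  assumes "locally_power_map X Y f x k"
  shows "multiplicity_at X Y f x k"
  unfolding multiplicity_at_def
proof (intro allI impI)
  fix W assume W: "openin X W \<and> x \<in> W"
  obtain U V \<phi> \<psi> where k: "1 \<le> k" and U: "openin X U" "x \<in> U" "openin Y V" "f ` U \<subseteq> V"
    and \<phi>: "homeomorphic_map (subtopology X U) (euclidean :: complex topology) \<phi>"
    and \<psi>: "homeomorphic_map (subtopology Y V) (euclidean :: complex topology) \<psi>"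
    and p: "\<phi> x = 0" "\<psi> (f x) = 0" "\<forall>u\<in>U. \<psi> (f u) = \<phi> u ^ k"
    using assms unfolding locally_power_map_def by blast
  have tU: "topspace (subtopology X U) = U" using U openin_subset by fastforce
  have tV: "topspace (subtopology Y V) = V" using U openin_subset by fastforce
  have inj\<phi>: "inj_on \<phi> U" "\<phi> ` U = UNIV" using \<phi> tU by (auto simp: homeomorphic_map_def quotient_map_def)
  have inj\<psi>: "inj_on \<psi> V" "\<psi> ` V = UNIV" using \<psi> tV by (auto simp: homeomorphic_map_def quotient_map_def)
  have "openin (subtopology X U) (U \<inter> W)" using W U by (auto simp: openin_open_subtopology)
  then have "open (\<phi> ` (U \<inter> W))" using homeomorphic_map_openness_eq[OF \<phi>] by auto
  moreover have "0 \<in> \<phi> ` (U \<inter> W)" using p U W by force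
  ultimately obtain e where e: "e > 0" "ball 0 e \<subseteq> \<phi> ` (U \<inter> W)" by (meson open_contains_ball)
  define U' where "U' = {u \<in> U. \<phi> u \<in> ball 0 e}"
  \<comment> \<open>The radius \<open>e ^ k\<close> forces every \<open>k\<close>-th root of a value
    of \<open>\<psi>\<close> on \<open>V'\<close> into the disc of radius \<open>e\<close>, so no
    root is lost by passing to \<open>U'\<close>.\<close>
  define V' where "V' = {y \<in> V. \<psi> y \<in> ball 0 (e ^ k)}"
  have "openin (subtopology X U) {u \<in> topspace (subtopology X U). \<phi> u \<in> ball 0 e}"
    by (rule openin_continuous_map_preimage[OF homeomorphic_imp_continuous_map[OF \<phi>]]) simp
  then have oU: "openin X U'" unfolding tU U'_def[symmetric] by (simp add: openin_open_subtopology[OF U(1)])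
  have "openin (subtopology Y V) {y \<in> topspace (subtopology Y V). \<psi> y \<in> ball 0 (e ^ k)}"
    by (rule openin_continuous_map_preimage[OF homeomorphic_imp_continuous_map[OF \<psi>]]) simp
  then have oV: "openin Y V'" unfolding tV V'_def[symmetric] by (simp add: openin_open_subtopology[OF U(3)])
  have U'W: "U' \<subseteq> W"
  proof
    fix u assume "u \<in> U'"
    then obtain w where "w \<in> U \<inter> W" "\<phi> u = \<phi> w" "u \<in> U" using e by (auto simp: U'_def)
    then show "u \<in> W" using inj\<phi> by (auto dest: inj_onD)
  qed
  have fV: "f u \<in> V" if "u \<in> U" for u using that U by auto
  have fib: "bij_betw \<phi> {u \<in> U'. f u = y} {z. z ^ k = \<psi> y}" if y: "y \<in> V'" for y
    unfolding bij_betw_def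
  proof
    show "inj_on \<phi> {u \<in> U'. f u = y}" by (rule inj_on_subset[OF inj\<phi>(1)]) (auto simp: U'_def)
    show "\<phi> ` {u \<in> U'. f u = y} = {z. z ^ k = \<psi> y}"
    proof (intro equalityI subsetI)
      fix z assume "z \<in> \<phi> ` {u \<in> U'. f u = y}"
      then show "z \<in> {z. z ^ k = \<psi> y}" using p by (auto simp: U'_def)
    next
      fix z assume z: "z \<in> {z. z ^ k = \<psi> y}"
      obtain u where u: "u \<in> U" "z = \<phi> u" using inj\<phi>(2) by (metis UNIV_I imageE)
      have "cmod z ^ k < e ^ k" using y z by (auto simp: V'_def simp flip: norm_power)
      then have "cmod z < e" using e(1) power_less_imp_less_base by (metis less_le)
      moreover have "f u = y"
        by (rule inj_onD[OF inj\<psi>(1)]) (use u z p y fV in \<open>auto simp: V'_def\<close>)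
      ultimately show "z \<in> \<phi> ` {u \<in> U'. f u = y}" using u by (auto simp: U'_def)
    qed
  qed
  have fx: "f x \<in> V'" using fV[OF U(2)] p e k by (auto simp: V'_def power_0_left)
  have xU: "x \<in> U'" using U p e by (auto simp: U'_def)
  have "{u \<in> U'. f u = f x} = {x}"
  proof -
    have "u = x" if "u \<in> U'" "f u = f x" for u
    proof -
      have "\<phi> u ^ k = 0" using that p by (auto simp: U'_def)
      then have "\<phi> u = \<phi> x" using p k by auto
      then show ?thesis using inj_onD[OF inj\<phi>(1)] U(2) that by (auto simp: U'_def)
    qed
    then show ?thesis using xU by auto
  qed
  moreover have "finite {u \<in> U'. f u = y} \<and> card {u \<in> U'. f u = y} = k" if "y \<in> V' - {f x}" for y
  proof -
    have "\<psi> y \<noteq> 0"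
    proof
      assume "\<psi> y = 0"
      then have "y = f x" using inj_onD[OF inj\<psi>(1), of y "f x"] p(2) that fV[OF U(2)] by (auto simp: V'_def)
      then show False using that by simp
    qed
    then have "finite {z. z ^ k = \<psi> y}" "card {z. z ^ k = \<psi> y} = k"
      using card_nth_roots[of "\<psi> y" k] finite_nth_roots[of k "\<psi> y"] k by auto
    moreover have "bij_betw \<phi> {u \<in> U'. f u = y} {z. z ^ k = \<psi> y}" using fib that by auto
    ultimately show ?thesis using bij_betw_finite[of \<phi>] bij_betw_same_card[of \<phi>] by auto
  qed
  ultimately have "k_to_one_at X Y f x k U' V'"
    using oU xU oV fx unfolding k_to_one_at_def by blast
  then show "\<exists>U V. U \<subseteq> W \<and> k_to_one_at X Y f x k U V" using U'W by blast
qed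

lemma openin_infinite_of_local_plane:
  assumes "openin Y O1" "y \<in> O1" "openin Y V" "y \<in> V" and \<psi>: "homeomorphic_map (subtopology Y V) (euclidean :: complex topology) \<psi>"
  shows "infinite O1"
proof
  assume "finite O1"
  have "openin (subtopology Y V) (O1 \<inter> V)" using assms by (auto simp: openin_open_subtopology)
  then have "open (\<psi> ` (O1 \<inter> V))" using homeomorphic_map_openness_eq[OF \<psi>] by auto
  moreover have "finite (\<psi> ` (O1 \<inter> V))" using \<open>finite O1\<close> by simp
  ultimately have "\<psi> ` (O1 \<inter> V) = {}" using finite_imp_not_open by blast
  then show False using assms by auto
qed

lemma locally_power_map_infinite:
  assumes "locally_power_map X Y f x k" "openin Y V" "f x \<in> V"
  shows "infinite V"
proof -
  obtain U V' \<phi> \<psi> where "openin Y V'" "x \<in> U" "f ` U \<subseteq> V'"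
    "homeomorphic_map (subtopology Y V') (euclidean :: complex topology) \<psi>"
    using assms(1) unfolding locally_power_map_def by blast
  then show ?thesis using openin_infinite_of_local_plane[OF assms(2,3)] by blast
qed

text \<open>Multiplicity does not refer to charts, so any one pair of charts determines the
  \<open>THE\<close> in \<open>local_degree\<close>.\<close>

lemma local_degree_eq:
  assumes "locally_power_map X Y f x k"
  shows "local_degree X Y f x = k"
proof -
  have x: "x \<in> topspace X" using assms openin_subset unfolding locally_power_map_def by blast
  have "V - {f x} \<noteq> {}" if "openin Y V" "f x \<in> V" for V
    using locally_power_map_infinite[OF assms that] by (metis finite.emptyI finite_Diff2 finite.insertI)
  then have "k' = k" if "locally_power_map X Y f x k'" for k'
    using multiplicity_at_unique[OF locally_power_map_multiplicity[OF that] locally_power_map_multiplicity[OF assms] x] by blast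
  then show ?thesis unfolding local_degree_def using assms by (intro the_equality)
qed

section \<open>Square roots of maps on the sphere\<close>

lemma chart_inverse:
  assumes "homeomorphic_map (subtopology X U) (euclidean :: complex topology) \<phi>" "openin X U"
  obtains \<phi>' where "continuous_map (subtopology X U) euclidean \<phi>" "continuous_map euclidean (subtopology X U) \<phi>'"
    "\<And>u. u \<in> U \<Longrightarrow> \<phi>' (\<phi> u) = u" "\<And>w. \<phi>' w \<in> U" "\<And>w. \<phi> (\<phi>' w) = w"
proof -
  obtain \<phi>' where h: "homeomorphic_maps (subtopology X U) (euclidean :: complex topology) \<phi> \<phi>'"
    using assms(1) homeomorphic_map_maps by blast
  have t: "topspace (subtopology X U) = U" using openin_subset[OF assms(2)] by auto
  have "\<phi>' \<in> topspace euclidean \<rightarrow> U"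
    using h t unfolding homeomorphic_maps_def by (metis continuous_map_funspace)
  then show ?thesis
    using h t that[of \<phi>'] unfolding homeomorphic_maps_def by auto
qed

lemma chart_openin:
  assumes "continuous_map (subtopology X U) (euclidean :: complex topology) \<phi>" "openin X U" "open S"
  shows "openin X {u \<in> U. \<phi> u \<in> S}"
proof -
  have t: "topspace (subtopology X U) = U" using openin_subset[OF assms(2)] by auto
  have "openin (subtopology X U) {u \<in> topspace (subtopology X U). \<phi> u \<in> S}"
    by (rule openin_continuous_map_preimage[OF assms(1)]) (use assms(3) in simp)
  then show ?thesis unfolding t by (simp add: openin_open_subtopology[OF assms(2)])
qed

lemma chart_small_disc:
  assumes \<phi>: "homeomorphic_map (subtopology X U) (euclidean :: complex topology) \<phi>" "openin X U"
    and x: "x \<in> U" "\<phi> x = 0" and W: "openin X W" "x \<in> W"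
  obtains r where "r > 0" "\<And>u. u \<in> U \<Longrightarrow> \<phi> u \<in> ball 0 r \<Longrightarrow> u \<in> W"
proof -
  have "topspace (subtopology X U) = U" using openin_subset[OF \<phi>(2)] by auto
  then have inj: "inj_on \<phi> U" using \<phi>(1) by (metis homeomorphic_map_def)
  have "openin (subtopology X U) (U \<inter> W)" using W \<phi>(2) by (auto simp: openin_open_subtopology)
  then have "open (\<phi> ` (U \<inter> W))" using homeomorphic_map_openness_eq[OF \<phi>(1)] by auto
  moreover have "0 \<in> \<phi> ` (U \<inter> W)" using x W by force
  ultimately obtain r where r: "r > 0" "ball 0 r \<subseteq> \<phi> ` (U \<inter> W)" by (meson open_contains_ball)
  show ?thesis
  proof (rule that[OF r(1)])
    fix u assume "u \<in> U" "\<phi> u \<in> ball 0 r"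
    then obtain w where "w \<in> U \<inter> W" "\<phi> u = \<phi> w" using r(2) by blast
    then show "u \<in> W" using inj_onD[OF inj] \<open>u \<in> U\<close> by auto
  qed
qed

text \<open>The neighbourhood is punctured because \<open>g\<close> is controlled only off
  \<open>E\<close> and may behave like a zero or a pole at \<open>e\<close>.\<close>

definition local_root :: "'a topology \<Rightarrow> 'a set \<Rightarrow> ('a \<Rightarrow> complex) \<Rightarrow> 'a \<Rightarrow> bool" where
  "local_root X E g e \<longleftrightarrow>
     (\<exists>N s. openin X N \<and> e \<in> N \<and> N - {e} \<subseteq> topspace X - E \<and>
        continuous_map (subtopology X (N - {e})) euclidean s \<and> (\<forall>z \<in> N - {e}. s z ^ 2 = g z))"

text \<open>Read in the chart, \<open>g\<close> is an even nonvanishing function on a punctured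
  disc, so \<open>even_punctured_has_root\<close> applies.\<close>

lemma even_local_root:
  assumes \<phi>: "homeomorphic_map (subtopology X U) (euclidean :: complex topology) \<phi>" "openin X U"
    and x: "x \<in> U" "\<phi> x = 0" and r: "r > 0" "\<And>u. u \<in> U \<Longrightarrow> \<phi> u \<in> ball 0 r - {0} \<Longrightarrow> u \<notin> E"
    and g: "continuous_map (subtopology X (topspace X - E)) euclidean g" "\<And>z. z \<in> topspace X - E \<Longrightarrow> g z \<noteq> 0"
    and even: "\<And>u u'. u \<in> U \<Longrightarrow> u' \<in> U \<Longrightarrow> \<phi> u \<in> ball 0 r - {0} \<Longrightarrow> \<phi> u' = - \<phi> u \<Longrightarrow> g u' = g u"
  shows "local_root X E g x"
proof -
  obtain \<phi>' where c: "continuous_map (subtopology X U) euclidean \<phi>" "continuous_map euclidean (subtopology X U) \<phi>'"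
    and inv: "\<And>u. u \<in> U \<Longrightarrow> \<phi>' (\<phi> u) = u" "\<And>w. \<phi>' w \<in> U" "\<And>w. \<phi> (\<phi>' w) = w"
    using chart_inverse[OF \<phi>] by metis
  let ?B = "ball 0 r - {0} :: complex set"
  have UX: "U \<subseteq> topspace X" using openin_subset[OF \<phi>(2)] .
  have \<phi>'E: "\<phi>' w \<in> topspace X - E" if "w \<in> ?B" for w
    using r(2)[OF inv(2)[of w]] inv(2,3)[of w] that UX by auto
  have "continuous_map (top_of_set ?B) X \<phi>'"
    using c(2) continuous_map_from_subtopology continuous_map_into_fulltopology by blast
  then have "continuous_map (top_of_set ?B) (subtopology X (topspace X - E)) \<phi>'"
    by (rule continuous_map_into_subtopology) (use \<phi>'E in auto)
  from continuous_map_compose[OF this g(1)] have "continuous_on ?B (g \<circ> \<phi>')" by simp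
  moreover have "(g \<circ> \<phi>') w \<noteq> 0" if "w \<in> ?B" for w
    using g(2)[OF \<phi>'E[OF that]] by simp
  moreover have "(g \<circ> \<phi>') (- w) = (g \<circ> \<phi>') w" if "w \<in> ?B" for w
    using even[of "\<phi>' w" "\<phi>' (- w)"] inv that by simp
  ultimately obtain s where s: "continuous_on ?B s" "\<And>w. w \<in> ?B \<Longrightarrow> s w ^ 2 = (g \<circ> \<phi>') w"
    using even_punctured_has_root[OF r(1)] by metis
  define N where "N = {u \<in> U. \<phi> u \<in> ball 0 r}"
  have oN: "openin X N" unfolding N_def by (rule chart_openin[OF c(1) \<phi>(2)]) simp
  have nz: "\<phi> u \<noteq> 0" if "u \<in> U" "u \<noteq> x" for u
    using inv(1)[OF that(1)] inv(1)[OF x(1)] x(2) that(2) by metis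
  have D: "\<phi> u \<in> ?B" "u \<in> U" if "u \<in> N - {x}" for u using that nz by (auto simp: N_def)
  have "continuous_map (subtopology X (N - {x})) (top_of_set ?B) \<phi>"
  proof (rule continuous_map_into_subtopology)
    show "continuous_map (subtopology X (N - {x})) euclidean \<phi>"
      by (rule continuous_map_from_subtopology_mono[OF c(1)]) (auto simp: N_def)
  qed (use D in auto)
  moreover have "continuous_map (top_of_set ?B) euclidean s" using s(1) by simp
  ultimately have "continuous_map (subtopology X (N - {x})) euclidean (s \<circ> \<phi>)"
    by (rule continuous_map_compose)
  moreover have "(s \<circ> \<phi>) z ^ 2 = g z" if "z \<in> N - {x}" for z
    using s(2)[OF D(1)[OF that]] inv(1)[OF D(2)[OF that]] by simp
  moreover have "N - {x} \<subseteq> topspace X - E" using D r(2) UX by (auto simp: subset_iff)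
  moreover have "x \<in> N" using x r(1) by (simp add: N_def)
  ultimately show ?thesis unfolding local_root_def using oN by blast
qed

text \<open>With \<open>q\<close> sent to infinity the rest of \<open>E\<close> becomes a finite set
  of punctures in a plane, the situation of \<open>global_square_root\<close>; hence local roots are
  required at every point of \<open>E\<close> except \<open>q\<close>.\<close>

lemma S2_global_root:
  assumes X: "X homeomorphic_space S2" and E: "finite E" "E \<subseteq> topspace X" "q \<in> E"
    and g: "continuous_map (subtopology X (topspace X - E)) euclidean g" "\<And>z. z \<in> topspace X - E \<Longrightarrow> g z \<noteq> 0"
    and loc: "\<And>e. e \<in> E - {q} \<Longrightarrow> local_root X E g e"
  obtains s :: "'a \<Rightarrow> complex" where "continuous_map (subtopology X (topspace X - E)) euclidean s"
    "\<And>z. z \<in> topspace X - E \<Longrightarrow> s z ^ 2 = g z"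
proof -
  let ?U = "topspace X - {q}"
  have oU: "openin X ?U" by (rule S2_openin_delete[OF X])
  obtain \<xi> where \<xi>: "homeomorphic_map (subtopology X ?U) (euclidean :: complex topology) \<xi>"
    using S2_punctured[OF X] E by blast
  obtain \<eta> where c: "continuous_map (subtopology X ?U) euclidean \<xi>" "continuous_map euclidean (subtopology X ?U) \<eta>"
    and inv: "\<And>u. u \<in> ?U \<Longrightarrow> \<eta> (\<xi> u) = u" "\<And>w. \<eta> w \<in> ?U" "\<And>w. \<xi> (\<eta> w) = w"
    using chart_inverse[OF \<xi> oU] by metis
  have \<eta>c: "continuous_map euclidean X \<eta>" using c(2) continuous_map_into_fulltopology by blast
  define Q where "Q = \<xi> ` (E - {q})"
  have \<eta>E: "\<eta> w \<in> topspace X - E" if "w \<notin> Q" for w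
  proof -
    have "\<eta> w \<notin> E - {q}" using that inv(3)[of w] unfolding Q_def by (metis imageI)
    then show ?thesis using inv(2)[of w] by blast
  qed
  have \<xi>Q: "\<xi> u \<notin> Q" if u: "u \<in> topspace X - E" for u
  proof
    assume "\<xi> u \<in> Q"
    then obtain e where e: "e \<in> E - {q}" "\<xi> u = \<xi> e" by (auto simp: Q_def)
    then have "u = e" using inv(1)[of u] inv(1)[of e] u E by auto
    then show False using e u by simp
  qed
  have comp: "continuous_on S (h \<circ> \<eta>)" if "continuous_map (subtopology X T) euclidean h" "\<And>w. w \<in> S \<Longrightarrow> \<eta> w \<in> T" for S T and h :: "'a \<Rightarrow> complex"
  proof -
    have "continuous_map (top_of_set S) X \<eta>" using \<eta>c continuous_map_from_subtopology by blast
    then have "continuous_map (top_of_set S) (subtopology X T) \<eta>"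
      using that(2) by (intro continuous_map_into_subtopology) auto
    from continuous_map_compose[OF this that(1)] show ?thesis by simp
  qed
  have fQ: "finite Q" using E by (simp add: Q_def)
  have gc: "continuous_on (- Q) (g \<circ> \<eta>)" by (rule comp[OF g(1)]) (use \<eta>E in auto)
  have g0: "(g \<circ> \<eta>) z \<noteq> 0" if "z \<notin> Q" for z using g(2)[OF \<eta>E[OF that]] by simp
  have gl: "\<exists>r>0. \<exists>s. continuous_on (ball a r - {a}) s \<and> (\<forall>z \<in> ball a r - {a}. s z ^ 2 = (g \<circ> \<eta>) z)"
    if "a \<in> Q" for a
  proof -
    from that obtain e where e: "e \<in> E - {q}" "a = \<xi> e" by (auto simp: Q_def)
    have eU: "e \<in> ?U" using e E by auto
    then have \<eta>a: "\<eta> a = e" using inv(1) e by simp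
    obtain N s where N: "openin X N" "e \<in> N" "N - {e} \<subseteq> topspace X - E"
       "continuous_map (subtopology X (N - {e})) euclidean s" "\<forall>z \<in> N - {e}. s z ^ 2 = g z"
      using loc[OF e(1)] unfolding local_root_def by blast
    have "openin euclidean {w \<in> topspace euclidean. \<eta> w \<in> N}"
      by (rule openin_continuous_map_preimage[OF \<eta>c N(1)])
    then have "open {w. \<eta> w \<in> N}" by simp
    then obtain r where r: "r > 0" "ball a r \<subseteq> {w. \<eta> w \<in> N}"
      using N(2) \<eta>a by (metis mem_Collect_eq open_contains_ball)
    have m: "\<eta> w \<in> N - {e}" if "w \<in> ball a r - {a}" for w
    proof -
      have "\<eta> w \<noteq> \<eta> a" using inv(3)[of w] inv(3)[of a] that by auto
      then show ?thesis using r(2) that \<eta>a by auto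
    qed
    have "continuous_on (ball a r - {a}) (s \<circ> \<eta>)" by (rule comp[OF N(4)]) (rule m)
    moreover have "\<forall>z \<in> ball a r - {a}. (s \<circ> \<eta>) z ^ 2 = (g \<circ> \<eta>) z" using N(5) m by simp
    ultimately show ?thesis using r(1) by blast
  qed
  obtain S where S: "continuous_on (- Q) S" "\<And>z. z \<notin> Q \<Longrightarrow> S z ^ 2 = (g \<circ> \<eta>) z"
    using global_square_root[OF fQ gc g0 gl] by metis
  show ?thesis
  proof
    have "continuous_map (subtopology X (topspace X - E)) euclidean \<xi>"
      by (rule continuous_map_from_subtopology_mono[OF c(1)]) (use E in auto)
    then have "continuous_map (subtopology X (topspace X - E)) (top_of_set (- Q)) \<xi>"
      using \<xi>Q by (intro continuous_map_into_subtopology) auto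
    moreover have "continuous_map (top_of_set (- Q)) euclidean S" using S(1) by simp
    ultimately show "continuous_map (subtopology X (topspace X - E)) euclidean (S \<circ> \<xi>)"
      by (rule continuous_map_compose)
    show "(S \<circ> \<xi>) z ^ 2 = g z" if "z \<in> topspace X - E" for z
    proof -
      have "z \<in> ?U" using that E by auto
      then show ?thesis using S(2)[OF \<xi>Q[OF that]] inv(1) by simp
    qed
  qed
qed

lemma S2_infinite_openin:
  assumes Y: "Y homeomorphic_space S2" and V: "openin Y V" "V \<noteq> {}"
  shows "infinite V"
proof -
  obtain h where h: "homeomorphic_map Y (top_of_set sph) h" using homeomorphic_S2_sph[OF Y] .
  have "(1, 0) \<in> h ` topspace Y" "(-1, 0) \<in> h ` topspace Y"
    using h by (auto simp: homeomorphic_map_def quotient_map_def norm_Pair)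
  then obtain p q where "p \<in> topspace Y" "q \<in> topspace Y" "h p = (1, 0)" "h q = (-1, 0)"
    unfolding image_iff by metis
  then have pq: "p \<in> topspace Y" "q \<in> topspace Y" "p \<noteq> q" by auto
  obtain y where y: "y \<in> V" using V by blast
  then have yY: "y \<in> topspace Y" using openin_subset[OF V(1)] by blast
  obtain b where b: "b \<in> topspace Y" "y \<noteq> b" using pq by metis
  obtain c where c: "homeomorphic_map (subtopology Y (topspace Y - {b})) (euclidean :: complex topology) c"
    using S2_punctured[OF Y b(1)] .
  have "openin Y (topspace Y - {b})" by (rule S2_openin_delete[OF Y])
  then show ?thesis using openin_infinite_of_local_plane[OF V(1) y _ _ c] b yY by blast
qed

section \<open>Branched covers between spheres and balanced fibres\<close>

locale S2_branched =
  fixes X :: "'a topology" and Y :: "'b topology" and f :: "'a \<Rightarrow> 'b" and m :: "'a \<Rightarrow> nat"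
  assumes X: "X homeomorphic_space S2" and Y: "Y homeomorphic_space S2"
    and f: "continuous_map X Y f"
    and power: "\<And>x. x \<in> topspace X \<Longrightarrow> locally_power_map X Y f x (m x)"
begin

lemma Hausdorff: "Hausdorff_space X" "Hausdorff_space Y"
  using S2_closed_orientable_surface[OF X] S2_closed_orientable_surface[OF Y]
  by (auto simp: closed_orientable_surface_def)

lemma connected: "connected_space Y"
  using S2_closed_orientable_surface[OF Y] by (auto simp: closed_orientable_surface_def)

lemma proper: "proper_map X Y f"
  using continuous_imp_proper_map[OF _ _ f] S2_closed_orientable_surface[OF X] Hausdorff
  by (auto simp: closed_orientable_surface_def Hausdorff_imp_kc_space)

lemma fibre_finite_sum:
  assumes "y \<in> topspace Y" "z \<in> topspace Y"
  shows fibre_finite: "finite {x \<in> topspace X. f x = y}"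
    and fibre_sum: "(\<Sum>x | x \<in> topspace X \<and> f x = y. m x) = (\<Sum>x | x \<in> topspace X \<and> f x = z. m x)"
  using weighted_fibre_constant[OF Hausdorff(1) connected Hausdorff_imp_t1_space[OF Hausdorff(2)] S2_infinite_openin[OF Y] proper
     locally_power_map_multiplicity[OF power] assms] by blast+

lemma fX: "f x \<in> topspace Y" if "x \<in> topspace X"
  using f that by (meson continuous_map_image_subset_topspace image_subset_iff)

text \<open>Here \<open>h\<close> is a root of \<open>f\<close> in the sense that \<open>f\<close>
  is a locally injective function \<open>g\<close> of it. So \<open>h\<close> has the same
  multiplicities \<open>m\<close>, and \<open>weighted_fibre_constant\<close> over the connected set
  \<open>W\<close> equates its weighted fibres.\<close>

lemma fibre_balance:
  fixes h :: "'a \<Rightarrow> complex"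
  assumes W: "open W" "connected W" and X2: "openin X X2"
    and h: "proper_map (subtopology X X2) (top_of_set W) h" "continuous_map (subtopology X X2) (top_of_set W) h"
    and g: "continuous_map (top_of_set W) Y g" "\<And>x. x \<in> X2 \<Longrightarrow> f x = g (h x)"
    and inj: "\<And>w. w \<in> W \<Longrightarrow> \<exists>r>0. ball w r \<subseteq> W \<and> inj_on g (ball w r)"
    and ab: "a \<in> W" "b \<in> W"
  shows "finite {x \<in> X2. h x = a}" "(\<Sum>x | x \<in> X2 \<and> h x = a. m x) = (\<Sum>x | x \<in> X2 \<and> h x = b. m x)"
proof -
  have X2X: "X2 \<subseteq> topspace X" using openin_subset[OF X2] .
  have t: "topspace (subtopology X X2) = X2" using X2X by auto
  have "multiplicity_at (subtopology X X2) (top_of_set W) h x (m x)" if x: "x \<in> topspace (subtopology X X2)" for x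
  proof -
    have xX: "x \<in> X2" "x \<in> topspace X" using x X2X by auto
    have hx: "h x \<in> W" using h(2) x by (metis continuous_map_image_subset_topspace image_subset_iff topspace_euclidean_subtopology)
    obtain r where r: "r > 0" "ball (h x) r \<subseteq> W" "inj_on g (ball (h x) r)" using inj[OF hx] by blast
    show ?thesis
    proof (rule multiplicity_at_factor[where g = g and Z = Y and f = f and ?O1.0 = "ball (h x) r"])
      show "multiplicity_at (subtopology X X2) Y f x (m x)"
        by (rule multiplicity_at_subtopology[OF locally_power_map_multiplicity[OF power[OF xX(2)]] X2 xX(1)])
      show "openin (top_of_set W) (ball (h x) r)" using r(2) W(1) by (simp add: openin_open_eq)
    qed (use xX t r h g x in auto)
  qed
  moreover have "infinite V" if "openin (top_of_set W) V" "V \<noteq> {}" for V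
    using that W(1) by (metis finite_imp_not_open openin_open_trans)
  moreover have "t1_space (top_of_set W)"
    by (intro Hausdorff_imp_t1_space Hausdorff_space_subtopology) simp
  ultimately have "finite {x \<in> topspace (subtopology X X2). h x = a} \<and> 
    (\<Sum>x | x \<in> topspace (subtopology X X2) \<and> h x = a. m x) = (\<Sum>x | x \<in> topspace (subtopology X X2) \<and> h x = b. m x)"
    using weighted_fibre_constant[of "subtopology X X2" "top_of_set W" h m a b] h(1) W(2) ab
      Hausdorff_space_subtopology[OF Hausdorff(1)]
    by (auto simp: connected_space_subtopology)
  then show "finite {x \<in> X2. h x = a}" "(\<Sum>x | x \<in> X2 \<and> h x = a. m x) = (\<Sum>x | x \<in> X2 \<and> h x = b. m x)"
    unfolding t by blast+
qed


lemma nhd_without: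
  assumes "finite E" "x \<in> topspace X"
  shows "openin X (topspace X - (E - {x}))" "x \<in> topspace X - (E - {x})"
proof -
  have "closedin X (E \<inter> topspace X - {x})"
    using Hausdorff(1) assms(1) by (intro Hausdorff_imp_t1_space[THEN t1_space_closedin_finite[THEN iffD1], rule_format]) auto
  moreover have "topspace X - (E - {x}) = topspace X - (E \<inter> topspace X - {x})" by auto
  ultimately show "openin X (topspace X - (E - {x}))" by auto
qed (use assms in auto)

text \<open>An even local degree makes \<open>f\<close> agree at opposite points of the chart; if
  \<open>f\<close> determines \<open>g\<close> on \<open>W\<close>, then \<open>g\<close> is even
  there. The set \<open>W\<close> is a parameter because a function such as \<open>u - a\<close> is
  determined by \<open>f\<close> only locally.\<close>

lemma even_local_root_at:
  fixes g :: "'a \<Rightarrow> complex"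
  assumes "finite E" "x \<in> topspace X"
    and g: "continuous_map (subtopology X (topspace X - E)) euclidean g" "\<And>z. z \<in> topspace X - E \<Longrightarrow> g z \<noteq> 0"
    and W: "openin X W" "x \<in> W" and "even (m x)"
    and even: "\<And>u u'. u \<in> W - E \<Longrightarrow> u' \<in> W - E \<Longrightarrow> f u = f u' \<Longrightarrow> g u' = g u"
  shows "local_root X E g x"
proof -
  obtain U V \<phi> \<psi> where k: "1 \<le> m x" and U: "openin X U" "x \<in> U" "openin Y V" "f ` U \<subseteq> V"
    and \<phi>: "homeomorphic_map (subtopology X U) (euclidean :: complex topology) \<phi>"
    and \<psi>: "homeomorphic_map (subtopology Y V) (euclidean :: complex topology) \<psi>"
    and p: "\<phi> x = 0" "\<psi> (f x) = 0" "\<forall>u\<in>U. \<psi> (f u) = \<phi> u ^ m x"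
    using power[OF assms(2)] unfolding locally_power_map_def by blast
  have "topspace (subtopology Y V) = V" using openin_subset[OF U(3)] by auto
  then have inj\<psi>: "inj_on \<psi> V" using \<psi> by (metis homeomorphic_map_def)
  have "openin X (W \<inter> (topspace X - (E - {x})))" using W(1) nhd_without[OF assms(1,2)] by blast
  then obtain r where r: "r > 0" "\<And>u. u \<in> U \<Longrightarrow> \<phi> u \<in> ball 0 r \<Longrightarrow> u \<in> W \<inter> (topspace X - (E - {x}))"
    using chart_small_disc[OF \<phi> U(1,2) p(1)] W(2) assms(2) by (metis (no_types, lifting) Diff_iff IntI insertI1)
  have rW: "u \<in> W - E" if "u \<in> U" "\<phi> u \<in> ball 0 r - {0}" for u
    using r(2)[OF that(1)] that p(1) by auto
  show ?thesis
  proof (rule even_local_root[OF \<phi> U(1,2) p(1) r(1) _ g])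
    show "u \<notin> E" if "u \<in> U" "\<phi> u \<in> ball 0 r - {0}" for u using rW[OF that] by simp
    fix u u' assume u: "u \<in> U" "u' \<in> U" "\<phi> u \<in> ball 0 r - {0}" "\<phi> u' = - \<phi> u"
    have "\<psi> (f u) = \<psi> (f u')" using p(3) u \<open>even (m x)\<close> by simp
    then have "f u = f u'" using inj_onD[OF inj\<psi>] u(1,2) U(4) by blast
    moreover have "\<phi> u' \<in> ball 0 r - {0}" using u by auto
    ultimately show "g u' = g u" using even rW u by metis
  qed
qed

text \<open>Over a point where the local degree is divisible by 4, any square root \<open>h\<close> of a function of \<open>f\<close> is even in the
  chart: rotating by \<open>\<i>\<close> multiplies \<open>h\<close> by a constant sign, so rotating twice fixes it.\<close>

lemma even_local_root_at_4:
  fixes g h :: "'a \<Rightarrow> complex"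
  assumes "finite E" "x \<in> topspace X"
    and g: "continuous_map (subtopology X (topspace X - E)) euclidean g" "\<And>z. z \<in> topspace X - E \<Longrightarrow> g z \<noteq> 0"
    and h: "continuous_map (subtopology X (topspace X - E)) euclidean h" "\<And>z. z \<in> topspace X - E \<Longrightarrow> h z \<noteq> 0"
    and "m x = 4"
    and hf: "\<And>u u'. u \<in> topspace X - E \<Longrightarrow> u' \<in> topspace X - E \<Longrightarrow> f u = f u' \<Longrightarrow> h u' ^ 2 = h u ^ 2"
    and gh: "\<And>u u'. u \<in> topspace X - E \<Longrightarrow> u' \<in> topspace X - E \<Longrightarrow> h u = h u' \<Longrightarrow> g u' = g u"
  shows "local_root X E g x"
proof -
  obtain U V \<phi> \<psi> where U: "openin X U" "x \<in> U" "openin Y V" "f ` U \<subseteq> V"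
    and \<phi>: "homeomorphic_map (subtopology X U) (euclidean :: complex topology) \<phi>"
    and \<psi>: "homeomorphic_map (subtopology Y V) (euclidean :: complex topology) \<psi>"
    and p: "\<phi> x = 0" "\<psi> (f x) = 0" "\<forall>u\<in>U. \<psi> (f u) = \<phi> u ^ 4"
    using power[OF assms(2)] unfolding locally_power_map_def \<open>m x = 4\<close> by blast
  have "topspace (subtopology Y V) = V" using openin_subset[OF U(3)] by auto
  then have inj\<psi>: "inj_on \<psi> V" using \<psi> by (metis homeomorphic_map_def)
  obtain r where r: "r > 0" "\<And>u. u \<in> U \<Longrightarrow> \<phi> u \<in> ball 0 r \<Longrightarrow> u \<in> topspace X - (E - {x})"
    using chart_small_disc[OF \<phi> U(1,2) p(1) nhd_without[OF assms(1,2)]] by metis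
  have rE: "u \<in> topspace X - E" if "u \<in> U" "\<phi> u \<in> ball 0 r - {0}" for u
    using r(2)[OF that(1)] that p(1) by auto
  obtain \<phi>' where c: "continuous_map euclidean (subtopology X U) \<phi>'"
    and inv: "\<And>u. u \<in> U \<Longrightarrow> \<phi>' (\<phi> u) = u" "\<And>w. \<phi>' w \<in> U" "\<And>w. \<phi> (\<phi>' w) = w"
    using chart_inverse[OF \<phi> U(1)] by metis
  let ?B = "ball 0 r - {0} :: complex set"
  have \<phi>'E: "\<phi>' w \<in> topspace X - E" if "w \<in> ?B" for w
    using rE[OF inv(2)] inv(3) that by simp
  have "continuous_map (top_of_set ?B) X \<phi>'"
    using c continuous_map_from_subtopology continuous_map_into_fulltopology by blast
  then have "continuous_map (top_of_set ?B) (subtopology X (topspace X - E)) \<phi>'"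
    by (rule continuous_map_into_subtopology) (use \<phi>'E in auto)
  from continuous_map_compose[OF this h(1)] have hc: "continuous_on ?B (h \<circ> \<phi>')" by simp
  have iB: "\<i> * w \<in> ?B" if "w \<in> ?B" for w using that by (auto simp: norm_mult)
  define q where "q w = h (\<phi>' (\<i> * w)) / h (\<phi>' w)" for w
  have q1: "q w = 1 \<or> q w = - 1" if w: "w \<in> ?B" for w
  proof -
    have "\<psi> (f (\<phi>' (\<i> * w))) = \<psi> (f (\<phi>' w))" using p(3) inv by (simp add: power_mult_distrib)
    then have "f (\<phi>' (\<i> * w)) = f (\<phi>' w)" using inj_onD[OF inj\<psi>] inv(2) U(4) by blast
    then have "h (\<phi>' (\<i> * w)) ^ 2 = h (\<phi>' w) ^ 2" using hf \<phi>'E w iB by metis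
    then have "h (\<phi>' (\<i> * w)) = h (\<phi>' w) \<or> h (\<phi>' (\<i> * w)) = - h (\<phi>' w)" by (simp add: power2_eq_iff)
    then show ?thesis using h(2)[OF \<phi>'E[OF w]] by (auto simp: q_def)
  qed
  have "q constant_on ?B"
  proof (rule continuous_discrete_range_constant)
    show "connected ?B" by (intro connected_open_delete) (auto simp: convex_connected)
    have "continuous_on ?B (\<lambda>w. (h \<circ> \<phi>') (\<i> * w) / (h \<circ> \<phi>') w)"
      using iB \<phi>'E h(2) by (intro continuous_on_divide hc continuous_on_compose2[OF hc] continuous_intros) auto
    then show "continuous_on ?B q" by (simp add: q_def[abs_def])
    show "\<exists>e>0. \<forall>y. y \<in> ?B \<and> q y \<noteq> q x \<longrightarrow> e \<le> cmod (q y - q x)" if x: "x \<in> ?B" for x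
    proof (intro exI[of _ 1] conjI allI impI)
      fix y assume "y \<in> ?B \<and> q y \<noteq> q x"
      then show "1 \<le> cmod (q y - q x)" using q1[of y] q1[OF x] by auto
    qed simp
  qed
  then obtain C where C: "\<And>w. w \<in> ?B \<Longrightarrow> q w = C" unfolding constant_on_def by blast
  have hneg: "h (\<phi>' (- w)) = h (\<phi>' w)" if w: "w \<in> ?B" for w
  proof -
    have "h (\<phi>' (\<i> * w)) = C * h (\<phi>' w)" if "w \<in> ?B" for w
      using C[OF that] h(2)[OF \<phi>'E[OF that]] by (auto simp: q_def field_simps)
    from this[OF w] this[OF iB[OF w]] have "h (\<phi>' (- w)) = C * (C * h (\<phi>' w))" by simp
    moreover have "C * C = 1" using q1[OF w] C[OF w] by auto
    ultimately show ?thesis by (metis mult.assoc mult_1)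
  qed
  show ?thesis
  proof (rule even_local_root[OF \<phi> U(1,2) p(1) r(1) _ g])
    show "u \<notin> E" if "u \<in> U" "\<phi> u \<in> ball 0 r - {0}" for u using rE[OF that] by simp
    fix u u' assume u: "u \<in> U" "u' \<in> U" "\<phi> u \<in> ball 0 r - {0}" "\<phi> u' = - \<phi> u"
    have "h u' = h u" using hneg[OF u(3)] inv(1)[OF u(1)] inv(1)[OF u(2)] u(4) by metis
    moreover have "\<phi> u' \<in> ball 0 r - {0}" using u by auto
    ultimately show "g u' = g u" using gh rE u by metis
  qed
qed

end

lemma proper_map_cong:
  assumes "proper_map X Y f" "\<And>x. x \<in> topspace X \<Longrightarrow> f x = g x"
  shows "proper_map X Y g"
proof -
  have "{x \<in> topspace X. f x = y} = {x \<in> topspace X. g x = y}" for y using assms(2) by auto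
  then show ?thesis using assms closed_map_eq[of X Y f g] by (simp add: proper_map_def)
qed

lemma S2_coordinate:
  assumes Y: "Y homeomorphic_space S2" and AB: "A \<in> topspace Y" "B \<in> topspace Y" "A \<noteq> B"
  obtains c :: "'b \<Rightarrow> complex" and c' where
    "continuous_map (subtopology Y (topspace Y - {B})) euclidean c" "continuous_map euclidean Y c'"
    "\<And>y. y \<in> topspace Y \<Longrightarrow> y \<noteq> B \<Longrightarrow> c' (c y) = y"
    "\<And>w. c' w \<in> topspace Y - {B}" "\<And>w. c (c' w) = w" "c' 0 = A" "c A = 0"
proof -
  let ?U = "topspace Y - {B}"
  obtain d where d: "homeomorphic_map (subtopology Y ?U) (euclidean :: complex topology) d"
    using S2_punctured[OF Y AB(2)] .
  have oU: "openin Y ?U" by (rule S2_openin_delete[OF Y])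
  obtain d' where c: "continuous_map (subtopology Y ?U) euclidean d" "continuous_map euclidean (subtopology Y ?U) d'"
    and inv: "\<And>u. u \<in> ?U \<Longrightarrow> d' (d u) = u" "\<And>w. d' w \<in> ?U" "\<And>w. d (d' w) = w"
    using chart_inverse[OF d oU] by metis
  have 1: "continuous_map (subtopology Y ?U) euclidean (\<lambda>y. d y - d A)"
    by (intro continuous_map_diff c) auto
  have "continuous_map euclidean euclidean (\<lambda>w. w + d A)"
    by (simp add: continuous_on_add)
  from continuous_map_compose[OF this c(2)] have "continuous_map euclidean (subtopology Y ?U) (\<lambda>w. d' (w + d A))"
    by (simp add: o_def)
  then have 2: "continuous_map euclidean Y (\<lambda>w. d' (w + d A))" using continuous_map_into_fulltopology by blast
  show ?thesis
    by (rule that[OF 1 2]) (use inv AB in auto)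
qed

context S2_branched begin

lemma openin_avoid_fibres:
  assumes "finite S" "S \<subseteq> topspace Y"
  shows "openin X {x \<in> topspace X. f x \<notin> S}" "finite {x \<in> topspace X. f x \<in> S}"
proof -
  have "{x \<in> topspace X. f x \<in> S} = (\<Union>y\<in>S. {x \<in> topspace X. f x = y})" by auto
  then show "finite {x \<in> topspace X. f x \<in> S}" using assms fibre_finite by (auto intro!: finite_UN_I)
  have "closedin Y S" using assms Hausdorff(2) by (metis Hausdorff_imp_t1_space t1_space_closedin_finite)
  then have "openin Y (topspace Y - S)" by blast
  from openin_continuous_map_preimage[OF f this]
  have "openin X {x \<in> topspace X. f x \<in> topspace Y - S}" .
  moreover have "{x \<in> topspace X. f x \<in> topspace Y - S} = {x \<in> topspace X. f x \<notin> S}" using fX by auto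
  ultimately show "openin X {x \<in> topspace X. f x \<notin> S}" by simp
qed

text \<open>Properness passes from a composite to its inner map when the middle space is Hausdorff,
  and the composite \<open>g \<circ> h\<close> is a restriction of the proper map
  \<open>f\<close>.\<close>

lemma proper_of_factor:
  fixes h :: "'a \<Rightarrow> complex"
  assumes "V \<subseteq> topspace Y" and h: "continuous_map (subtopology X {x \<in> topspace X. f x \<in> V}) (top_of_set W) h"
    and g: "continuous_map (top_of_set W) Y g" "\<And>w. w \<in> W \<Longrightarrow> g w \<in> V"
    and fgh: "\<And>x. x \<in> topspace X \<Longrightarrow> f x \<in> V \<Longrightarrow> f x = g (h x)"
  shows "proper_map (subtopology X {x \<in> topspace X. f x \<in> V}) (top_of_set W) h"
proof (rule proper_map_from_composition_right[OF _ _ h])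
  show "Hausdorff_space (top_of_set W)" by (intro Hausdorff_space_subtopology) simp
  show "continuous_map (top_of_set W) (subtopology Y V) g"
    using g by (intro continuous_map_into_subtopology) auto
  have "proper_map (subtopology X {x \<in> topspace X. f x \<in> V}) (subtopology Y V) f"
    by (rule proper_map_restriction[OF proper]) simp
  then show "proper_map (subtopology X {x \<in> topspace X. f x \<in> V}) (subtopology Y V) (g \<circ> h)"
    by (rule proper_map_cong) (use fgh in auto)
qed

lemma locally_inj_power:
  assumes "(w::complex) \<noteq> 0" "open W" "w \<in> W"
  shows "\<exists>r>0. ball w r \<subseteq> W \<and> inj_on (\<lambda>w. w ^ 2) (ball w r)"
proof -
  have "deriv (\<lambda>w. w ^ 2) w \<noteq> 0"
    using assms by (subst DERIV_imp_deriv[of _ "2 * w"]) (auto intro!: derivative_eq_intros)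
  moreover have "(\<lambda>w. w ^ 2) holomorphic_on W" by (intro holomorphic_intros)
  ultimately obtain r where "r > 0" "ball w r \<subseteq> W" "inj_on (\<lambda>w. w ^ 2) (ball w r)"
    using has_complex_derivative_locally_injective[of "\<lambda>w. w ^ 2" W w] assms by metis
  then show ?thesis by blast
qed

text \<open>The function \<open>c \<circ> f\<close> is zero over \<open>A\<close> and infinite over
  \<open>B\<close>; even local degrees there give a root off these two fibres. The equation
  \<open>f x = c' (u x ^ 2)\<close> then exhibits \<open>f\<close> as a locally injective function
  of \<open>u\<close>.\<close>

lemma square_root_of_map:
  fixes c :: "'b \<Rightarrow> complex" and c' :: "complex \<Rightarrow> 'b"
  assumes B: "B \<in> topspace Y" "q \<in> topspace X" "f q = B"
    and c: "continuous_map (subtopology Y (topspace Y - {B})) euclidean c" "continuous_map euclidean Y c'"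
      "\<And>y. y \<in> topspace Y \<Longrightarrow> y \<noteq> B \<Longrightarrow> c' (c y) = y"
      "\<And>w. c' w \<in> topspace Y - {B}" "\<And>w. c (c' w) = w" "c' 0 = A"
    and even: "\<And>x. x \<in> topspace X \<Longrightarrow> f x = A \<or> f x = B \<Longrightarrow> even (m x)"
  obtains u :: "'a \<Rightarrow> complex" where
    "continuous_map (subtopology X {x \<in> topspace X. f x \<notin> {A, B}}) (top_of_set (- {0})) u"
    "\<forall>x \<in> {x \<in> topspace X. f x \<notin> {A, B}}. f x = c' (u x ^ 2) \<and> u x ^ 2 = c (f x) \<and> u x \<noteq> 0"
proof -
  have A: "A \<in> topspace Y" using c(4)[of 0] c(6) by simp
  define E where "E = {x \<in> topspace X. f x \<in> {A, B}}"
  have XE: "topspace X - E = {x \<in> topspace X. f x \<notin> {A, B}}" by (auto simp: E_def)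
  have finE: "finite E" unfolding E_def using openin_avoid_fibres(2)[of "{A, B}"] A B by auto
  let ?X1 = "subtopology X (topspace X - E)"
  have "continuous_map ?X1 (subtopology Y (topspace Y - {B})) f"
    by (rule continuous_map_into_subtopology[OF continuous_map_from_subtopology[OF f]]) (use fX XE in auto)
  from continuous_map_compose[OF this c(1)] have g: "continuous_map ?X1 euclidean (c \<circ> f)" .
  have g0: "(c \<circ> f) z \<noteq> 0" if "z \<in> topspace X - E" for z
  proof
    assume "(c \<circ> f) z = 0"
    then have "f z = A" using c(3)[of "f z"] c(6) fX that XE by auto
    then show False using that XE by auto
  qed
  \<comment> \<open>\<open>c \<circ> f\<close> depends on \<open>f\<close> alone, so the whole space
    serves as the neighbourhood in \<open>even_local_root_at\<close>.\<close>
  have loc: "local_root X E (c \<circ> f) e" if e: "e \<in> E - {q}" for e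
  proof (rule even_local_root_at[OF finE _ g g0])
    show "openin X (topspace X)" by simp
    show "even (m e)" using e even by (auto simp: E_def)
  qed (use e in \<open>auto simp: E_def\<close>)
  have "E \<subseteq> topspace X" "q \<in> E" using B by (auto simp: E_def)
  from S2_global_root[OF X finE this g g0 loc] obtain u where
    u: "continuous_map ?X1 euclidean u" "\<And>z. z \<in> topspace X - E \<Longrightarrow> u z ^ 2 = (c \<circ> f) z" by metis
  have u0: "u z \<noteq> 0" if "z \<in> topspace X - E" for z using u(2)[OF that] g0[OF that] by auto
  show ?thesis
  proof (rule that)
    show "continuous_map (subtopology X {x \<in> topspace X. f x \<notin> {A, B}}) (top_of_set (- {0})) u"
      unfolding XE[symmetric] by (rule continuous_map_into_subtopology[OF u(1)]) (use u0 in auto)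
    show "\<forall>x \<in> {x \<in> topspace X. f x \<notin> {A, B}}. f x = c' (u x ^ 2) \<and> u x ^ 2 = c (f x) \<and> u x \<noteq> 0"
    proof
      fix x assume x: "x \<in> {x \<in> topspace X. f x \<notin> {A, B}}"
      then have xE: "x \<in> topspace X - E" by (simp add: E_def)
      have "u x ^ 2 = c (f x)" using u(2)[OF xE] by simp
      moreover from this have "f x = c' (u x ^ 2)" using c(3)[of "f x"] fX x by auto
      moreover have "u x \<noteq> 0" by (rule u0[OF xE])
      ultimately show "f x = c' (u x ^ 2) \<and> u x ^ 2 = c (f x) \<and> u x \<noteq> 0" by blast
    qed
  qed
qed

lemma square_root_proper:
  fixes c :: "'b \<Rightarrow> complex" and c' :: "complex \<Rightarrow> 'b"
  assumes c: "continuous_map euclidean Y c'" "\<And>w. c' w \<in> topspace Y - {B}" "\<And>w. c (c' w) = w" "c' 0 = A"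
    and u: "continuous_map (subtopology X {x \<in> topspace X. f x \<notin> {A, B}}) (top_of_set (- {0})) u"
    "\<And>x. x \<in> topspace X \<Longrightarrow> f x \<notin> {A, B} \<Longrightarrow> f x = c' (u x ^ 2)"
  shows "continuous_map (top_of_set (- {0})) Y (\<lambda>w. c' (w ^ 2))"
    "\<And>w. w \<noteq> 0 \<Longrightarrow> c' (w ^ 2) \<in> topspace Y - {A, B}"
    "proper_map (subtopology X {x \<in> topspace X. f x \<notin> {A, B}}) (top_of_set (- {0})) u"
proof -
  have "continuous_map (top_of_set (- {0})) euclidean (\<lambda>w::complex. w ^ 2)" by (auto intro!: continuous_intros)
  from continuous_map_compose[OF this c(1)] show g: "continuous_map (top_of_set (- {0})) Y (\<lambda>w. c' (w ^ 2))"
    by (simp add: o_def)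
  have "c' w \<noteq> A" if "w \<noteq> 0" for w using c(3)[of w] c(3)[of 0] c(4) that by auto
  then show gV: "c' (w ^ 2) \<in> topspace Y - {A, B}" if "w \<noteq> 0" for w
    using c(2)[of "w ^ 2"] that by auto
  have eq: "{x \<in> topspace X. f x \<in> topspace Y - {A, B}} = {x \<in> topspace X. f x \<notin> {A, B}}" using fX by auto
  show "proper_map (subtopology X {x \<in> topspace X. f x \<notin> {A, B}}) (top_of_set (- {0})) u"
    using proper_of_factor[of "topspace Y - {A, B}" "- {0}" u "\<lambda>w. c' (w ^ 2)"] u g gV unfolding eq by auto
qed

text \<open>The exact half is recorded, not only evenness, because
  \<open>four_dvd_card_fibre\<close> halves the set \<open>u = - a\<close> once more.\<close>

lemma square_root_balance:
  fixes c :: "'b \<Rightarrow> complex" and c' :: "complex \<Rightarrow> 'b"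
  assumes B: "B \<in> topspace Y" and A: "A \<in> topspace Y"
    and c: "continuous_map euclidean Y c'" "\<And>w. c' w \<in> topspace Y - {B}" "\<And>w. c (c' w) = w" "c' 0 = A"
    and u: "continuous_map (subtopology X {x \<in> topspace X. f x \<notin> {A, B}}) (top_of_set (- {0})) u"
    "\<And>x. x \<in> topspace X \<Longrightarrow> f x \<notin> {A, B} \<Longrightarrow> f x = c' (u x ^ 2)"
    and "a \<noteq> 0" "\<And>x. x \<in> topspace X \<Longrightarrow> f x = c' (a ^ 2) \<Longrightarrow> m x = 2"
  shows "finite {x \<in> topspace X. f x = c' (a ^ 2)}"
    "card {x \<in> topspace X. f x = c' (a ^ 2)} = 2 * card {x \<in> topspace X. f x = c' (a ^ 2) \<and> u x = - a}"
proof -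
  let ?V = "topspace Y - {A, B}"
  let ?X1 = "{x \<in> topspace X. f x \<notin> {A, B}}"
  have injc: "inj c'" using c(3) by (metis injI)
  have g: "continuous_map (top_of_set (- {0})) Y (\<lambda>w. c' (w ^ 2))" by (rule square_root_proper(1)[OF c u])
  have prp: "proper_map (subtopology X ?X1) (top_of_set (- {0})) u" by (rule square_root_proper(3)[OF c u])
  have gV: "c' (w ^ 2) \<in> ?V" if "w \<in> - {0}" for w
    using square_root_proper(2)[OF c u] that by auto
  have oX1: "openin X ?X1" using openin_avoid_fibres(1)[of "{A, B}"] A B by auto
  have conn: "connected (- {0 :: complex})" by (rule connected_punctured_universe) simp
  have inj: "\<exists>r>0. ball w r \<subseteq> - {0} \<and> inj_on (\<lambda>w. c' (w ^ 2)) (ball w r)" if w: "w \<in> - {0}" for w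
  proof -
    obtain r where "r > 0" "ball w r \<subseteq> - {0}" "inj_on (\<lambda>w. w ^ 2) (ball w r)"
      using locally_inj_power[of w "- {0}"] w by (auto simp: open_Compl)
    then show ?thesis using injc by (intro exI[of _ r]) (auto simp: inj_on_def)
  qed
  have bal: "finite {x \<in> ?X1. u x = b}" "(\<Sum>x | x \<in> ?X1 \<and> u x = a. m x) = (\<Sum>x | x \<in> ?X1 \<and> u x = b. m x)" if "b \<noteq> 0" for b
    using fibre_balance[OF _ conn oX1 prp u(1) g _ inj, of a b] fibre_balance[OF _ conn oX1 prp u(1) g _ inj, of b b] u(2) that \<open>a \<noteq> 0\<close> by (auto simp: open_Compl)
  have aV: "c' (a ^ 2) \<notin> {A, B}" using gV[of a] \<open>a \<noteq> 0\<close> by auto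
  have pm: "(x \<in> ?X1 \<and> (u x = a \<or> u x = - a)) \<longleftrightarrow> x \<in> topspace X \<and> f x = c' (a ^ 2)" for x
  proof
    assume "x \<in> ?X1 \<and> (u x = a \<or> u x = - a)"
    then show "x \<in> topspace X \<and> f x = c' (a ^ 2)" using u(2)[of x] by auto
  next
    assume x: "x \<in> topspace X \<and> f x = c' (a ^ 2)"
    then have "x \<in> ?X1" using aV by auto
    moreover from this have "c' (u x ^ 2) = c' (a ^ 2)" using u(2)[of x] x by simp
    then have "u x ^ 2 = a ^ 2" using injc by (metis injD)
    ultimately show "x \<in> ?X1 \<and> (u x = a \<or> u x = - a)" by (simp add: power2_eq_iff)
  qed
  let ?P = "{x \<in> ?X1. u x = a}" and ?N = "{x \<in> ?X1. u x = - a}"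
  have un: "{x \<in> topspace X. f x = c' (a ^ 2)} = ?P \<union> ?N" using pm by blast
  have fin: "finite ?P" "finite ?N" using bal(1)[of a] bal(1)[of "- a"] \<open>a \<noteq> 0\<close> by auto
  have m2: "m x = 2" if "x \<in> ?P \<union> ?N" for x using assms(10) that unfolding un[symmetric] by blast
  have "(\<Sum>x\<in>?P. m x) = (\<Sum>x\<in>?N. m x)" using bal(2)[of "- a"] \<open>a \<noteq> 0\<close> by simp
  then have card: "card ?P = card ?N" using m2 by simp
  have "?P \<inter> ?N = {}" using \<open>a \<noteq> 0\<close> by auto
  then have "card (?P \<union> ?N) = card ?P + card ?N" using fin by (rule_tac card_Un_disjoint)
  moreover have "?N = {x \<in> topspace X. f x = c' (a ^ 2) \<and> u x = - a}" using pm by blast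
  ultimately show "card {x \<in> topspace X. f x = c' (a ^ 2)} = 2 * card {x \<in> topspace X. f x = c' (a ^ 2) \<and> u x = - a}"
    unfolding un card by simp
  show "finite {x \<in> topspace X. f x = c' (a ^ 2)}" unfolding un using fin by simp
qed

lemma even_card_fibre:
  assumes ABC: "A \<in> topspace Y" "B \<in> topspace Y" "C \<in> topspace Y" "A \<noteq> B" "C \<noteq> A" "C \<noteq> B"
    and q: "q \<in> topspace X" "f q = B"
    and even: "\<And>x. x \<in> topspace X \<Longrightarrow> f x = A \<or> f x = B \<Longrightarrow> even (m x)"
    and two: "\<And>x. x \<in> topspace X \<Longrightarrow> f x = C \<Longrightarrow> m x = 2"
  shows "even (card {x \<in> topspace X. f x = C})"
proof -
  obtain c :: "'b \<Rightarrow> complex" and c' where c: "continuous_map (subtopology Y (topspace Y - {B})) euclidean c" "continuous_map euclidean Y c'"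
    "\<And>y. y \<in> topspace Y \<Longrightarrow> y \<noteq> B \<Longrightarrow> c' (c y) = y"
    "\<And>w. c' w \<in> topspace Y - {B}" "\<And>w. c (c' w) = w" "c' 0 = A" "c A = 0"
    using S2_coordinate[OF Y ABC(1,2,4)] by metis
  have "\<exists>u. continuous_map (subtopology X {x \<in> topspace X. f x \<notin> {A, B}}) (top_of_set (- {0})) u \<and>
    (\<forall>x \<in> {x \<in> topspace X. f x \<notin> {A, B}}. f x = c' (u x ^ 2) \<and> u x ^ 2 = c (f x) \<and> u x \<noteq> 0)"
    by (rule square_root_of_map[of B q c c' A]) (fact ABC q c even | blast)+
  then obtain u where u: "continuous_map (subtopology X {x \<in> topspace X. f x \<notin> {A, B}}) (top_of_set (- {0})) u"
    and uf: "\<forall>x \<in> {x \<in> topspace X. f x \<notin> {A, B}}. f x = c' (u x ^ 2) \<and> u x ^ 2 = c (f x) \<and> u x \<noteq> 0"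
    by blast
  have u2: "f x = c' (u x ^ 2)" if "x \<in> topspace X" "f x \<notin> {A, B}" for x using uf that by blast
  define a where "a = csqrt (c C)"
  have a2: "c' (a ^ 2) = C" using c(3) ABC by (simp add: a_def)
  have a0: "a \<noteq> 0" using a2 c(6) ABC by auto
  from square_root_balance(2)[OF ABC(2,1) c(2,4,5,6) u u2 a0] two
  show ?thesis unfolding a2 by simp
qed

text \<open>The second root \<open>v\<close> of \<open>u - a\<close> exists because all its zeros
  and poles have even order in the topological sense: zeros lie over \<open>C\<close>, where the
  local degree is 2, and poles over \<open>B\<close>, where degree 4 of \<open>f\<close> leaves
  order 2 for \<open>u\<close>.\<close>

lemma four_dvd_card_fibre:
  assumes ABC: "A \<in> topspace Y" "B \<in> topspace Y" "C \<in> topspace Y" "A \<noteq> B" "C \<noteq> A" "C \<noteq> B"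
    and q: "q \<in> topspace X" "f q = B"
    and even: "\<And>x. x \<in> topspace X \<Longrightarrow> f x = A \<Longrightarrow> even (m x)"
    and four: "\<And>x. x \<in> topspace X \<Longrightarrow> f x = B \<Longrightarrow> m x = 4"
    and two: "\<And>x. x \<in> topspace X \<Longrightarrow> f x = C \<Longrightarrow> m x = 2"
  shows "4 dvd card {x \<in> topspace X. f x = C}"
proof -
  obtain c :: "'b \<Rightarrow> complex" and c' where c: "continuous_map (subtopology Y (topspace Y - {B})) euclidean c" "continuous_map euclidean Y c'"
    "\<And>y. y \<in> topspace Y \<Longrightarrow> y \<noteq> B \<Longrightarrow> c' (c y) = y"
    "\<And>w. c' w \<in> topspace Y - {B}" "\<And>w. c (c' w) = w" "c' 0 = A" "c A = 0"
    using S2_coordinate[OF Y ABC(1,2,4)] by metis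
  have even': "even (m x)" if "x \<in> topspace X" "f x = A \<or> f x = B" for x
    using even four that by fastforce
  let ?X1 = "{x \<in> topspace X. f x \<notin> {A, B}}"
  have "\<exists>u. continuous_map (subtopology X ?X1) (top_of_set (- {0})) u \<and>
    (\<forall>x \<in> ?X1. f x = c' (u x ^ 2) \<and> u x ^ 2 = c (f x) \<and> u x \<noteq> 0)"
    by (rule square_root_of_map[of B q c c' A]) (fact ABC q c even' | blast)+
  then obtain u where u1: "continuous_map (subtopology X ?X1) (top_of_set (- {0})) u"
    and uf1: "\<forall>x \<in> ?X1. f x = c' (u x ^ 2) \<and> u x ^ 2 = c (f x) \<and> u x \<noteq> 0"
    by blast
  have ux: "f x = c' (u x ^ 2)" "u x ^ 2 = c (f x)" "u x \<noteq> 0" if "x \<in> topspace X" "f x \<notin> {A, B}" for x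
    using uf1 that by blast+
  note u = u1 ux
  define a where "a = csqrt (c C)"
  have a2: "c' (a ^ 2) = C" using c(3) ABC by (simp add: a_def)
  have a0: "a \<noteq> 0" using a2 c(6) ABC by auto
  have injc: "inj c'" using c(5) by (metis injI)
  have c2: "card {x \<in> topspace X. f x = C} = 2 * card {x \<in> topspace X. f x = C \<and> u x = - a}"
    using square_root_balance(2)[OF ABC(2,1) c(2,4,5,6) u(1,2) a0] two unfolding a2 by simp
  have uc: "continuous_map (subtopology X ?X1) euclidean u" using u(1) continuous_map_into_fulltopology by blast
  \<comment> \<open>The zeros of \<open>u - a\<close>, namely the points over \<open>C\<close> with
    \<open>u = a\<close>, join the two excluded fibres.\<close>
  define E where "E = {x \<in> topspace X. f x \<in> {A, B} \<or> f x = C \<and> u x = a}"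
  have finE: "finite E"
    by (rule finite_subset[OF _ openin_avoid_fibres(2)[of "{A, B, C}"]]) (use ABC in \<open>auto simp: E_def\<close>)
  let ?X2 = "topspace X - E"
  have X12: "?X2 \<subseteq> ?X1" by (auto simp: E_def)
  have X2: "x \<in> ?X2 \<longleftrightarrow> x \<in> ?X1 \<and> u x \<noteq> a" for x
    using u(2)[of x] a2 by (auto simp: E_def)
  have uc2: "continuous_map (subtopology X ?X2) euclidean u"
    by (rule continuous_map_from_subtopology_mono[OF uc X12])
  have g: "continuous_map (subtopology X ?X2) euclidean (\<lambda>x. u x - a)"
    by (intro continuous_map_diff uc2) auto
  have g0: "u z - a \<noteq> 0" if "z \<in> ?X2" for z using that X2 by simp
  have u0: "u z \<noteq> 0" if "z \<in> ?X2" for z using u(4)[of z] that X2 by auto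
  have uf: "u x' ^ 2 = u x ^ 2" if "x \<in> ?X2" "x' \<in> ?X2" "f x = f x'" for x x'
    using u(3) that X2 by (metis (mono_tags, lifting) mem_Collect_eq)
  have loc: "local_root X E (\<lambda>x. u x - a) e" if e: "e \<in> E - {q}" for e
  proof -
    have eX: "e \<in> topspace X" using e by (auto simp: E_def)
    consider "f e = B" | "f e = A" | "f e = C" "u e = a" using e by (auto simp: E_def)
    then show ?thesis
    proof cases
      case 1
      show ?thesis
      proof (rule even_local_root_at_4[OF finE eX g _ uc2])
        show "u z - a \<noteq> 0" "u z \<noteq> 0" if "z \<in> ?X2" for z by (rule g0[OF that] u0[OF that])+
        show "m e = 4" by (rule four[OF eX 1])
        show "u x' ^ 2 = u x ^ 2" if "x \<in> ?X2" "x' \<in> ?X2" "f x = f x'" for x x' by (rule uf[OF that])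
      qed simp
    next
      case 2
      \<comment> \<open>Near a point over \<open>A\<close> the values of \<open>u\<close> are small.
        Where \<open>cmod u < cmod a\<close>, the factor \<open>1 - u / a\<close> lies in the right
        half-plane, so the product of \<open>csqrt (- a)\<close> with its principal root is
        continuous.\<close>
      define N where "N = {x \<in> topspace X - {x \<in> topspace X. f x = B}. cmod (c (f x)) < (cmod a)\<^sup>2} \<inter> (topspace X - (E - {e}))"
      have oB: "openin X {x \<in> topspace X. f x \<notin> {B}}" using openin_avoid_fibres(1)[of "{B}"] ABC by auto
      have "continuous_map (subtopology X {x \<in> topspace X. f x \<notin> {B}}) (subtopology Y (topspace Y - {B})) f"
        by (rule continuous_map_into_subtopology[OF continuous_map_from_subtopology[OF f]]) (use fX in auto)
      from chart_openin[OF continuous_map_compose[OF this c(1)] oB, of "ball 0 ((cmod a)\<^sup>2)"]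
      have "openin X {x \<in> {x \<in> topspace X. f x \<notin> {B}}. cmod (c (f x)) < (cmod a)\<^sup>2}" by simp
      moreover have "{x \<in> {x \<in> topspace X. f x \<notin> {B}}. cmod (c (f x)) < (cmod a)\<^sup>2} = {x \<in> topspace X - {x \<in> topspace X. f x = B}. cmod (c (f x)) < (cmod a)\<^sup>2}"
        by auto
      ultimately have oN: "openin X N" unfolding N_def using nhd_without(1)[OF finE eX] by auto
      have eN: "e \<in> N" using eX 2 c(7) a0 ABC nhd_without(2)[OF finE eX] by (auto simp: N_def)
      have sub: "N - {e} \<subseteq> ?X2" by (auto simp: N_def)
      have small: "1 - u x / a \<notin> \<real>\<^sub>\<le>\<^sub>0" if x: "x \<in> N - {e}" for x
      proof -
        have "x \<in> ?X1" using sub x X12 by blast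
        then have "cmod (u x) ^ 2 < (cmod a)\<^sup>2" using u(3)[of x] x by (auto simp: N_def simp flip: norm_power)
        then have "cmod (u x / a) < 1" using a0 by (simp add: norm_divide power_less_imp_less_base)
        then have "Re (u x / a) < 1" using complex_Re_le_cmod le_less_trans by blast
        then show ?thesis by (auto simp: complex_nonpos_Reals_iff)
      qed
      have "continuous_map (subtopology X (N - {e})) euclidean u"
        by (rule continuous_map_from_subtopology_mono[OF uc2 sub])
      then have "continuous_map (subtopology X (N - {e})) (top_of_set (u ` (N - {e}))) u"
        by (intro continuous_map_into_subtopology) auto
      moreover have "continuous_on (u ` (N - {e})) (\<lambda>w. csqrt (- a) * csqrt (1 - w / a))"
        using small a0 by (intro continuous_on_mult continuous_on_const
            continuous_on_compose2[OF continuous_on_csqrt] continuous_intros) auto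
      then have "continuous_map (top_of_set (u ` (N - {e}))) euclidean (\<lambda>w. csqrt (- a) * csqrt (1 - w / a))" by simp
      ultimately have "continuous_map (subtopology X (N - {e})) euclidean ((\<lambda>w. csqrt (- a) * csqrt (1 - w / a)) \<circ> u)"
        by (rule continuous_map_compose)
      moreover have "((\<lambda>w. csqrt (- a) * csqrt (1 - w / a)) \<circ> u) z ^ 2 = u z - a" for z
        using a0 by (simp add: power_mult_distrib field_simps)
      ultimately show ?thesis unfolding local_root_def using oN eN sub by blast
    next
      case 3
      have oX1: "openin X ?X1" using openin_avoid_fibres(1)[of "{A, B}"] ABC by auto
      \<comment> \<open>Of the two roots \<open>u\<close> and \<open>- u\<close> only one lies in
        the half-plane containing \<open>a\<close>, so on \<open>W\<close> the value of
        \<open>f\<close> determines \<open>u - a\<close>.\<close>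
      define W where "W = {x \<in> ?X1. u x \<in> {w. Re (w / a) > 0}}"
      have "open {w. Re (w / a) > 0}" by (intro open_Collect_less continuous_intros) (use a0 in auto)
      then have oW: "openin X W" unfolding W_def by (rule chart_openin[OF uc oX1])
      have eW: "e \<in> W" using 3 eX ABC a0 by (auto simp: W_def)
      show ?thesis
      proof (rule even_local_root_at[OF finE eX g g0 oW eW])
        show "even (m e)" using two[OF eX 3(1)] by simp
        fix x x' assume x: "x \<in> W - E" "x' \<in> W - E" "f x = f x'"
        have "x \<in> ?X2" "x' \<in> ?X2" using x by (auto simp: W_def)
        from uf[OF this x(3)] have "u x' = u x \<or> u x' = - u x" by (simp add: power2_eq_iff)
        moreover have "u x' \<noteq> - u x"
        proof
          assume "u x' = - u x"
          then have "u x' / a = - (u x / a)" by simp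
          moreover have "Re (u x' / a) > 0" "Re (u x / a) > 0" using x by (auto simp: W_def)
          ultimately show False by simp
        qed
        ultimately show "u x' - a = u x - a" by simp
      qed
    qed
  qed
  have "E \<subseteq> topspace X" "q \<in> E" using q by (auto simp: E_def)
  from S2_global_root[OF X finE this g g0 loc] obtain v where
    v: "continuous_map (subtopology X ?X2) euclidean v" "\<And>z. z \<in> ?X2 \<Longrightarrow> v z ^ 2 = u z - a" by metis
  define b where "b = csqrt (- a)"
  have b2: "b ^ 2 = - a" by (simp add: b_def)
  \<comment> \<open>The values of \<open>v\<close> lie here: \<open>u = v ^ 2 + a\<close> avoids 0
    and \<open>a\<close>, hence \<open>v\<close> avoids \<open>b\<close>, \<open>- b\<close> and
    0.\<close>
  define W where "W = - {0, b, - b}"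
  have Wmem: "w \<in> W \<longleftrightarrow> w \<noteq> 0 \<and> w ^ 2 + a \<noteq> 0" for w
    using b2 by (auto simp: W_def eq_neg_iff_add_eq_0[symmetric] power2_eq_iff simp flip: b2)
  have oW: "open W" unfolding W_def by (intro open_Compl finite_imp_closed) auto
  have cW: "connected W"
    unfolding W_def Compl_eq_Diff_UNIV by (rule connected_open_diff_countable) auto
  have vW: "v z \<in> W" if "z \<in> ?X2" for z
    using v(2)[OF that] u0[OF that] g0[OF that] by (auto simp: Wmem)
  have vcW: "continuous_map (subtopology X ?X2) (top_of_set W) v"
    by (rule continuous_map_into_subtopology[OF v(1)]) (use vW in auto)
  have prop1: "proper_map (subtopology X ?X1) (top_of_set (- {0})) u"
    by (rule square_root_proper(3)[OF c(2,4,5,6) u(1,2)])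
  have prp: "proper_map (subtopology X ?X2) (top_of_set W) v"
  proof (rule proper_map_from_composition_right[OF _ _ vcW])
    show "Hausdorff_space (top_of_set W)" by (intro Hausdorff_space_subtopology) simp
    show "continuous_map (top_of_set W) (top_of_set (- {0, a})) (\<lambda>w. w ^ 2 + a)"
      by (intro continuous_map_into_subtopology) (auto simp: Wmem intro!: continuous_intros)
    have r: "{x \<in> topspace (subtopology X ?X1). u x \<in> - {0, a}} = ?X2" using X2 u(4) by auto
    have "?X1 \<inter> ?X2 = ?X2" "- {0} \<inter> - {0, a} = - {0, a}" using X12 by auto
    then have "proper_map (subtopology X ?X2) (top_of_set (- {0, a})) u"
      using proper_map_restriction[OF prop1 r] by (simp only: subtopology_subtopology)
    then show "proper_map (subtopology X ?X2) (top_of_set (- {0, a})) ((\<lambda>w. w ^ 2 + a) \<circ> v)"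
      by (rule proper_map_cong) (use v(2) in auto)
  qed
  have oX2: "openin X ?X2"
    using finE Hausdorff(1) \<open>E \<subseteq> topspace X\<close> by (metis Hausdorff_imp_t1_space openin_diff openin_topspace t1_space_closedin_finite)
  have gg: "continuous_map (top_of_set W) Y (\<lambda>w. c' ((w ^ 2 + a) ^ 2))"
  proof -
    have "continuous_map (top_of_set W) euclidean (\<lambda>w. (w ^ 2 + a) ^ 2)" by (auto intro!: continuous_intros)
    from continuous_map_compose[OF this c(2)] show ?thesis by (simp add: o_def)
  qed
  have inj: "\<exists>r>0. ball w r \<subseteq> W \<and> inj_on (\<lambda>w. c' ((w ^ 2 + a) ^ 2)) (ball w r)" if w: "w \<in> W" for w
  proof -
    \<comment> \<open>The derivative vanishes only at the three points removed in
      \<open>W\<close>.\<close>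
    have "deriv (\<lambda>w. (w ^ 2 + a) ^ 2) w = 2 * (w ^ 2 + a) * (2 * w)"
      by (rule DERIV_imp_deriv) (auto intro!: derivative_eq_intros)
    then have "deriv (\<lambda>w. (w ^ 2 + a) ^ 2) w \<noteq> 0" using w unfolding Wmem by (metis mult_eq_0_iff zero_neq_numeral)
    moreover have "(\<lambda>w. (w ^ 2 + a) ^ 2) holomorphic_on W" by (intro holomorphic_intros)
    ultimately obtain r where "r > 0" "ball w r \<subseteq> W" "inj_on (\<lambda>w. (w ^ 2 + a) ^ 2) (ball w r)"
      using has_complex_derivative_locally_injective[of "\<lambda>w. (w ^ 2 + a) ^ 2" W w] w oW by metis
    then show ?thesis using injc by (intro exI[of _ r]) (auto simp: inj_on_def)
  qed
  have fv: "f x = c' ((v x ^ 2 + a) ^ 2)" if "x \<in> ?X2" for x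
    using v(2)[OF that] u(2)[of x] that X2 by auto
  \<comment> \<open>Over \<open>u = - a\<close> one has \<open>v ^ 2 = - 2 * a\<close>, so
    \<open>\<beta>\<close> and \<open>- \<beta>\<close> are the two values of \<open>v\<close> to be
    balanced.\<close>
  define \<beta> where "\<beta> = csqrt (- 2 * a)"
  have \<beta>2: "\<beta> ^ 2 = - 2 * a" by (simp add: \<beta>_def)
  have \<beta>0: "\<beta> \<noteq> 0" using \<beta>2 a0 by auto
  have \<beta>W: "\<beta> \<in> W" "- \<beta> \<in> W" using \<beta>2 a0 \<beta>0 by (auto simp: Wmem)
  have bal: "finite {x \<in> ?X2. v x = w}" "(\<Sum>x | x \<in> ?X2 \<and> v x = w. m x) = (\<Sum>x | x \<in> ?X2 \<and> v x = w'. m x)"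
    if "w \<in> W" "w' \<in> W" for w w'
    using fibre_balance[OF oW cW oX2 prp vcW gg _ inj that] fv by auto
  let ?P = "{x \<in> ?X2. v x = \<beta>}" and ?N = "{x \<in> ?X2. v x = - \<beta>}"
  have un: "{x \<in> topspace X. f x = C \<and> u x = - a} = ?P \<union> ?N"
  proof (intro equalityI subsetI)
    fix x assume x: "x \<in> {x \<in> topspace X. f x = C \<and> u x = - a}"
    have "- a \<noteq> a"
    proof
      assume "- a = a"
      then have "a + a = 0" by (metis add.right_inverse)
      then have "2 * a = 0" by simp
      then show False using a0 by simp
    qed
    then have x2: "x \<in> ?X2" using X2[of x] x ABC by simp
    then have "v x ^ 2 = \<beta> ^ 2" using v(2)[OF x2] x \<beta>2 by simp
    then show "x \<in> ?P \<union> ?N" using x2 by (auto simp: power2_eq_iff)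
  next
    fix x assume x: "x \<in> ?P \<union> ?N"
    then have x2: "x \<in> ?X2" by auto
    have "v x ^ 2 = \<beta> ^ 2" using x by auto
    then have ua: "u x = - a" using v(2)[OF x2] \<beta>2 by (simp add: algebra_simps)
    then have "f x = C" using u(2)[of x] x2 X2 a2 by auto
    then show "x \<in> {x \<in> topspace X. f x = C \<and> u x = - a}" using x2 ua by auto
  qed
  have fin: "finite ?P" "finite ?N" by (rule bal(1)[OF \<beta>W]) (rule bal(1)[OF \<beta>W(2,1)])
  have m2: "m x = 2" if "x \<in> ?P \<union> ?N" for x using two that unfolding un[symmetric] by blast
  have "(\<Sum>x\<in>?P. m x) = (\<Sum>x\<in>?N. m x)" using bal(2)[OF \<beta>W] by simp
  then have card: "card ?P = card ?N" using m2 by simp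
  have "?P \<inter> ?N = {}" using \<beta>0 by auto
  then have "card (?P \<union> ?N) = card ?P + card ?N" using fin by (rule_tac card_Un_disjoint)
  then have "card {x \<in> topspace X. f x = C} = 4 * card ?N" using c2 un card by simp
  then show ?thesis by simp
qed

end

section \<open>The sphere as a quotient of the plane\<close>

text \<open>Further out on a ray the left side \<open>r\<^sup>2\<close> is multiplied by
  \<open>t\<^sup>2 > 1\<close>, while neither factor on the right grows and their product is
  positive; so the surface is not met again.\<close>

lemma pillow_ray_unique:
  fixes p q r t :: real
  assumes "t > 0" "p\<^sup>2 \<le> 1" "q\<^sup>2 \<le> 1" "r\<^sup>2 = (1 - p\<^sup>2) * (1 - q\<^sup>2)"
    "(t * p)\<^sup>2 \<le> 1" "(t * q)\<^sup>2 \<le> 1" "(t * r)\<^sup>2 = (1 - (t * p)\<^sup>2) * (1 - (t * q)\<^sup>2)"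
  shows "t \<le> 1"
proof (rule ccontr)
  assume "\<not> t \<le> 1"
  then have t: "1 < t\<^sup>2" using assms(1) by (simp add: power2_gt_1_iff)
  have le: "x\<^sup>2 < 1 \<and> 1 - (t * x)\<^sup>2 \<le> 1 - x\<^sup>2" if "(t * x)\<^sup>2 \<le> 1" for x
  proof -
    have "x\<^sup>2 \<le> (t * x)\<^sup>2" using t by (simp add: power_mult_distrib mult_le_cancel_right1)
    moreover have "x\<^sup>2 < 1"
    proof (cases "x = 0")
      case False
      then have "x\<^sup>2 < t\<^sup>2 * x\<^sup>2" using t by simp
      then show ?thesis using that by (simp add: power_mult_distrib)
    qed simp
    ultimately show ?thesis by simp
  qed
  have "(t * r)\<^sup>2 \<le> (1 - p\<^sup>2) * (1 - q\<^sup>2)"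
    unfolding assms(7) using le[OF assms(5)] le[OF assms(6)] assms(5,6) by (intro mult_mono) auto
  moreover have "0 < (1 - p\<^sup>2) * (1 - q\<^sup>2)" using le[OF assms(5)] le[OF assms(6)] by simp
  from mult_strict_right_mono[OF t this] have "r\<^sup>2 < (t * r)\<^sup>2"
    unfolding power_mult_distrib assms(4) by (simp only: mult_1)
  ultimately show False using assms(4) by simp
qed

lemma pillow_ray_exists:
  fixes p q r :: real
  assumes "p \<noteq> 0 \<or> q \<noteq> 0 \<or> r \<noteq> 0"
  obtains t where "t > 0" "\<bar>t * p\<bar> \<le> 1" "\<bar>t * q\<bar> \<le> 1" "(t * r)\<^sup>2 = (1 - (t * p)\<^sup>2) * (1 - (t * q)\<^sup>2)"
proof -
  define \<phi> where "\<phi> t = (1 - (t * p)\<^sup>2) * (1 - (t * q)\<^sup>2) - (t * r)\<^sup>2" for t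
  \<comment> \<open>At the origin the difference is 1. Where the ray reaches the edge of the square,
    or where \<open>t * r\<close> has modulus 1 if \<open>p = q = 0\<close>, it is at most 0, so the
    intermediate value theorem gives a crossing.\<close>
  have "\<exists>b>0. \<phi> b \<le> 0 \<and> b * \<bar>p\<bar> \<le> 1 \<and> b * \<bar>q\<bar> \<le> 1"
  proof (cases "p = 0 \<and> q = 0")
    case True
    then have "r \<noteq> 0" using assms by auto
    then show ?thesis using True by (intro exI[of _ "1 / \<bar>r\<bar>"]) (auto simp: \<phi>_def power_divide)
  next
    case False
    show ?thesis
    proof (cases "\<bar>q\<bar> \<le> \<bar>p\<bar>")
      case True
      then have "p \<noteq> 0" using False by auto
      then show ?thesis using True by (intro exI[of _ "1 / \<bar>p\<bar>"]) (auto simp: \<phi>_def power_divide)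
    next
      case F2: False
      then have "q \<noteq> 0" by auto
      then show ?thesis using F2 by (intro exI[of _ "1 / \<bar>q\<bar>"]) (auto simp: \<phi>_def power_divide)
    qed
  qed
  then obtain b where b: "b > 0" "\<phi> b \<le> 0" "b * \<bar>p\<bar> \<le> 1" "b * \<bar>q\<bar> \<le> 1" by blast
  have "\<exists>t\<ge>0. t \<le> b \<and> \<phi> t = 0"
    by (rule IVT2') (use b in \<open>auto simp: \<phi>_def intro!: continuous_intros\<close>)
  then obtain t where t: "0 \<le> t" "t \<le> b" "\<phi> t = 0" by blast
  have "t \<noteq> 0" using t(3) by (auto simp: \<phi>_def)
  moreover have "\<bar>t * x\<bar> \<le> 1" if "b * \<bar>x\<bar> \<le> 1" for x
    using mult_right_mono[OF t(2), of "\<bar>x\<bar>"] that t(1) by (simp add: abs_mult)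
  ultimately show ?thesis using that[of t] t b by (auto simp: \<phi>_def)
qed

definition gauss_int :: "complex set" where "gauss_int = {z. Re z \<in> \<int> \<and> Im z \<in> \<int>}"

text \<open>With \<open>p = cos X\<close>, \<open>q = cos Y\<close>, \<open>r = sin X sin Y\<close> the surface \<open>r\<^sup>2 = (1 - p\<^sup>2) (1 - q\<^sup>2)\<close>, \<open>\<bar>p\<bar>, \<bar>q\<bar> \<le> 1\<close> is the quotient of
  the plane by the lattice and \<open>z \<mapsto> - z\<close>; it is met once by every ray from the origin. In the coordinates
  \<open>(p + q, (p - q) + \<i> r)\<close> the rotation \<open>z \<mapsto> \<i> z\<close> becomes a half-turn about the first axis.\<close>

definition pillow :: "complex \<Rightarrow> real \<times> complex" where
  "pillow z = (cos (2 * pi * Re z) + cos (2 * pi * Im z),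
     Complex (cos (2 * pi * Re z) - cos (2 * pi * Im z)) (sin (2 * pi * Re z) * sin (2 * pi * Im z)))"

text \<open>Radial projection of the pillow surface to the unit sphere; on the surface it is
  injective by uniqueness on rays, and it is onto by existence.\<close>

definition pill :: "complex \<Rightarrow> real \<times> complex" where
  "pill z = pillow z /\<^sub>R norm (pillow z)"

lemma pillow_nonzero: "pillow z \<noteq> 0"
proof
  assume "pillow z = 0"
  then have "cos (2 * pi * Re z) = 0" "cos (2 * pi * Im z) = 0" "sin (2 * pi * Re z) * sin (2 * pi * Im z) = 0"
    by (auto simp: pillow_def zero_prod_def complex_eq_iff)
  then show False using sin_cos_squared_add[of "2 * pi * Re z"] sin_cos_squared_add[of "2 * pi * Im z"] by auto
qed

lemma pillow_eq_scaled:
  assumes "pillow w = t *\<^sub>R pillow z"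
  shows "cos (2 * pi * Re w) = t * cos (2 * pi * Re z)" "cos (2 * pi * Im w) = t * cos (2 * pi * Im z)"
    "sin (2 * pi * Re w) * sin (2 * pi * Im w) = t * (sin (2 * pi * Re z) * sin (2 * pi * Im z))"
proof -
  have e: "cos (2 * pi * Re w) + cos (2 * pi * Im w) = t * (cos (2 * pi * Re z) + cos (2 * pi * Im z))"
    "cos (2 * pi * Re w) - cos (2 * pi * Im w) = t * (cos (2 * pi * Re z) - cos (2 * pi * Im z))"
    "sin (2 * pi * Re w) * sin (2 * pi * Im w) = t * (sin (2 * pi * Re z) * sin (2 * pi * Im z))"
    using assms by (auto simp: pillow_def complex_eq_iff)
  show "cos (2 * pi * Re w) = t * cos (2 * pi * Re z)" "cos (2 * pi * Im w) = t * cos (2 * pi * Im z)"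
    using e(1,2) by (simp_all add: algebra_simps)
  show "sin (2 * pi * Re w) * sin (2 * pi * Im w) = t * (sin (2 * pi * Re z) * sin (2 * pi * Im z))" by (rule e(3))
qed

lemma pillow_scaled_le:
  assumes "pillow w = t *\<^sub>R pillow z" "t > 0"
  shows "t \<le> 1"
proof -
  note e = pillow_eq_scaled[OF assms(1), symmetric]
  show ?thesis
  proof (rule pillow_ray_unique[OF assms(2)])
    show "(cos (2 * pi * Re z))\<^sup>2 \<le> 1" "(cos (2 * pi * Im z))\<^sup>2 \<le> 1"
      "(t * cos (2 * pi * Re z))\<^sup>2 \<le> 1" "(t * cos (2 * pi * Im z))\<^sup>2 \<le> 1"
      unfolding e by (simp_all add: abs_square_le_1)
    show "(sin (2 * pi * Re z) * sin (2 * pi * Im z))\<^sup>2 = (1 - (cos (2 * pi * Re z))\<^sup>2) * (1 - (cos (2 * pi * Im z))\<^sup>2)"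
      "(t * (sin (2 * pi * Re z) * sin (2 * pi * Im z)))\<^sup>2 = (1 - (t * cos (2 * pi * Re z))\<^sup>2) * (1 - (t * cos (2 * pi * Im z))\<^sup>2)"
      unfolding e by (simp_all add: power_mult_distrib sin_squared_eq)
  qed
qed

text \<open>Each vector is a positive multiple of the other, and \<open>pillow_scaled_le\<close>
  bounds both reciprocal factors by 1.\<close>

lemma pill_eq_imp_pillow_eq:
  assumes "pill z = pill w"
  shows "pillow z = pillow w"
proof -
  let ?t = "norm (pillow w) / norm (pillow z)"
  have n: "norm (pillow z) > 0" "norm (pillow w) > 0" using pillow_nonzero by auto
  have "pillow w = norm (pillow w) *\<^sub>R pill w" "pillow z = norm (pillow z) *\<^sub>R pill z" using n by (auto simp: pill_def)
  then have "pillow w = norm (pillow w) *\<^sub>R pill z" "pillow z = norm (pillow z) *\<^sub>R pill w" using assms by auto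
  then have e: "pillow w = ?t *\<^sub>R pillow z" "pillow z = (1 / ?t) *\<^sub>R pillow w"
    by (auto simp: pill_def divide_inverse mult.commute)
  have "?t \<le> 1" by (rule pillow_scaled_le[OF e(1)]) (use n in auto)
  moreover have "1 / ?t \<le> 1" by (rule pillow_scaled_le[OF e(2)]) (use n in auto)
  ultimately have "?t = 1" using n by (simp add: field_simps)
  then show ?thesis using e(1) by (simp only: scaleR_one)
qed

lemma gauss_int_simps [simp]: "0 \<in> gauss_int" "1 \<in> gauss_int" "\<i> \<in> gauss_int" "of_int n \<in> gauss_int" "of_nat k \<in> gauss_int"
  by (auto simp: gauss_int_def)

lemma gauss_int_closed:
  assumes "z \<in> gauss_int" "w \<in> gauss_int"
  shows "z + w \<in> gauss_int" "z - w \<in> gauss_int" "- z \<in> gauss_int" "z * w \<in> gauss_int"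
  using assms by (auto simp: gauss_int_def)

lemma gauss_int_add_iff: "w \<in> gauss_int \<Longrightarrow> z + w \<in> gauss_int \<longleftrightarrow> z \<in> gauss_int"
  by (metis add_diff_cancel gauss_int_closed(1,2))

lemma gauss_int_minus_iff: "- z \<in> gauss_int \<longleftrightarrow> z \<in> gauss_int"
  by (metis minus_minus gauss_int_closed(3))

lemma gauss_int_i_iff: "\<i> * z \<in> gauss_int \<longleftrightarrow> z \<in> gauss_int"
proof -
  have "z = - (\<i> * (\<i> * z))" by simp
  then show ?thesis by (metis gauss_int_closed(3,4) gauss_int_simps(3))
qed

lemma two_pi_eq_iff: "(\<exists>n::int. 2 * pi * x = 2 * pi * y + 2 * pi * n) \<longleftrightarrow> x - y \<in> \<int>"
proof -
  have "2 * pi * x = 2 * pi * y + 2 * pi * of_int n \<longleftrightarrow> x - y = of_int n" for n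
  proof -
    have "2 * pi * x = 2 * pi * y + 2 * pi * of_int n \<longleftrightarrow> 2 * pi * x = 2 * pi * (y + of_int n)"
      by (simp add: algebra_simps)
    also have "\<dots> \<longleftrightarrow> x = y + of_int n" by simp
    finally show ?thesis by auto
  qed
  then show ?thesis by (auto simp: Ints_def)
qed

lemma sin_cos_2pi_eq: "sin (2 * pi * x) = sin (2 * pi * y) \<and> cos (2 * pi * x) = cos (2 * pi * y) \<longleftrightarrow> x - y \<in> \<int>"
  unfolding sin_cos_eq_iff two_pi_eq_iff[symmetric] by (auto simp: mult.commute mult.left_commute)

text \<open>Equal cosines leave a free sign for each sine; the product of the sines ties the two
  signs together, so modulo the lattice only \<open>z\<close> and \<open>- z\<close> remain.\<close>

lemma pillow_eq_iff: "pillow z = pillow w \<longleftrightarrow> z - w \<in> gauss_int \<or> z + w \<in> gauss_int"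
proof
  assume "pillow z = pillow w"
  then have "pillow z = 1 *\<^sub>R pillow w" by simp
  note e = pillow_eq_scaled[OF this, unfolded mult_1]
  have m: "z - w \<in> gauss_int" if "sin (2 * pi * Re z) = sin (2 * pi * Re w)" "sin (2 * pi * Im z) = sin (2 * pi * Im w)"
    using that e sin_cos_2pi_eq[of "Re z" "Re w"] sin_cos_2pi_eq[of "Im z" "Im w"] by (simp add: gauss_int_def)
  have p: "z + w \<in> gauss_int" if "sin (2 * pi * Re z) = - sin (2 * pi * Re w)" "sin (2 * pi * Im z) = - sin (2 * pi * Im w)"
    using that e sin_cos_2pi_eq[of "Re z" "- Re w"] sin_cos_2pi_eq[of "Im z" "- Im w"] by (simp add: gauss_int_def)
  have sq: "sin x = sin y \<or> sin x = - sin y" if "cos x = cos y" for x y :: real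
    using that sin_squared_eq[of x] sin_squared_eq[of y] by (metis power2_eq_iff)
  show "z - w \<in> gauss_int \<or> z + w \<in> gauss_int"
    using sq[OF e(1)] sq[OF e(2)] e(3) m p by fastforce
next
  assume "z - w \<in> gauss_int \<or> z + w \<in> gauss_int"
  then show "pillow z = pillow w"
  proof
    assume "z - w \<in> gauss_int"
    then show ?thesis using sin_cos_2pi_eq[of "Re z" "Re w"] sin_cos_2pi_eq[of "Im z" "Im w"]
      by (simp add: gauss_int_def pillow_def)
  next
    assume "z + w \<in> gauss_int"
    then show ?thesis using sin_cos_2pi_eq[of "Re z" "- Re w"] sin_cos_2pi_eq[of "Im z" "- Im w"]
      by (simp add: gauss_int_def pillow_def)
  qed
qed

lemma pill_eq_iff: "pill z = pill w \<longleftrightarrow> z - w \<in> gauss_int \<or> z + w \<in> gauss_int"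
  using pill_eq_imp_pillow_eq pillow_eq_iff by (metis pill_def)

lemma continuous_pill: "continuous_on UNIV pill"
proof -
  have "continuous_on UNIV pillow"
    unfolding pillow_def Complex_eq by (intro continuous_intros)
  then show ?thesis unfolding pill_def by (intro continuous_intros) (use pillow_nonzero in auto)
qed

lemma range_pill: "range pill = sph"
proof (intro equalityI subsetI)
  fix x assume "x \<in> range pill"
  then show "x \<in> sph" using pillow_nonzero by (auto simp: pill_def)
next
  fix x assume x: "x \<in> sph"
  obtain s c where sc: "x = (s, c)" by (cases x)
  \<comment> \<open>Inverts the coordinates \<open>(p + q, (p - q) + \<i> * r)\<close>.\<close>
  let ?p = "(s + Re c) / 2" and ?q = "(s - Re c) / 2" and ?r = "Im c"
  have "?p \<noteq> 0 \<or> ?q \<noteq> 0 \<or> ?r \<noteq> 0"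
  proof (rule ccontr)
    assume "\<not> ?thesis"
    then have "s + Re c = 0" "s - Re c = 0" "Im c = 0" by auto
    then have "s = 0" "c = 0" by (auto simp: complex_eq_iff)
    then show False using x sc by simp
  qed
  then obtain t where t: "t > 0" "\<bar>t * ?p\<bar> \<le> 1" "\<bar>t * ?q\<bar> \<le> 1" "(t * ?r)\<^sup>2 = (1 - (t * ?p)\<^sup>2) * (1 - (t * ?q)\<^sup>2)"
    using pillow_ray_exists by metis
  define X where "X = arccos (t * ?p)"
  \<comment> \<open>\<open>arccos\<close> only yields nonnegative sines, so the sign of
    \<open>r\<close> is carried by \<open>Y\<close>.\<close>
  define Y where "Y = (if ?r \<ge> 0 then arccos (t * ?q) else - arccos (t * ?q))"
  have cX: "cos X = t * ?p" "cos Y = t * ?q" using t by (auto simp: X_def Y_def cos_arccos_abs)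
  have sX: "sin X = sqrt (1 - (t * ?p)\<^sup>2)" using t by (simp add: X_def sin_arccos_abs)
  have sY: "sin Y = (if ?r \<ge> 0 then 1 else - 1) * sqrt (1 - (t * ?q)\<^sup>2)" using t by (simp add: Y_def sin_arccos_abs)
  have "sin X * sin Y = (if ?r \<ge> 0 then 1 else - 1) * sqrt ((t * ?r)\<^sup>2)"
    unfolding sX sY t(4) by (simp add: real_sqrt_mult)
  also have "\<dots> = t * ?r" using t(1) by (auto simp: abs_mult)
  finally have sXY: "sin X * sin Y = t * ?r" .
  define z where "z = Complex (X / (2 * pi)) (Y / (2 * pi))"
  have "pillow z = t *\<^sub>R x"
    unfolding pillow_def z_def sc using cX sXY by (simp add: complex_eq_iff field_simps)
  moreover have "norm (t *\<^sub>R x) = t" using x t(1) by simp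
  ultimately have "pill z = x" using t(1) by (simp add: pill_def)
  then show "x \<in> range pill" by blast
qed

text \<open>Multiplication by \<open>\<i>\<close> exchanges the cosines and changes the sign of one
  sine: \<open>p + q\<close> is kept, \<open>p - q\<close> and \<open>r\<close> are negated.\<close>

lemma pill_rotate: "pill (\<i> * z) = (fst (pill z), - snd (pill z))"
proof -
  have "pillow (\<i> * z) = (fst (pillow z), - snd (pillow z))"
    by (simp add: pillow_def complex_eq_iff)
  moreover from this have "norm (pillow (\<i> * z)) = norm (pillow z)"
    by (simp add: norm_prod_def)
  ultimately show ?thesis by (simp add: pill_def)
qed

text \<open>The value at \<open>c = 0\<close> is \<open>(s, 0)\<close> since \<open>x / 0 = 0\<close>.\<close>

definition double_angle :: "real \<times> complex \<Rightarrow> real \<times> complex" where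
  "double_angle x = (fst x, (snd x)\<^sup>2 /\<^sub>R cmod (snd x))"

lemma continuous_double_angle: "continuous_on UNIV double_angle"
proof -
  have "isCont (\<lambda>c::complex. c\<^sup>2 /\<^sub>R cmod c) c" for c
  proof (cases "c = 0")
    case True
    have "((\<lambda>c::complex. c\<^sup>2 /\<^sub>R cmod c) \<longlongrightarrow> 0) (at 0)"
    proof (rule tendsto_norm_zero_cancel)
      have "((\<lambda>c. cmod c) \<longlongrightarrow> 0) (at (0::complex))" by (intro tendsto_eq_intros) auto
      then show "((\<lambda>c. cmod (c\<^sup>2 /\<^sub>R cmod c)) \<longlongrightarrow> 0) (at (0::complex))"
        by (rule Lim_transform_eventually) (auto simp: eventually_at norm_mult power2_eq_square intro!: exI[of _ 1])
    qed
    then show ?thesis using True by (simp add: isCont_def)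
  next
    case False
    then show ?thesis by (intro continuous_intros) auto
  qed
  then have c: "continuous_on UNIV (\<lambda>c::complex. c\<^sup>2 /\<^sub>R cmod c)" by (simp add: continuous_at_imp_continuous_on)
  show ?thesis
    unfolding double_angle_def[abs_def]
    by (rule continuous_on_Pair[OF continuous_on_fst[OF continuous_on_id]
        continuous_on_compose2[OF c continuous_on_snd[OF continuous_on_id]]]) simp
qed

lemma norm_double_angle_snd: "cmod ((c::complex)\<^sup>2 /\<^sub>R cmod c) = cmod c"
  by (cases "c = 0") (simp_all add: norm_mult power2_eq_square)

text \<open>Squaring the direction and keeping the modulus identifies exactly \<open>c\<close> and
  \<open>- c\<close>, so \<open>double_angle\<close> is the quotient by the half-turn of
  \<open>pill_rotate\<close>.\<close>

lemma double_angle_eq_iff: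
  "double_angle x = double_angle y \<longleftrightarrow> x = y \<or> x = (fst y, - snd y)"
proof
  assume e: "double_angle x = double_angle y"
  then have f: "fst x = fst y" and s: "(snd x)\<^sup>2 /\<^sub>R cmod (snd x) = (snd y)\<^sup>2 /\<^sub>R cmod (snd y)"
    by (auto simp: double_angle_def)
  have n: "cmod (snd x) = cmod (snd y)" using arg_cong[OF s, of cmod] by (simp only: norm_double_angle_snd)
  have "(snd x)\<^sup>2 = (snd y)\<^sup>2"
    using s n by (cases "snd y = 0") auto
  then have "snd x = snd y \<or> snd x = - snd y" by (simp add: power2_eq_iff)
  then show "x = y \<or> x = (fst y, - snd y)" using f by (auto simp: prod_eq_iff)
qed (auto simp: double_angle_def)

lemma double_angle_sph: "double_angle ` sph = sph"
proof (intro equalityI subsetI)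
  fix x assume "x \<in> double_angle ` sph"
  then obtain y where "y \<in> sph" "x = double_angle y" by blast
  then show "x \<in> sph" unfolding mem_sph by (simp only: double_angle_def norm_double_angle_snd fst_conv snd_conv)
next
  fix x assume x: "x \<in> sph"
  \<comment> \<open>The square root is rescaled to have modulus \<open>cmod (snd x)\<close>, since
    \<open>double_angle\<close> preserves that modulus.\<close>
  define y where "y = (fst x, csqrt (cmod (snd x) *\<^sub>R snd x))"
  have n: "cmod (snd y) = cmod (snd x)"
  proof -
    have "(cmod (snd y))\<^sup>2 = (cmod (snd x))\<^sup>2"
      by (simp add: y_def flip: norm_power)
    then show ?thesis by simp
  qed
  have "(snd y)\<^sup>2 = cmod (snd x) *\<^sub>R snd x" by (simp add: y_def)
  then have "double_angle y = x" unfolding double_angle_def n by (cases "snd x = 0") (auto simp: prod_eq_iff y_def)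
  moreover have "y \<in> sph" using x n unfolding mem_sph by (simp add: y_def)
  ultimately show "x \<in> double_angle ` sph" by blast
qed

text \<open>The quotient by rotations of order 4 is taken in two stages: \<open>pill\<close> divides
  by -1, and on its sphere \<open>\<i>\<close> acts as the half-turn that
  \<open>double_angle\<close> divides by.\<close>

definition theta :: "complex \<Rightarrow> real \<times> complex" where "theta z = double_angle (pill z)"

lemma theta_eq_iff:
  "theta z = theta w \<longleftrightarrow> z - w \<in> gauss_int \<or> z + w \<in> gauss_int \<or> z - \<i> * w \<in> gauss_int \<or> z + \<i> * w \<in> gauss_int"
  unfolding theta_def double_angle_eq_iff pill_rotate[symmetric] pill_eq_iff by blast

lemma continuous_theta: "continuous_on UNIV theta"
  unfolding theta_def by (rule continuous_on_compose2[OF continuous_double_angle continuous_pill]) simp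

lemma range_theta: "range theta = sph"
  unfolding theta_def using range_pill double_angle_sph by (metis image_image)

section \<open>Local form of the two quotient maps\<close>

lemma gauss_int_isolated:
  obtains \<delta> where "\<delta> > 0" "\<And>h. cmod h < \<delta> \<Longrightarrow> a + h \<in> gauss_int \<longleftrightarrow> a \<in> gauss_int \<and> h = 0"
proof (cases "a \<in> gauss_int")
  case True
  have "h = 0" if "cmod h < 1" "a + h \<in> gauss_int" for h
  proof -
    have "h \<in> gauss_int" using that(2) True by (metis add.commute gauss_int_add_iff)
    then have "Re h \<in> \<int>" "Im h \<in> \<int>" by (auto simp: gauss_int_def)
    moreover have "\<bar>Re h\<bar> < 1" "\<bar>Im h\<bar> < 1" using abs_Re_le_cmod[of h] abs_Im_le_cmod[of h] that(1) by linarith+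
    ultimately show ?thesis by (simp add: complex_eq_iff Ints_nonzero_abs_less1)
  qed
  then show ?thesis using True by (intro that[of 1]) auto
next
  case False
  have "closed (Re -` \<int> \<inter> Im -` \<int>)"
    by (intro closed_Int continuous_closed_vimage closed_Ints) (auto intro!: continuous_intros)
  moreover have "Re -` \<int> \<inter> Im -` \<int> = gauss_int" by (auto simp: gauss_int_def)
  ultimately have "open (- gauss_int)" by (metis open_Compl)
  then obtain \<delta> where d: "\<delta> > 0" "ball a \<delta> \<subseteq> - gauss_int" using False by (metis ComplI open_contains_ball)
  show ?thesis
  proof (rule that[OF d(1)])
    fix h assume "cmod h < \<delta>"
    then have "a + h \<in> ball a \<delta>" by (simp add: dist_norm)
    then show "a + h \<in> gauss_int \<longleftrightarrow> a \<in> gauss_int \<and> h = 0" using d(2) False by auto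
  qed
qed

text \<open>These are orders of stabilisers: the half-turn \<open>w \<mapsto> 2 * z - w\<close>
  about \<open>z\<close> belongs to the group if \<open>2 * z\<close> is in the lattice, the
  quarter-turn \<open>w \<mapsto> \<i> * w + (1 - \<i>) * z\<close> if \<open>(1 - \<i>) * z\<close>
  is.\<close>

definition pill_index :: "complex \<Rightarrow> nat" where "pill_index z = (if 2 * z \<in> gauss_int then 2 else 1)"
definition theta_index :: "complex \<Rightarrow> nat" where
  "theta_index z = (if (1 - \<i>) * z \<in> gauss_int then 4 else if 2 * z \<in> gauss_int then 2 else 1)"

text \<open>For small \<open>h\<close> and \<open>h'\<close> only group elements fixing
  \<open>z\<close> can relate \<open>z + h\<close> to \<open>z + h'\<close>; these are rotations
  about \<open>z\<close>, and equality of powers expresses lying in one orbit of them.\<close>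

lemma pill_local:
  obtains \<delta> where "\<delta> > 0"
    "\<And>h h'. cmod h < \<delta> \<Longrightarrow> cmod h' < \<delta> \<Longrightarrow> pill (z + h) = pill (z + h') \<longleftrightarrow> h ^ pill_index z = h' ^ pill_index z"
proof -
  obtain d0 where d0: "d0 > 0" "\<And>h. cmod h < d0 \<Longrightarrow> 0 + h \<in> gauss_int \<longleftrightarrow> 0 \<in> gauss_int \<and> h = 0"
    using gauss_int_isolated[of 0] by metis
  obtain d1 where d1: "d1 > 0" "\<And>h. cmod h < d1 \<Longrightarrow> 2 * z + h \<in> gauss_int \<longleftrightarrow> 2 * z \<in> gauss_int \<and> h = 0"
    using gauss_int_isolated[of "2 * z"] by metis
  show ?thesis
  proof (rule that[of "min d0 d1 / 2"])
    fix h h' assume h: "cmod h < min d0 d1 / 2" "cmod h' < min d0 d1 / 2"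
    have "cmod (h - h') < d0" "cmod (h + h') < d1"
      using h norm_triangle_ineq4[of h h'] norm_triangle_ineq[of h h'] by linarith+
    from d0(2)[OF this(1)] d1(2)[OF this(2)]
    have "h - h' \<in> gauss_int \<longleftrightarrow> h = h'" "2 * z + (h + h') \<in> gauss_int \<longleftrightarrow> 2 * z \<in> gauss_int \<and> h + h' = 0" by auto
    moreover have "z + h - (z + h') = h - h'" "z + h + (z + h') = 2 * z + (h + h')" by (simp_all add: algebra_simps)
    ultimately show "pill (z + h) = pill (z + h') \<longleftrightarrow> h ^ pill_index z = h' ^ pill_index z"
      unfolding pill_eq_iff by (auto simp: pill_index_def power2_eq_iff eq_neg_iff_add_eq_0)
  qed (use d0 d1 in auto)
qed

lemma power4_eq_iff: "(x::complex) ^ 4 = y ^ 4 \<longleftrightarrow> x = y \<or> x = - y \<or> x = \<i> * y \<or> x = - \<i> * y"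
proof -
  have "x ^ 4 - y ^ 4 = (x - y) * (x + y) * ((x - \<i> * y) * (x + \<i> * y))"
    by (simp add: algebra_simps power4_eq_xxxx)
  then have "x ^ 4 = y ^ 4 \<longleftrightarrow> (x - y) * (x + y) * ((x - \<i> * y) * (x + \<i> * y)) = 0" by (metis eq_iff_diff_eq_0)
  then show ?thesis by (auto simp: eq_neg_iff_add_eq_0)
qed

lemma gauss_int_1i_iff: "(1 + \<i>) * z \<in> gauss_int \<longleftrightarrow> (1 - \<i>) * z \<in> gauss_int"
proof -
  have "(1 + \<i>) * z = \<i> * ((1 - \<i>) * z)" by (simp add: algebra_simps)
  then show ?thesis by (simp only: gauss_int_i_iff)
qed

lemma gauss_int_1i_imp_2: "(1 - \<i>) * z \<in> gauss_int \<Longrightarrow> 2 * z \<in> gauss_int"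
proof -
  assume "(1 - \<i>) * z \<in> gauss_int"
  moreover have "1 + \<i> \<in> gauss_int" by (intro gauss_int_closed(1)) auto
  ultimately have "(1 + \<i>) * ((1 - \<i>) * z) \<in> gauss_int" using gauss_int_closed(4) by blast
  moreover have "(1 + \<i>) * ((1 - \<i>) * z) = 2 * z" by (simp add: algebra_simps)
  ultimately show ?thesis by (simp only:)
qed

lemma theta_local:
  obtains \<delta> where "\<delta> > 0"
    "\<And>h h'. cmod h < \<delta> \<Longrightarrow> cmod h' < \<delta> \<Longrightarrow> theta (z + h) = theta (z + h') \<longleftrightarrow> h ^ theta_index z = h' ^ theta_index z"
proof -
  \<comment> \<open>One radius for each rotation part 1, -1, \<open>\<i>\<close>,
    \<open>- \<i>\<close> that may relate \<open>z + h\<close> to \<open>z + h'\<close>.\<close>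
  obtain d0 where d0: "d0 > 0" "\<And>h. cmod h < d0 \<Longrightarrow> 0 + h \<in> gauss_int \<longleftrightarrow> 0 \<in> gauss_int \<and> h = 0"
    using gauss_int_isolated[of 0] by metis
  obtain d1 where d1: "d1 > 0" "\<And>h. cmod h < d1 \<Longrightarrow> 2 * z + h \<in> gauss_int \<longleftrightarrow> 2 * z \<in> gauss_int \<and> h = 0"
    using gauss_int_isolated[of "2 * z"] by metis
  obtain d2 where d2: "d2 > 0" "\<And>h. cmod h < d2 \<Longrightarrow> (1 - \<i>) * z + h \<in> gauss_int \<longleftrightarrow> (1 - \<i>) * z \<in> gauss_int \<and> h = 0"
    using gauss_int_isolated[of "(1 - \<i>) * z"] by metis
  obtain d3 where d3: "d3 > 0" "\<And>h. cmod h < d3 \<Longrightarrow> (1 + \<i>) * z + h \<in> gauss_int \<longleftrightarrow> (1 + \<i>) * z \<in> gauss_int \<and> h = 0"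
    using gauss_int_isolated[of "(1 + \<i>) * z"] by metis
  show ?thesis
  proof (rule that[of "min (min d0 d1) (min d2 d3) / 2"])
    fix h h' assume h: "cmod h < min (min d0 d1) (min d2 d3) / 2" "cmod h' < min (min d0 d1) (min d2 d3) / 2"
    have n: "cmod (\<i> * h') = cmod h'" by (simp add: norm_mult)
    have "cmod (h - h') < d0" "cmod (h + h') < d1" "cmod (h - \<i> * h') < d2" "cmod (h + \<i> * h') < d3"
      using h norm_triangle_ineq4[of h h'] norm_triangle_ineq[of h h']
        norm_triangle_ineq4[of h "\<i> * h'"] norm_triangle_ineq[of h "\<i> * h'"] n by linarith+
    from d0(2)[OF this(1)] d1(2)[OF this(2)] d2(2)[OF this(3)] d3(2)[OF this(4)]
    have mem: "h - h' \<in> gauss_int \<longleftrightarrow> h = h'" "2 * z + (h + h') \<in> gauss_int \<longleftrightarrow> 2 * z \<in> gauss_int \<and> h + h' = 0"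
      "(1 - \<i>) * z + (h - \<i> * h') \<in> gauss_int \<longleftrightarrow> (1 - \<i>) * z \<in> gauss_int \<and> h - \<i> * h' = 0"
      "(1 + \<i>) * z + (h + \<i> * h') \<in> gauss_int \<longleftrightarrow> (1 - \<i>) * z \<in> gauss_int \<and> h + \<i> * h' = 0"
      by (auto simp: gauss_int_1i_iff)
    have rw: "z + h - (z + h') = h - h'" "z + h + (z + h') = 2 * z + (h + h')"
      "z + h - \<i> * (z + h') = (1 - \<i>) * z + (h - \<i> * h')" "z + h + \<i> * (z + h') = (1 + \<i>) * z + (h + \<i> * h')"
      by (simp_all add: algebra_simps)
    have e: "theta (z + h) = theta (z + h') \<longleftrightarrow> h = h' \<or> 2 * z \<in> gauss_int \<and> h + h' = 0 \<or>
        (1 - \<i>) * z \<in> gauss_int \<and> h - \<i> * h' = 0 \<or> (1 - \<i>) * z \<in> gauss_int \<and> h + \<i> * h' = 0"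
      unfolding theta_eq_iff rw mem ..
    show "theta (z + h) = theta (z + h') \<longleftrightarrow> h ^ theta_index z = h' ^ theta_index z"
      unfolding e using gauss_int_1i_imp_2[of z]
      by (auto simp: theta_index_def power2_eq_iff power4_eq_iff eq_neg_iff_add_eq_0)
  qed (use d0 d1 d2 d3 in auto)
qed

section \<open>Charts from quotients by power maps\<close>

lemma exists_complex_root:
  assumes "1 \<le> (e::nat)"
  shows "\<exists>z::complex. z ^ e = w"
proof (cases "w = 0")
  case True
  then show ?thesis using assms by (intro exI[of _ 0]) (simp add: power_0_left)
next
  case False
  then have "(exp (Ln w / of_nat e)) ^ e = w" using assms by (simp add: exp_of_nat_mult[symmetric])
  then show ?thesis by blast
qed

text \<open>\<open>z ^ e\<close> is an open surjection of the plane, hence a quotient map, and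
  \<open>G\<close> is induced by \<open>G0\<close>.\<close>

lemma continuous_map_of_powers:
  fixes G0 :: "complex \<Rightarrow> 'b"
  assumes "continuous_map euclidean Y G0" "1 \<le> (e::nat)" and G: "\<And>z. G (z ^ e) = G0 z"
  shows "continuous_map euclidean Y G"
proof -
  note root = exists_complex_root[OF assms(2)]
  have openm: "open ((\<lambda>z::complex. z ^ e) ` S)" if "open S" for S
  proof (rule open_mapping_thm[of "\<lambda>z. z ^ e" UNIV])
    show "(\<lambda>z::complex. z ^ e) holomorphic_on UNIV" by (intro holomorphic_intros)
    show "\<not> (\<lambda>z::complex. z ^ e) constant_on UNIV"
    proof
      assume "(\<lambda>z::complex. z ^ e) constant_on UNIV"
      then have "(0::complex) ^ e = 1 ^ e" unfolding constant_on_def by (metis UNIV_I)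
      then show False using assms(2) by (simp add: power_0_left)
    qed
  qed (use that in auto)
  show ?thesis
    unfolding continuous_map_def
  proof (intro conjI allI impI)
    have "G w \<in> topspace Y" for w
    proof -
      obtain z where "z ^ e = w" using root by blast
      then show ?thesis using G[of z] assms(1) continuous_map_image_subset_topspace by fastforce
    qed
    then show "G \<in> topspace euclidean \<rightarrow> topspace Y" by auto
    fix V assume V: "openin Y V"
    have "{w \<in> topspace euclidean. G w \<in> V} = (\<lambda>z. z ^ e) ` {z \<in> topspace euclidean. G0 z \<in> V}"
    proof (intro equalityI subsetI)
      fix w assume "w \<in> {w \<in> topspace euclidean. G w \<in> V}"
      moreover obtain z where "z ^ e = w" using root by blast
      ultimately show "w \<in> (\<lambda>z. z ^ e) ` {z \<in> topspace euclidean. G0 z \<in> V}" using G[of z] by auto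
    qed (use G in auto)
    moreover have "openin euclidean {z \<in> topspace euclidean. G0 z \<in> V}"
      by (rule openin_continuous_map_preimage[OF assms(1) V])
    ultimately show "openin euclidean {w \<in> topspace euclidean. G w \<in> V}" using openm by simp
  qed
qed

text \<open>Openness is local, so one point of the sphere is removed and invariance of domain
  applied in the resulting plane.\<close>

lemma S2_invariance_of_domain:
  fixes G :: "complex \<Rightarrow> 'b"
  assumes Y: "Y homeomorphic_space S2" and G: "continuous_map euclidean Y G" "inj G" and S: "open S"
  shows "openin Y (G ` S)"
proof (subst openin_subopen, clarify)
  fix w assume w: "w \<in> S"
  have GY: "G z \<in> topspace Y" for z using G(1) continuous_map_image_subset_topspace by fastforce
  \<comment> \<open>\<open>G (w + 1)\<close> merely serves as a point other than \<open>G w\<close>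
    that can be removed.\<close>
  have "G (w + 1) \<noteq> G w" using G(2) by (simp add: inj_eq)
  let ?b = "G (w + 1)" let ?U = "topspace Y - {?b}"
  obtain c where c: "homeomorphic_map (subtopology Y ?U) (euclidean :: complex topology) c"
    using S2_punctured[OF Y GY] .
  have oU: "openin Y ?U" by (rule S2_openin_delete[OF Y])
  have tU: "topspace (subtopology Y ?U) = ?U" by auto
  have cc: "continuous_map (subtopology Y ?U) euclidean c" by (rule homeomorphic_imp_continuous_map[OF c])
  have injc: "inj_on c ?U" using c tU by (metis homeomorphic_map_def)
  define S' where "S' = S \<inter> {z. G z \<in> ?U}"
  have "openin euclidean {z \<in> topspace euclidean. G z \<in> ?U}" by (rule openin_continuous_map_preimage[OF G(1) oU])
  then have oS': "open S'" unfolding S'_def using S by (simp add: open_Int)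
  have "continuous_map (top_of_set S') (subtopology Y ?U) G"
    by (rule continuous_map_into_subtopology[OF continuous_map_from_subtopology[OF G(1)]]) (auto simp: S'_def)
  from continuous_map_compose[OF this cc] have "continuous_on S' (c \<circ> G)" by simp
  moreover have "inj_on (c \<circ> G) S'"
    using injc G(2) by (auto simp: S'_def inj_on_def)
  ultimately have "open ((c \<circ> G) ` S')" using oS' invariance_of_domain by blast
  then have "openin (subtopology Y ?U) {y \<in> topspace (subtopology Y ?U). c y \<in> (c \<circ> G) ` S'}"
    by (intro openin_continuous_map_preimage[OF cc]) simp
  moreover have "{y \<in> topspace (subtopology Y ?U). c y \<in> (c \<circ> G) ` S'} = G ` S'"
    unfolding tU using inj_onD[OF injc] GY by (auto simp: S'_def)
  ultimately have "openin Y (G ` S')" using oU by (simp add: openin_open_subtopology)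
  moreover have "G w \<in> G ` S'" using w \<open>G (w + 1) \<noteq> G w\<close> GY by (auto simp: S'_def)
  moreover have "G ` S' \<subseteq> G ` S" by (auto simp: S'_def)
  ultimately show "\<exists>T. openin Y T \<and> G w \<in> T \<and> T \<subseteq> G ` S" by blast
qed

text \<open>\<open>G0\<close> factors through \<open>z ^ e\<close> as an injective map
  \<open>G\<close> of the plane, open by invariance of domain; the inverse of \<open>G\<close> is
  the chart.\<close>

lemma power_quotient_chart:
  fixes G0 :: "complex \<Rightarrow> 'b"
  assumes Y: "Y homeomorphic_space S2" and G0: "continuous_map euclidean Y G0" and e: "1 \<le> (e::nat)"
    and eq: "\<And>z w. G0 z = G0 w \<longleftrightarrow> z ^ e = w ^ e"
  obtains \<psi> where "openin Y (range G0)"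
    "homeomorphic_map (subtopology Y (range G0)) (euclidean :: complex topology) \<psi>" "\<And>z. \<psi> (G0 z) = z ^ e"
proof -
  note root = exists_complex_root[OF e]
  define G where "G w = G0 (SOME z. z ^ e = w)" for w
  have G: "G (z ^ e) = G0 z" for z
  proof -
    have "(SOME x. x ^ e = z ^ e) ^ e = z ^ e" by (rule someI) simp
    then show ?thesis unfolding G_def eq .
  qed
  have Gc: "continuous_map euclidean Y G" by (rule continuous_map_of_powers[OF G0 e G])
  have inj: "inj G"
  proof (rule injI)
    fix w w' assume "G w = G w'"
    moreover obtain z z' where "z ^ e = w" "z' ^ e = w'" using root by metis
    ultimately show "w = w'" using G[of z] G[of z'] eq by metis
  qed
  have rng: "range G = range G0"
  proof -
    have "G w \<in> range G0" for w by (simp add: G_def)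
    moreover have "G0 z \<in> range G" for z unfolding G[symmetric] by simp
    ultimately show ?thesis by blast
  qed
  have op: "openin Y (G ` S)" if "open S" for S by (rule S2_invariance_of_domain[OF Y Gc inj that])
  have oR: "openin Y (range G0)" using op[of UNIV] rng by simp
  have tR: "topspace (subtopology Y (range G0)) = range G0" using openin_subset[OF oR] by auto
  have "homeomorphic_map euclidean (subtopology Y (range G0)) G"
  proof (rule bijective_open_imp_homeomorphic_map)
    show "continuous_map euclidean (subtopology Y (range G0)) G"
      by (rule continuous_map_into_subtopology[OF Gc]) (use rng in auto)
    show "open_map euclidean (subtopology Y (range G0)) G"
      unfolding open_map_def using op oR rng by (auto simp: openin_open_subtopology)
    show "G ` topspace euclidean = topspace (subtopology Y (range G0))" using rng tR by simp
    show "inj_on G (topspace euclidean)" using inj by simp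
  qed
  then obtain \<psi> where h: "homeomorphic_maps euclidean (subtopology Y (range G0)) G \<psi>"
    using homeomorphic_map_maps by blast
  then have "homeomorphic_maps (subtopology Y (range G0)) euclidean \<psi> G" by (rule homeomorphic_maps_sym[THEN iffD1])
  then have "homeomorphic_map (subtopology Y (range G0)) euclidean \<psi>" using homeomorphic_maps_map by blast
  moreover have "\<psi> (G0 z) = z ^ e" for z
    using h G[of z] unfolding homeomorphic_maps_def by (metis UNIV_I topspace_euclidean)
  ultimately show ?thesis using that oR by blast
qed

text \<open>The radial homeomorphism of the plane onto the disc of radius \<open>d\<close>. Charts
  in \<open>locally_power_map\<close> fill the whole plane, whereas \<open>pill_local\<close> and
  \<open>theta_local\<close> only speak about small discs.\<close>

definition squeeze :: "real \<Rightarrow> complex \<Rightarrow> complex" where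
  "squeeze d z = z /\<^sub>R ((1 + cmod z) / d)"

lemma norm_squeeze: "d > 0 \<Longrightarrow> cmod (squeeze d z) = d * cmod z / (1 + cmod z)"
  by (simp add: squeeze_def divide_inverse)

lemma squeeze_less: "d > 0 \<Longrightarrow> cmod (squeeze d z) < d"
  unfolding norm_squeeze by (simp add: divide_less_eq add_pos_nonneg algebra_simps)

text \<open>The scaling depends on the modulus alone, so it commutes with multiplication by roots of
  unity.\<close>

lemma squeeze_power_eq:
  assumes d: "d > 0" and e: "1 \<le> (e::nat)"
  shows "squeeze d z ^ e = squeeze d w ^ e \<longleftrightarrow> z ^ e = w ^ e"
proof -
  have sq: "squeeze d z ^ e = z ^ e /\<^sub>R (((1 + cmod z) / d) ^ e)" for z
    unfolding squeeze_def scaleR_power power_inverse ..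
  show ?thesis
  proof
    assume l: "squeeze d z ^ e = squeeze d w ^ e"
    have "cmod (squeeze d z) ^ e = cmod (squeeze d w) ^ e" using arg_cong[OF l, of cmod] by (simp add: norm_power)
    then have "cmod (squeeze d z) = cmod (squeeze d w)"
      using e by (metis norm_ge_zero power_eq_imp_eq_base less_le_trans zero_less_one)
    then have "d * cmod z * (1 + cmod w) = d * cmod w * (1 + cmod z)"
      unfolding norm_squeeze[OF d] by (simp add: frac_eq_eq add_nonneg_eq_0_iff)
    then have n: "cmod z = cmod w" using d by (simp add: algebra_simps)
    have "1 + cmod w \<noteq> 0" using norm_ge_zero[of w] by linarith
    then have "((1 + cmod w) / d) ^ e \<noteq> 0" using d by simp
    then show "z ^ e = w ^ e" using l unfolding sq n
      by (metis scaleR_cancel_left inverse_nonzero_iff_nonzero)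
  next
    assume r: "z ^ e = w ^ e"
    have "cmod z ^ e = cmod w ^ e" using arg_cong[OF r, of cmod] by (simp add: norm_power)
    then have "cmod z = cmod w" using e by (metis norm_ge_zero power_eq_imp_eq_base less_le_trans zero_less_one)
    then show "squeeze d z ^ e = squeeze d w ^ e" unfolding sq r by simp
  qed
qed

lemma continuous_squeeze: "d > 0 \<Longrightarrow> continuous_on UNIV (squeeze d)"
  unfolding squeeze_def[abs_def] by (intro continuous_intros) (auto simp: add_nonneg_eq_0_iff)

section \<open>Covers induced by lattice inclusions\<close>

text \<open>\<open>F\<close> below is defined by choosing representatives; its continuity is
  recovered from its local form.\<close>

lemma locally_power_map_continuous:
  assumes "\<And>x. x \<in> topspace X \<Longrightarrow> \<exists>k. locally_power_map X Y F x k"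
  shows "continuous_map X Y F"
  unfolding continuous_map_def
proof (intro conjI allI impI)
  have loc: "\<exists>U. openin X U \<and> x \<in> U \<and> continuous_map (subtopology X U) Y F" if x: "x \<in> topspace X" for x
  proof -
    obtain k where "locally_power_map X Y F x k" using assms[OF x] ..
    then obtain U V \<phi> \<psi> where U: "openin X U" "x \<in> U" "openin Y V" "F ` U \<subseteq> V"
      and \<phi>: "homeomorphic_map (subtopology X U) (euclidean :: complex topology) \<phi>"
      and \<psi>: "homeomorphic_map (subtopology Y V) (euclidean :: complex topology) \<psi>"
      and p: "\<forall>u\<in>U. \<psi> (F u) = \<phi> u ^ k"
      unfolding locally_power_map_def by blast
    obtain \<psi>' where c: "continuous_map euclidean (subtopology Y V) \<psi>'" and inv: "\<And>u. u \<in> V \<Longrightarrow> \<psi>' (\<psi> u) = u"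
      using chart_inverse[OF \<psi> U(3)] by metis
    have "continuous_map euclidean euclidean (\<lambda>w::complex. w ^ k)" by (auto intro!: continuous_intros)
    from continuous_map_compose[OF continuous_map_compose[OF homeomorphic_imp_continuous_map[OF \<phi>] this] c]
    have "continuous_map (subtopology X U) (subtopology Y V) (\<psi>' \<circ> ((\<lambda>w. w ^ k) \<circ> \<phi>))" .
    then have "continuous_map (subtopology X U) Y (\<psi>' \<circ> ((\<lambda>w. w ^ k) \<circ> \<phi>))"
      using continuous_map_into_fulltopology by blast
    moreover have "(\<psi>' \<circ> ((\<lambda>w. w ^ k) \<circ> \<phi>)) u = F u" if "u \<in> topspace (subtopology X U)" for u
    proof -
      have "u \<in> U" using that by simp
      then have "F u \<in> V" "\<phi> u ^ k = \<psi> (F u)" using U(4) p by auto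
      then show ?thesis using inv by simp
    qed
    ultimately have "continuous_map (subtopology X U) Y F" by (rule continuous_map_eq)
    then show ?thesis using U by blast
  qed
  show "F \<in> topspace X \<rightarrow> topspace Y"
  proof
    fix x assume x: "x \<in> topspace X"
    obtain U where "openin X U" "x \<in> U" "continuous_map (subtopology X U) Y F" using loc[OF x] by blast
    then show "F x \<in> topspace Y" using x by (auto simp: continuous_map_def)
  qed
  fix V assume V: "openin Y V"
  show "openin X {x \<in> topspace X. F x \<in> V}"
  proof (subst openin_subopen, clarify)
    fix x assume x: "x \<in> topspace X" "F x \<in> V"
    obtain U where U: "openin X U" "x \<in> U" "continuous_map (subtopology X U) Y F" using loc[OF x(1)] by blast
    have "openin (subtopology X U) {u \<in> topspace (subtopology X U). F u \<in> V}"
      by (rule openin_continuous_map_preimage[OF U(3) V])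
    then have "openin X {u \<in> topspace (subtopology X U). F u \<in> V}" using U(1) by (simp add: openin_open_subtopology)
    then show "\<exists>S. openin X S \<and> x \<in> S \<and> S \<subseteq> {x \<in> topspace X. F x \<in> V}"
      using x U(2) by (intro exI[of _ "{u \<in> topspace (subtopology X U). F u \<in> V}"]) auto
  qed
qed

text \<open>The order of a stabiliser is constant on orbits; translations, -1 and
  \<open>\<i>\<close> suffice to check this.\<close>

lemma theta_index_cong:
  assumes "theta z = theta w"
  shows "theta_index z = theta_index w"
proof -
  have aux: "theta_index z = theta_index w" if "z - w \<in> gauss_int" for z w
  proof -
    have eq: "(1 - \<i>) * z = (1 - \<i>) * w + (1 - \<i>) * (z - w)" "2 * z = 2 * w + 2 * (z - w)" by (simp_all add: algebra_simps)
    have "1 - \<i> \<in> gauss_int" "2 \<in> gauss_int" by (auto simp: gauss_int_def)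
    then have "(1 - \<i>) * (z - w) \<in> gauss_int" "2 * (z - w) \<in> gauss_int" using that gauss_int_closed(4) by blast+
    then have "(1 - \<i>) * z \<in> gauss_int \<longleftrightarrow> (1 - \<i>) * w \<in> gauss_int" "2 * z \<in> gauss_int \<longleftrightarrow> 2 * w \<in> gauss_int"
      unfolding eq by (auto simp only: gauss_int_add_iff)
    then show ?thesis unfolding theta_index_def by simp
  qed
  have m: "theta_index (- w) = theta_index w" for w
  proof -
    have "(1 - \<i>) * - w = - ((1 - \<i>) * w)" "2 * - w = - (2 * w)" by simp_all
    then show ?thesis unfolding theta_index_def by (simp only: gauss_int_minus_iff)
  qed
  have i: "theta_index (\<i> * w) = theta_index w" for w
  proof -
    have "(1 - \<i>) * (\<i> * w) = \<i> * ((1 - \<i>) * w)" "2 * (\<i> * w) = \<i> * (2 * w)" by simp_all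
    then show ?thesis unfolding theta_index_def by (simp only: gauss_int_i_iff)
  qed
  have "z - w \<in> gauss_int \<or> z - (- w) \<in> gauss_int \<or> z - \<i> * w \<in> gauss_int \<or> z - (- (\<i> * w)) \<in> gauss_int"
    using assms unfolding theta_eq_iff by simp
  then show ?thesis using aux m i by metis
qed

lemma nat_eq_of_dvd_diff:
  assumes "int b dvd int k - int k'" "k < b" "k' < b"
  shows "k = k'"
  using assms by (metis mod_eq_dvd_iff mod_pos_pos_trivial of_nat_0_le_iff of_nat_less_iff of_nat_eq_iff)

text \<open>Indexing by integers turns questions about points with nontrivial stabiliser into parity
  questions, since modulo the lattice only \<open>m\<close> and \<open>n\<close> modulo 2
  matter.\<close>

definition half :: "int \<Rightarrow> int \<Rightarrow> complex" where "half m n = Complex (of_int m / 2) (of_int n / 2)"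

lemma half_int_iff: "of_int m / 2 \<in> (\<int> :: real set) \<longleftrightarrow> even m"
proof
  assume "of_int m / 2 \<in> (\<int> :: real set)"
  then obtain k where "real_of_int m / 2 = of_int k" by (auto simp: Ints_def)
  then have "real_of_int m = of_int (2 * k)" by simp
  then have "m = 2 * k" by (simp only: of_int_eq_iff)
  then show "even m" by simp
qed auto

lemma half_gauss_int_iff: "half m n \<in> gauss_int \<longleftrightarrow> even m \<and> even n"
  by (simp add: half_def gauss_int_def half_int_iff)

text \<open>Modulo the lattice signs disappear, and rotation by \<open>\<i>\<close> swaps the
  coordinates. Three classes remain, those of (0,0), (1,1) and (1,0): the cone points of
  S(2,4,4).\<close>

lemma theta_half_eq_iff:
  "theta (half m n) = theta (half m' n') \<longleftrightarrow>
     even (m - m') \<and> even (n - n') \<or> even (m - n') \<and> even (n - m')"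
proof -
  have "half m n - half m' n' = half (m - m') (n - n')" "half m n + half m' n' = half (m + m') (n + n')"
    "half m n - \<i> * half m' n' = half (m + n') (n - m')" "half m n + \<i> * half m' n' = half (m - n') (n + m')"
    by (auto simp: half_def complex_eq_iff diff_divide_distrib add_divide_distrib)
  then show ?thesis unfolding theta_eq_iff by (auto simp: half_gauss_int_iff)
qed

lemma two_mult_gauss_int: "2 * z \<in> gauss_int \<longleftrightarrow> (\<exists>m n. z = half m n)"
proof
  assume "2 * z \<in> gauss_int"
  then obtain m n :: int where "2 * Re z = of_int m" "2 * Im z = of_int n"
    by (auto simp: gauss_int_def elim!: Ints_cases)
  then have "z = half m n" by (auto simp: half_def complex_eq_iff)
  then show "\<exists>m n. z = half m n" by blast
next
  assume "\<exists>m n. z = half m n"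
  then show "2 * z \<in> gauss_int" by (auto simp: half_def gauss_int_def)
qed

text \<open>Multiplication by \<open>1 - \<i>\<close> turns \<open>half m n\<close> into
  \<open>half (m + n) (n - m)\<close>. So the classes of (0,0) and (1,1) have order 4 and that of
  (1,0) has order 2.\<close>

lemma theta_index_half: "theta_index (half m n) = (if even (m + n) then 4 else 2)"
proof -
  have "(1 - \<i>) * half m n = half (m + n) (n - m)"
    by (auto simp: half_def complex_eq_iff diff_divide_distrib add_divide_distrib)
  then have "(1 - \<i>) * half m n \<in> gauss_int \<longleftrightarrow> even (m + n)" by (auto simp: half_gauss_int_iff)
  then show ?thesis unfolding theta_index_def using two_mult_gauss_int[of "half m n"] by auto
qed

lemma theta_index_1_iff: "theta_index z = 1 \<longleftrightarrow> 2 * z \<notin> gauss_int"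
  using gauss_int_1i_imp_2[of z] by (auto simp: theta_index_def)

lemma image_mset_two_values:
  assumes "finite S" "\<And>x. x \<in> S \<Longrightarrow> x \<notin> K \<Longrightarrow> f x = \<alpha>" "\<And>x. x \<in> S \<Longrightarrow> x \<in> K \<Longrightarrow> f x = \<beta>"
  shows "image_mset f (mset_set S) = replicate_mset (card (S - K)) \<alpha> + replicate_mset (card (S \<inter> K)) \<beta>"
proof -
  have "mset_set S = mset_set ((S - K) \<union> (S \<inter> K))" by (simp add: Un_Diff_Int)
  also have "\<dots> = mset_set (S - K) + mset_set (S \<inter> K)"
    by (rule mset_set_Union) (use assms(1) in auto)
  finally have "image_mset f (mset_set S) = image_mset f (mset_set (S - K)) + image_mset f (mset_set (S \<inter> K))" by simp
  also have "image_mset f (mset_set (S - K)) = image_mset (\<lambda>_. \<alpha>) (mset_set (S - K))"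
    by (rule image_mset_cong) (use assms in auto)
  also have "image_mset f (mset_set (S \<inter> K)) = image_mset (\<lambda>_. \<beta>) (mset_set (S \<inter> K))"
    by (rule image_mset_cong) (use assms in auto)
  finally show ?thesis by (simp add: image_mset_const_eq)
qed

text \<open>\<open>P\<close> and \<open>T\<close> present \<open>X\<close> and \<open>Y\<close> as the orbifolds \<open>S(2,2,2,2)\<close> and \<open>S(2,4,4)\<close>, quotients of the plane. The
  real-affine map \<open>z \<mapsto> A z + c\<close> with integral matrix \<open>((a, s), (0, b))\<close> and half-integral \<open>c\<close> descends to a
  branched cover of degree \<open>2 a b\<close>.\<close>

locale lattice_cover =
  fixes X :: "'a topology" and Y :: "'b topology" and P :: "complex \<Rightarrow> 'a" and T :: "complex \<Rightarrow> 'b"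
    and a b :: nat and s g h :: int
  assumes X: "X homeomorphic_space S2" and Y: "Y homeomorphic_space S2"
    and P: "continuous_map euclidean X P" "range P = topspace X" "\<And>z w. P z = P w \<longleftrightarrow> pill z = pill w"
    and T: "continuous_map euclidean Y T" "range T = topspace Y" "\<And>z w. T z = T w \<longleftrightarrow> theta z = theta w"
    and ab: "a > 0" "b > 0"
begin

definition A :: "complex \<Rightarrow> complex" where
  "A z = Complex (of_nat a * Re z + of_int s * Im z) (of_nat b * Im z)"

definition B :: "complex \<Rightarrow> complex" where
  "B w = Complex ((Re w - of_int s * (Im w / of_nat b)) / of_nat a) (Im w / of_nat b)"

abbreviation c :: complex where "c \<equiv> half g h"

definition F :: "'a \<Rightarrow> 'b" where "F x = T (A (SOME z. P z = x) + c)"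

lemma AB [simp]: "A (B w) = w" "B (A z) = z"
  using ab by (auto simp: A_def B_def complex_eq_iff)

lemma A_linear: "A (z + w) = A z + A w" "A (z - w) = A z - A w" "A (- z) = - A z" "A (2 * z) = 2 * A z"
  by (auto simp: A_def complex_eq_iff algebra_simps)

lemma B_simps: "B (- w) = - B w" "B 0 = 0"
proof -
  have "A (- B w) = - w" by (simp add: A_linear(3))
  then show "B (- w) = - B w" using AB(2)[of "- B w"] by simp
  show "B 0 = 0" by (simp add: B_def complex_eq_iff)
qed

lemma B_linear: "B (z + w) = B z + B w"
proof -
  have "A (B z + B w) = z + w" by (simp add: A_linear(1))
  then show ?thesis using AB(2)[of "B z + B w"] by simp
qed

lemma B_eq_iff: "B z = B w \<longleftrightarrow> z = w"
  by (metis AB(1))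

lemma A_gauss_int: "z \<in> gauss_int \<Longrightarrow> A z \<in> gauss_int"
  by (auto simp: A_def gauss_int_def)

lemma continuous_B: "continuous_on UNIV B"
  unfolding B_def[abs_def] Complex_eq by (intro continuous_intros) (use ab in auto)

lemma two_c: "2 * c \<in> gauss_int"
  using two_mult_gauss_int by blast

text \<open>The representative chosen in \<open>F\<close> does not matter: \<open>A\<close> is
  additive and preserves the lattice, and replacing \<open>z\<close> by \<open>- z\<close> negates
  \<open>A z + c\<close> up to \<open>2 * c\<close>, a lattice vector. This is why the translation
  is half-integral.\<close>

lemma F_P: "F (P z) = T (A z + c)"
proof -
  let ?w = "SOME w. P w = P z"
  have "P ?w = P z" by (rule someI) (rule refl)
  then have "?w - z \<in> gauss_int \<or> ?w + z \<in> gauss_int" unfolding P(3) pill_eq_iff .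
  then have "A ?w - A z \<in> gauss_int \<or> A ?w + A z \<in> gauss_int" using A_gauss_int A_linear by metis
  then have "(A ?w + c) - (A z + c) \<in> gauss_int \<or> (A ?w + c) + (A z + c) \<in> gauss_int"
  proof
    assume "A ?w + A z \<in> gauss_int"
    then have "A ?w + A z + 2 * c \<in> gauss_int" by (rule gauss_int_closed(1)[OF _ two_c])
    then show ?thesis by (simp add: algebra_simps)
  qed simp
  then have "theta (A ?w + c) = theta (A z + c)" unfolding theta_eq_iff by blast
  then show ?thesis unfolding F_def T(3) .
qed

text \<open>A half-turn about \<open>z\<close> is carried to a half-turn about
  \<open>A z + c\<close>, so the stabiliser of \<open>z\<close> embeds in that of its image.\<close>

lemma pill_index_dvd: "pill_index z dvd theta_index (A z + c)"
proof (cases "2 * z \<in> gauss_int")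
  case True
  have "A (2 * z) + 2 * c \<in> gauss_int" 
    by (rule gauss_int_closed(1)[OF A_gauss_int[OF True] two_c])
  moreover have "2 * (A z + c) = A (2 * z) + 2 * c" by (simp only: A_linear(4) distrib_left)
  ultimately have "2 * (A z + c) \<in> gauss_int" by simp
  then show ?thesis unfolding theta_index_def pill_index_def by auto
qed (simp add: pill_index_def)

lemma index_ge_1: "1 \<le> pill_index z" "1 \<le> theta_index z"
  by (simp_all add: pill_index_def theta_index_def)

text \<open>With one parameter \<open>\<zeta>\<close> for both sides, the source chart reads
  \<open>\<zeta> ^ pill_index z\<close> and the target chart
  \<open>\<zeta> ^ theta_index (A z + c)\<close>; \<open>F\<close> is then the power by the quotient
  of the exponents.\<close>

lemma F_local: "locally_power_map X Y F (P z) (theta_index (A z + c) div pill_index z)"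
proof -
  obtain d1 where d1: "d1 > 0" "\<And>h h'. cmod h < d1 \<Longrightarrow> cmod h' < d1 \<Longrightarrow> pill (z + h) = pill (z + h') \<longleftrightarrow> h ^ pill_index z = h' ^ pill_index z"
    using pill_local[of z] by metis
  obtain d2 where d2: "d2 > 0" "\<And>h h'. cmod h < d2 \<Longrightarrow> cmod h' < d2 \<Longrightarrow>
     theta (A z + c + h) = theta (A z + c + h') \<longleftrightarrow> h ^ theta_index (A z + c) = h' ^ theta_index (A z + c)"
    using theta_local[of "A z + c"] by metis
  have "isCont B 0" using continuous_B by (simp add: continuous_on_eq_continuous_at)
  then have "\<exists>d3>0. \<forall>w. dist w 0 < d3 \<longrightarrow> dist (B w) (B 0) < d1" using d1(1) unfolding continuous_at_eps_delta by blast
  then obtain d3 where d3: "d3 > 0" "\<And>w. cmod w < d3 \<Longrightarrow> cmod (B w) < d1" by (auto simp: B_simps)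
  define d where "d = min d2 d3"
  have d: "d > 0" using d2 d3 by (simp add: d_def)
  have sm: "cmod (B (squeeze d \<zeta>)) < d1" "cmod (squeeze d \<zeta>) < d2" for \<zeta>
    using squeeze_less[OF d, of \<zeta>] d3(2)[of "squeeze d \<zeta>"] by (auto simp: d_def)
  \<comment> \<open>\<open>A\<close> need not be conformal, so its inverse \<open>B\<close> is built
    into the source chart; then \<open>F (GX \<zeta>) = GY \<zeta>\<close> exactly.\<close>
  define GX where "GX \<zeta> = P (z + B (squeeze d \<zeta>))" for \<zeta>
  define GY where "GY \<zeta> = T (A z + c + squeeze d \<zeta>)" for \<zeta>
  have cs: "continuous_on UNIV (\<lambda>\<zeta>. B (squeeze d \<zeta>))"
    by (rule continuous_on_compose2[OF continuous_B continuous_squeeze[OF d]]) simp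
  have "continuous_map euclidean euclidean (\<lambda>\<zeta>. z + B (squeeze d \<zeta>))"
    using cs by (auto intro!: continuous_intros)
  from continuous_map_compose[OF this P(1)] have cX: "continuous_map euclidean X GX" by (simp add: GX_def[abs_def] o_def)
  have "continuous_map euclidean euclidean (\<lambda>\<zeta>. A z + c + squeeze d \<zeta>)"
    using continuous_squeeze[OF d] by (auto intro!: continuous_intros)
  from continuous_map_compose[OF this T(1)] have cY: "continuous_map euclidean Y GY" by (simp add: GY_def[abs_def] o_def)
  have eX: "GX \<zeta> = GX \<zeta>' \<longleftrightarrow> \<zeta> ^ pill_index z = \<zeta>' ^ pill_index z" for \<zeta> \<zeta>'
  proof -
    have "GX \<zeta> = GX \<zeta>' \<longleftrightarrow> B (squeeze d \<zeta>) ^ pill_index z = B (squeeze d \<zeta>') ^ pill_index z"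
      unfolding GX_def P(3) by (rule d1(2)[OF sm(1) sm(1)])
    \<comment> \<open>The exponent is 1 or 2, and the odd bijection \<open>B\<close> respects
      equality up to sign.\<close>
    also have "\<dots> \<longleftrightarrow> squeeze d \<zeta> ^ pill_index z = squeeze d \<zeta>' ^ pill_index z"
      by (auto simp: pill_index_def power2_eq_iff B_eq_iff simp flip: B_simps(1))
    also have "\<dots> \<longleftrightarrow> \<zeta> ^ pill_index z = \<zeta>' ^ pill_index z" by (rule squeeze_power_eq[OF d index_ge_1(1)])
    finally show ?thesis .
  qed
  have eY: "GY \<zeta> = GY \<zeta>' \<longleftrightarrow> \<zeta> ^ theta_index (A z + c) = \<zeta>' ^ theta_index (A z + c)" for \<zeta> \<zeta>'
    unfolding GY_def T(3) d2(2)[OF sm(2) sm(2)] by (rule squeeze_power_eq[OF d index_ge_1(2)])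
  obtain \<phi> where \<phi>: "openin X (range GX)" "homeomorphic_map (subtopology X (range GX)) (euclidean :: complex topology) \<phi>"
      "\<And>\<zeta>. \<phi> (GX \<zeta>) = \<zeta> ^ pill_index z"
    using power_quotient_chart[OF X cX index_ge_1(1) eX] by metis
  obtain \<psi> where \<psi>: "openin Y (range GY)" "homeomorphic_map (subtopology Y (range GY)) (euclidean :: complex topology) \<psi>"
      "\<And>\<zeta>. \<psi> (GY \<zeta>) = \<zeta> ^ theta_index (A z + c)"
    using power_quotient_chart[OF Y cY index_ge_1(2) eY] by metis
  have FG: "F (GX \<zeta>) = GY \<zeta>" for \<zeta>
    by (simp add: GX_def GY_def F_P A_linear algebra_simps)
  have G0: "GX 0 = P z" by (simp add: GX_def squeeze_def B_simps)
  show ?thesis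
    unfolding locally_power_map_def
  proof (intro conjI exI)
    have "theta_index (A z + c) div pill_index z \<noteq> 0"
      using pill_index_dvd[of z] index_ge_1[of z] index_ge_1[of "A z + c"]
      by (metis dvd_div_eq_0_iff not_one_le_zero)
    then show "1 \<le> theta_index (A z + c) div pill_index z" by simp
    show "P z \<in> range GX" using G0 by (metis rangeI)
    show "F ` range GX \<subseteq> range GY" using FG by auto
    show "\<phi> (P z) = 0" using \<phi>(3)[of 0] index_ge_1(1)[of z] G0 by (simp add: power_0_left)
    show "\<psi> (F (P z)) = 0" using \<psi>(3)[of 0] index_ge_1(2)[of "A z + c"] G0 FG[of 0] by (simp add: power_0_left)
    show "\<forall>u\<in>range GX. \<psi> (F u) = \<phi> u ^ (theta_index (A z + c) div pill_index z)"
      using pill_index_dvd[of z] by (auto simp: FG \<phi>(3) \<psi>(3) simp flip: power_mult)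
  qed (use \<phi> \<psi> in auto)
qed

lemma local_degree_P: "local_degree X Y F (P z) = theta_index (A z + c) div pill_index z"
  by (rule local_degree_eq[OF F_local])

lemma F_power: "x \<in> topspace X \<Longrightarrow> locally_power_map X Y F x (local_degree X Y F x)"
  unfolding P(2)[symmetric] using F_local local_degree_P by auto

sublocale S2_branched X Y F "local_degree X Y F"
proof
  show "continuous_map X Y F" by (rule locally_power_map_continuous) (use F_power in blast)
qed (use X Y F_power in auto)

text \<open>The orbit of \<open>v\<close> consists of \<open>\<i> ^ j * v\<close> plus lattice
  vectors. The source group absorbs half-turns and translations by the columns of the matrix,
  leaving \<open>j\<close> in {0, 1} and \<open>a * b\<close> residues.\<close>

lemma generic_fibre:
  assumes v: "2 * v \<notin> gauss_int"
  shows "card {x \<in> topspace X. F x = T v} = 2 * a * b"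
proof -
  define pt where "pt = (\<lambda>(j::nat, l::nat, k::nat). \<i> ^ j * v + Complex (of_nat l) (of_nat k))"
  define q where "q t = P (B (pt t - c))" for t
  let ?I = "{0, 1::nat} \<times> {..<a} \<times> {..<b}"
  have v1: "(1 - \<i>) * v \<notin> gauss_int" "(1 + \<i>) * v \<notin> gauss_int"
    using gauss_int_1i_imp_2 v gauss_int_1i_iff by blast+
  have AP: "A (B (pt t - c)) + c = pt t" for t by simp
  have bij: "bij_betw q ?I {x \<in> topspace X. F x = T v}"
    unfolding bij_betw_def
  proof
    show "inj_on q ?I"
    proof (rule inj_onI)
      fix t t' assume t: "t \<in> ?I" "t' \<in> ?I" "q t = q t'"
      obtain j l k where tj: "t = (j, l, k)" by (cases t)
      obtain j' l' k' where tj': "t' = (j', l', k')" by (cases t')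
      have jlk: "j = 0 \<or> j = 1" "l < a" "k < b" "j' = 0 \<or> j' = 1" "l' < a" "k' < b" using t tj tj' by auto
      let ?n = "Complex (of_nat l) (of_nat k)" and ?n' = "Complex (of_nat l') (of_nat k')"
      have n: "?n \<in> gauss_int" "?n' \<in> gauss_int" by (auto simp: gauss_int_def)
      let ?z = "B (pt t - c)" and ?z' = "B (pt t' - c)"
      have "?z - ?z' \<in> gauss_int \<or> ?z + ?z' \<in> gauss_int"
        using t(3) unfolding q_def P(3) pill_eq_iff .
      then show "t = t'"
      proof
        assume "?z + ?z' \<in> gauss_int"
        then have "A (?z + ?z') \<in> gauss_int" by (rule A_gauss_int)
        then have "pt t + pt t' - 2 * c \<in> gauss_int" by (simp add: A_linear algebra_simps)
        then have "pt t + pt t' - 2 * c + 2 * c \<in> gauss_int" by (rule gauss_int_closed(1)[OF _ two_c])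
        then have "(\<i> ^ j * v + \<i> ^ j' * v) + (?n + ?n') \<in> gauss_int" by (simp add: tj tj' pt_def algebra_simps)
        then have "\<i> ^ j * v + \<i> ^ j' * v \<in> gauss_int"
          using gauss_int_add_iff[OF gauss_int_closed(1)[OF n]] by blast
        \<comment> \<open>The sum is \<open>2 * v\<close>, \<open>(1 + \<i>) * v\<close> or
          \<open>2 * \<i> * v\<close>, none of them in the lattice, so listed points are never
          related by a half-turn.\<close>
        moreover have "\<i> ^ j * v + \<i> ^ j' * v \<notin> gauss_int"
        proof -
          consider "j = 0" "j' = 0" | "j = 0" "j' = 1" | "j = 1" "j' = 0" | "j = 1" "j' = 1" using jlk by auto
          then show ?thesis
          proof cases
            case 4
            have "\<i> * v + \<i> * v = \<i> * (2 * v)" by simp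
            then show ?thesis using v gauss_int_i_iff 4 by (metis power_one_right)
          qed (use v v1 in \<open>auto simp: algebra_simps\<close>)
        qed
        ultimately show ?thesis by blast
      next
        assume zz: "?z - ?z' \<in> gauss_int"
        then have "A (?z - ?z') \<in> gauss_int" by (rule A_gauss_int)
        then have m: "pt t - pt t' \<in> gauss_int" by (simp add: A_linear)
        have "(\<i> ^ j * v - \<i> ^ j' * v) + (?n - ?n') \<in> gauss_int" using m by (simp add: tj tj' pt_def algebra_simps)
        then have "\<i> ^ j * v - \<i> ^ j' * v \<in> gauss_int"
          using gauss_int_add_iff[OF gauss_int_closed(2)[OF n]] by blast
        moreover have "\<i> ^ j * v - \<i> ^ j' * v \<notin> gauss_int" if ne: "j \<noteq> j'"
        proof -
          consider "j = 0" "j' = 1" | "j = 1" "j' = 0" using jlk ne by auto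
          then show ?thesis
          proof cases
            case 2
            have "\<i> * v - v = - ((1 - \<i>) * v)" by (simp add: algebra_simps)
            then show ?thesis using v1 gauss_int_minus_iff 2 by (metis power_one_right power_0 mult_1)
          qed (use v1 in \<open>auto simp: algebra_simps\<close>)
        qed
        ultimately have j: "j = j'" by blast
        obtain m1 m2 :: int where z: "Re (?z - ?z') = of_int m1" "Im (?z - ?z') = of_int m2"
          using zz by (auto simp: gauss_int_def elim!: Ints_cases)
        have e: "pt t - pt t' = A (?z - ?z')" by (simp add: A_linear)
        have "real l - real l' = real a * of_int m1 + of_int s * of_int m2" "real k - real k' = real b * of_int m2"
          using arg_cong[OF e, of Re] arg_cong[OF e, of Im] z j by (simp_all add: A_def tj tj' pt_def)
        then have r: "real_of_int (int l - int l') = of_int (int a * m1 + s * m2)" "real_of_int (int k - int k') = of_int (int b * m2)"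
          by simp_all
        have ik: "int k - int k' = int b * m2" using r(2) by (simp only: of_int_eq_iff)
        have il: "int l - int l' = int a * m1 + s * m2" using r(1) by (simp only: of_int_eq_iff)
        have "int b dvd int k - int k'" unfolding ik by simp
        then have k: "k = k'" using jlk nat_eq_of_dvd_diff by blast
        then have "m2 = 0" using ik ab by simp
        then have "int a dvd int l - int l'" using il by simp
        then have "l = l'" using jlk nat_eq_of_dvd_diff by blast
        then show ?thesis using j k tj tj' by simp
      qed
    qed
    show "q ` ?I = {x \<in> topspace X. F x = T v}"
    proof (intro equalityI subsetI)
      fix x assume "x \<in> q ` ?I"
      then obtain j l k where t: "x = q (j, l, k)" "j = 0 \<or> j = 1" by auto
      have "F x = T (\<i> ^ j * v + Complex (of_nat l) (of_nat k))"
        unfolding t(1) q_def F_P AP by (simp add: pt_def)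
      also have "\<dots> = T v"
      proof -
        have "Complex (of_nat l) (of_nat k) \<in> gauss_int" by (auto simp: gauss_int_def)
        then show ?thesis unfolding T(3) theta_eq_iff using t(2) by auto
      qed
      finally show "x \<in> {x \<in> topspace X. F x = T v}" using P(2) t(1) q_def by auto
    next
      fix x assume x: "x \<in> {x \<in> topspace X. F x = T v}"
      then obtain z where z: "x = P z" unfolding P(2)[symmetric] by blast
      have th: "theta (A z + c) = theta v" using x z F_P T(3) by simp
      have "\<exists>z' j. P z' = x \<and> j \<in> {0, 1::nat} \<and> A z' + c - \<i> ^ j * v \<in> gauss_int"
      proof -
        have neg: "P (- z) = x" unfolding z P(3) pill_eq_iff by simp
        have w: "A (- z) + c - u \<in> gauss_int" if "A z + c + u \<in> gauss_int" for u
        proof -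
          have eq: "A (- z) + c - u = 2 * c - (A z + c + u)" by (simp add: A_linear)
          show ?thesis unfolding eq by (rule gauss_int_closed(2)[OF two_c that])
        qed
        consider "A z + c - v \<in> gauss_int" | "A z + c + v \<in> gauss_int" | "A z + c - \<i> * v \<in> gauss_int" | "A z + c + \<i> * v \<in> gauss_int"
          using th unfolding theta_eq_iff by blast
        then show ?thesis
        proof cases
          case 1 then show ?thesis using z by (intro exI[of _ z] exI[of _ 0]) simp
        next
          case 2 then show ?thesis using neg w[of v] by (intro exI[of _ "- z"] exI[of _ 0]) simp
        next
          case 3 then show ?thesis using z by (intro exI[of _ z] exI[of _ 1]) simp
        next
          case 4 then show ?thesis using neg w[of "\<i> * v"] by (intro exI[of _ "- z"] exI[of _ 1]) simp
        qed
      qed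
      then obtain z' j where z': "P z' = x" "j \<in> {0, 1::nat}" "A z' + c - \<i> ^ j * v \<in> gauss_int" by blast
      then obtain m1 m2 :: int where m: "Re (A z' + c - \<i> ^ j * v) = of_int m1" "Im (A z' + c - \<i> ^ j * v) = of_int m2"
        by (auto simp: gauss_int_def elim!: Ints_cases)
      \<comment> \<open>The second coordinate is reduced modulo \<open>b\<close> first; the multiple
        \<open>u2\<close> removed there shifts the first coordinate by \<open>u2 * s\<close> before
        that is reduced modulo \<open>a\<close>.\<close>
      define u2 where "u2 = m2 div int b"
      define k where "k = nat (m2 mod int b)"
      define u1 where "u1 = (m1 - u2 * s) div int a"
      define l where "l = nat ((m1 - u2 * s) mod int a)"
      have k: "k < b" "m2 = int k + int b * u2" using ab by (auto simp: k_def u2_def nat_less_iff)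
      have l: "l < a" "m1 = int l + int a * u1 + u2 * s" using ab by (auto simp: l_def u1_def nat_less_iff)
      let ?u = "Complex (of_int u1) (of_int u2)"
      have "A z' + c - \<i> ^ j * v = Complex (of_nat l) (of_nat k) + A ?u"
        using m k(2) l(2) by (simp add: complex_eq_iff A_def)
      then have "A z' = (pt (j, l, k) - c) + A ?u" by (simp add: pt_def algebra_simps)
      then have "z' = B (pt (j, l, k) - c) + ?u" by (metis AB(2) B_linear)
      then have "z' - B (pt (j, l, k) - c) \<in> gauss_int" by (simp add: gauss_int_def)
      then have "P z' = q (j, l, k)" unfolding q_def P(3) pill_eq_iff by blast
      then show "x \<in> q ` ?I" using z' k(1) l(1) by (intro image_eqI[of _ _ "(j, l, k)"]) auto
    qed
  qed
  have "card {x \<in> topspace X. F x = T v} = card ?I" by (rule bij_betw_same_card[OF bij, symmetric])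
  then show ?thesis by (simp add: card_cartesian_product)
qed

lemma degree_sum:
  assumes y: "y \<in> topspace Y"
  shows "(\<Sum>x | x \<in> topspace X \<and> F x = y. local_degree X Y F x) = 2 * a * b"
proof -
  \<comment> \<open>Twice this point has real part 1/2, so it is generic, and its unweighted fibre
    count fixes the weighted one everywhere.\<close>
  let ?v = "Complex (1/4) 0"
  have v: "2 * ?v \<notin> gauss_int"
  proof -
    have "(1/2::real) \<notin> \<int>" using half_int_iff[of 1] by simp
    then show ?thesis by (simp add: gauss_int_def)
  qed
  have one: "local_degree X Y F x = 1" if x: "x \<in> {x \<in> topspace X. F x = T ?v}" for x
  proof -
    obtain z where z: "x = P z" using x unfolding P(2)[symmetric] by blast
    then have "theta (A z + c) = theta ?v" using x F_P T(3) by simp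
    then have "theta_index (A z + c) = 1" using theta_index_cong theta_index_1_iff v by metis
    then show ?thesis using pill_index_dvd[of z] z local_degree_P[of z] by simp
  qed
  have Tv: "T ?v \<in> topspace Y" using T(2) by blast
  have "(\<Sum>x | x \<in> topspace X \<and> F x = y. local_degree X Y F x) = (\<Sum>x | x \<in> topspace X \<and> F x = T ?v. local_degree X Y F x)"
    by (rule fibre_sum[OF y Tv])
  also have "\<dots> = 2 * a * b" using one generic_fibre[OF v] by simp
  finally show ?thesis .
qed


section \<open>Fibres over the cone points\<close>

lemma half_fibre:
  assumes x: "x \<in> topspace X" "F x = T (half m n)"
  shows "local_degree X Y F x = (if x \<in> P ` {z. 2 * z \<in> gauss_int} then theta_index (half m n) div 2 else theta_index (half m n))"
proof -
  obtain z where z: "x = P z" using x(1) unfolding P(2)[symmetric] by blast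
  have "theta (A z + c) = theta (half m n)" using x(2) z F_P T(3) by simp
  then have e: "theta_index (A z + c) = theta_index (half m n)" by (rule theta_index_cong)
  have "x \<in> P ` {z. 2 * z \<in> gauss_int} \<longleftrightarrow> 2 * z \<in> gauss_int"
  proof
    assume "x \<in> P ` {z. 2 * z \<in> gauss_int}"
    then obtain w where w: "2 * w \<in> gauss_int" "P w = P z" using z by auto
    then have "w - z \<in> gauss_int \<or> w + z \<in> gauss_int" unfolding P(3) pill_eq_iff by blast
    moreover have "2 \<in> gauss_int" by (simp add: gauss_int_def)
    ultimately have "2 * (w - z) \<in> gauss_int \<or> 2 * (w + z) \<in> gauss_int"
      using gauss_int_closed(4) by blast
    then have "2 * w - 2 * z \<in> gauss_int \<or> 2 * w + 2 * z \<in> gauss_int" by (simp only: right_diff_distrib distrib_left)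
    then show "2 * z \<in> gauss_int"
      using w(1) by (metis add.commute add_diff_cancel_left' diff_diff_eq2 gauss_int_closed(2))
  qed (use z in auto)
  then show ?thesis using local_degree_P[of z] z e by (simp add: pill_index_def)
qed

text \<open>The four cone points of the source, the only places where the local degree is
  halved.\<close>

definition corners :: "'a set" where "corners = P ` {z. 2 * z \<in> gauss_int}"

lemma corners_eq: "corners = (\<lambda>(i, j). P (half i j)) ` ({0, 1} \<times> {0, 1})"
  and inj_corners: "inj_on (\<lambda>(i, j). P (half i j)) ({0, 1} \<times> {0, 1})"
proof -
  have eq: "P (half m n) = P (half m' n') \<longleftrightarrow> even (m - m') \<and> even (n - n')" for m n m' n'
  proof -
    have "half m n - half m' n' = half (m - m') (n - n')" "half m n + half m' n' = half (m + m') (n + n')"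
      by (auto simp: half_def complex_eq_iff diff_divide_distrib add_divide_distrib)
    then show ?thesis unfolding P(3) pill_eq_iff by (auto simp: half_gauss_int_iff)
  qed
  show "corners = (\<lambda>(i, j). P (half i j)) ` ({0, 1} \<times> {0, 1})"
  proof (intro equalityI subsetI)
    fix x assume "x \<in> corners"
    then obtain m n where "x = P (half m n)" unfolding corners_def two_mult_gauss_int by auto
    moreover have "even (k - k mod 2)" for k :: int by presburger
    ultimately have "x = P (half (m mod 2) (n mod 2))" using eq by blast
    moreover have "m mod 2 \<in> {0, 1}" "n mod 2 \<in> {0, 1}" by auto
    ultimately show "x \<in> (\<lambda>(i, j). P (half i j)) ` ({0, 1} \<times> {0, 1})" by (intro image_eqI[of _ _ "(m mod 2, n mod 2)"]) auto
  next
    fix x assume "x \<in> (\<lambda>(i, j). P (half i j)) ` ({0, 1} \<times> {0, 1})"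
    then show "x \<in> corners" unfolding corners_def two_mult_gauss_int by auto
  qed
  show "inj_on (\<lambda>(i, j). P (half i j)) ({0, 1} \<times> {0, 1})"
    by (rule inj_onI) (auto simp: eq)
qed

lemma F_corner: "F (P (half i j)) = T (half (int a * i + s * j + g) (int b * j + h))"
proof -
  have "A (half i j) + c = half (int a * i + s * j + g) (int b * j + h)"
    by (simp add: A_def half_def complex_eq_iff add_divide_distrib)
  then show ?thesis using F_P by simp
qed

text \<open>The number of source cone points over a given special point of the target; by
  \<open>theta_half_eq_iff\<close> it is a matter of parities.\<close>

definition corner_count :: "int \<Rightarrow> int \<Rightarrow> nat" where
  "corner_count m n = card {(i, j) \<in> {0, 1} \<times> {0, 1}.
     theta (half (int a * i + s * j + g) (int b * j + h)) = theta (half m n)}"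

lemma card_corners_fibre:
  "card ({x \<in> topspace X. F x = T (half m n)} \<inter> corners) = corner_count m n"
proof -
  let ?S = "{(i, j) \<in> {0, 1} \<times> {0, 1}. theta (half (int a * i + s * j + g) (int b * j + h)) = theta (half m n)}"
  have eq: "{x \<in> topspace X. F x = T (half m n)} \<inter> corners = (\<lambda>(i, j). P (half i j)) ` ?S"
  proof (intro equalityI subsetI)
    fix x assume x: "x \<in> {x \<in> topspace X. F x = T (half m n)} \<inter> corners"
    then obtain i j where ij: "x = P (half i j)" "(i, j) \<in> {0, 1} \<times> {0, 1}" unfolding corners_eq by auto
    then have "(i, j) \<in> ?S" using x by (simp add: F_corner T(3))
    then show "x \<in> (\<lambda>(i, j). P (half i j)) ` ?S" using ij(1) by (rule_tac image_eqI[of _ _ "(i, j)"]) auto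
  next
    fix x assume "x \<in> (\<lambda>(i, j). P (half i j)) ` ?S"
    then obtain i j where ij: "x = P (half i j)" "(i, j) \<in> ?S" by auto
    then have "F x = T (half m n)" by (auto simp: F_corner T(3))
    moreover have "x \<in> corners" using ij unfolding corners_eq by (auto intro!: image_eqI[of _ _ "(i, j)"])
    moreover have "x \<in> topspace X" using ij(1) P(2) by blast
    ultimately show "x \<in> {x \<in> topspace X. F x = T (half m n)} \<inter> corners" by blast
  qed
  have "card ((\<lambda>(i, j). P (half i j)) ` ?S) = card ?S"
    by (rule card_image, rule inj_on_subset[OF inj_corners]) auto
  then show ?thesis unfolding eq corner_count_def .
qed

lemma corner_count_le: "corner_count m n \<le> 4"
proof -
  have "corner_count m n \<le> card ({0, 1::int} \<times> {0, 1::int})"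
    unfolding corner_count_def by (rule card_mono) auto
  then show ?thesis by (simp add: card_cartesian_product)
qed

text \<open>The local degree is the index of the target point, halved at corners. The total degree
  then forces the number of remaining points.\<close>

lemma local_degrees_half:
  fixes m n
  defines "e \<equiv> theta_index (half m n)"
  obtains N where "local_degrees_over X Y F (T (half m n)) = rep e N + rep (e div 2) (corner_count m n)"
    "e * N + e div 2 * corner_count m n = 2 * a * b"
proof -
  let ?S = "{x \<in> topspace X. F x = T (half m n)}"
  have Ty: "T (half m n) \<in> topspace Y" using T(2) by blast
  have fin: "finite ?S" by (rule fibre_finite[OF Ty Ty])
  have deg: "local_degree X Y F x = (if x \<in> corners then e div 2 else e)" if "x \<in> ?S" for x
    using half_fibre[of x m n] that unfolding corners_def e_def by auto
  have "local_degrees_over X Y F (T (half m n)) = rep e (card (?S - corners)) + rep (e div 2) (card (?S \<inter> corners))"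
    unfolding local_degrees_over_def fibre_def by (rule image_mset_two_values[OF fin]) (use deg in auto)
  moreover from this have "sum_mset (local_degrees_over X Y F (T (half m n))) = e * card (?S - corners) + e div 2 * card (?S \<inter> corners)"
    by (simp add: sum_mset_replicate_mset)
  moreover have "sum_mset (local_degrees_over X Y F (T (half m n))) = 2 * a * b"
    unfolding local_degrees_over_def fibre_def using degree_sum[OF Ty] by (simp add: sum_unfold_sum_mset)
  ultimately show ?thesis using that[of "card (?S - corners)"] unfolding card_corners_fibre by (simp add: mult.commute)
qed

lemma local_degrees_generic:
  assumes "2 * v \<notin> gauss_int" "x \<in> fibre X F (T v)"
  shows "local_degree X Y F x = 1"
proof -
  have x: "x \<in> topspace X" "F x = T v" using assms(2) by (auto simp: fibre_def)
  obtain z where z: "x = P z" using x(1) unfolding P(2)[symmetric] by blast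
  then have "theta (A z + c) = theta v" using x F_P T(3) by simp
  then have "theta_index (A z + c) = 1" using theta_index_cong theta_index_1_iff assms(1) by metis
  then show ?thesis using pill_index_dvd[of z] z local_degree_P[of z] by simp
qed

lemma branching_iff: "T v \<in> branching_points X Y F \<longleftrightarrow> (\<exists>e \<in># local_degrees_over X Y F (T v). e > 1)"
proof -
  have Ty: "T v \<in> topspace Y" using T(2) by blast
  have "finite (fibre X F (T v))" unfolding fibre_def by (rule fibre_finite[OF Ty Ty])
  then show ?thesis using Ty by (auto simp: branching_points_def local_degrees_over_def)
qed

lemma realizable_cover:
  assumes ab2: "2 * a * b > 4"
    and L0: "4 * N0 + 2 * corner_count 0 0 = 2 * a * b"
    and L1: "4 * N1 + 2 * corner_count 1 1 = 2 * a * b"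
    and L2: "2 * N2 + corner_count 1 0 = 2 * a * b"
  shows "realizable X Y (2 * a * b)
    {# rep 2 N2 + rep 1 (corner_count 1 0), rep 4 N0 + rep 2 (corner_count 0 0), rep 4 N1 + rep 2 (corner_count 1 1) #}"
proof -
  have ld_aux: "local_degrees_over X Y F (T (half m n)) = rep e N + rep (e div 2) (corner_count m n)"
    if e: "theta_index (half m n) = e" "e > 0" and N: "e * N + e div 2 * corner_count m n = 2 * a * b" for m n e N
  proof -
    obtain N' where N': "local_degrees_over X Y F (T (half m n)) = rep e N' + rep (e div 2) (corner_count m n)"
      "e * N' + e div 2 * corner_count m n = 2 * a * b"
      using local_degrees_half[of m n] unfolding e(1) by blast
    have "e * N' = e * N" using N N'(2) by linarith
    then have "N' = N" using e(2) by simp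
    then show ?thesis using N'(1) by simp
  qed
  have ld: "local_degrees_over X Y F (T (half 0 0)) = rep 4 N0 + rep 2 (corner_count 0 0)"
    "local_degrees_over X Y F (T (half 1 1)) = rep 4 N1 + rep 2 (corner_count 1 1)"
    "local_degrees_over X Y F (T (half 1 0)) = rep 2 N2 + rep 1 (corner_count 1 0)"
    using ld_aux[of 0 0 4 N0] ld_aux[of 1 1 4 N1] ld_aux[of 1 0 2 N2] L0 L1 L2
    by (simp_all add: theta_index_half)
  have half_br: "T (half 0 0) \<in> branching_points X Y F" "T (half 1 1) \<in> branching_points X Y F" "T (half 1 0) \<in> branching_points X Y F"
  proof -
    \<comment> \<open>Degree above 4 guarantees a point of local degree 2 over the class of (1,0),
      where at most four corners of degree 1 can lie.\<close>
    have "N0 \<noteq> 0 \<or> corner_count 0 0 \<noteq> 0" "N1 \<noteq> 0 \<or> corner_count 1 1 \<noteq> 0" "N2 \<noteq> 0"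
      using ab2 L0 L1 L2 corner_count_le[of 1 0] by auto
    then show "T (half 0 0) \<in> branching_points X Y F" "T (half 1 1) \<in> branching_points X Y F" "T (half 1 0) \<in> branching_points X Y F"
      unfolding branching_iff ld by (auto simp: in_replicate_mset)
  qed
  have gen: "2 * v \<notin> gauss_int" if "T v \<notin> {T (half 0 0), T (half 1 1), T (half 1 0)}" for v
  proof
    assume "2 * v \<in> gauss_int"
    then obtain m n where "v = half m n" using two_mult_gauss_int by auto
    then show False using that by (auto simp: T(3) theta_half_eq_iff)
  qed
  have nb: "T v \<notin> branching_points X Y F" if "2 * v \<notin> gauss_int" for v
    using local_degrees_generic[OF that] by (auto simp: branching_points_def)
  have bp: "branching_points X Y F = {T (half 1 0), T (half 0 0), T (half 1 1)}"
  proof (intro equalityI subsetI)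
    fix y assume y: "y \<in> branching_points X Y F"
    then have "y \<in> range T" using T(2) by (simp add: branching_points_def)
    then obtain v where "y = T v" by blast
    then show "y \<in> {T (half 1 0), T (half 0 0), T (half 1 1)}" using gen nb y by blast
  qed (use half_br in auto)
  have dist: "T (half 1 0) \<noteq> T (half 0 0)" "T (half 1 0) \<noteq> T (half 1 1)" "T (half 0 0) \<noteq> T (half 1 1)"
    by (auto simp: T(3) theta_half_eq_iff)
  have "has_cover_degree X Y F (2 * a * b)"
    unfolding has_cover_degree_def
  proof
    fix y assume y: "y \<in> topspace Y - branching_points X Y F"
    then have "y \<in> range T" using T(2) by simp
    then obtain v where v: "y = T v" by blast
    have "2 * v \<notin> gauss_int" using gen y unfolding bp v by blast
    then have "card (fibre X F y) = 2 * a * b" using generic_fibre by (simp add: fibre_def v)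
    moreover have "finite (fibre X F y)" unfolding fibre_def using fibre_finite y by blast
    ultimately show "finite (fibre X F y) \<and> card (fibre X F y) = 2 * a * b" by simp
  qed
  moreover have "branched_cover X Y F"
    unfolding branched_cover_def using S2_closed_orientable_surface[OF X] S2_closed_orientable_surface[OF Y] f F_power by blast
  moreover have "finite (branching_points X Y F)" unfolding bp by simp
  moreover have "image_mset (local_degrees_over X Y F) (mset_set (branching_points X Y F)) =
     {# rep 2 N2 + rep 1 (corner_count 1 0), rep 4 N0 + rep 2 (corner_count 0 0), rep 4 N1 + rep 2 (corner_count 1 1) #}"
    unfolding bp using dist ld by simp
  ultimately show ?thesis unfolding realizable_def by blast
qed

end

lemma S2_present:
  fixes p :: "complex \<Rightarrow> real \<times> complex"
  assumes X: "X homeomorphic_space S2" and p: "continuous_on UNIV p" "range p = sph"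
  shows "\<exists>P. continuous_map euclidean X P \<and> range P = topspace X \<and> (\<forall>z w. P z = P w \<longleftrightarrow> p z = p w)"
proof -
  obtain k k' where "homeomorphic_maps X (top_of_set sph) k k'"
    using homeomorphic_space_trans[OF X S2_sph] unfolding homeomorphic_space_def by blast
  then have k: "continuous_map (top_of_set sph) X k'" "\<And>x. x \<in> topspace X \<Longrightarrow> k' (k x) = x" "\<And>y. y \<in> sph \<Longrightarrow> k (k' y) = y"
    "\<And>x. x \<in> topspace X \<Longrightarrow> k x \<in> sph"
    by (auto simp: homeomorphic_maps_def continuous_map_def)
  have "continuous_map euclidean (top_of_set sph) p"
    using p by (intro continuous_map_into_subtopology) auto
  from continuous_map_compose[OF this k(1)] have c: "continuous_map euclidean X (k' \<circ> p)" .
  have "range (k' \<circ> p) = topspace X"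
  proof (intro equalityI subsetI)
    fix x assume "x \<in> range (k' \<circ> p)"
    then show "x \<in> topspace X" using c by (auto simp: continuous_map_def)
  next
    fix x assume x: "x \<in> topspace X"
    then obtain z where "k x = p z" using k(4)[OF x] p(2) by (metis imageE)
    then have "(k' \<circ> p) z = x" using k(2)[OF x] by simp
    then show "x \<in> range (k' \<circ> p)" by blast
  qed
  moreover have "(k' \<circ> p) z = (k' \<circ> p) w \<longleftrightarrow> p z = p w" for z w
    using k(3)[of "p z"] k(3)[of "p w"] p(2) by (metis comp_apply rangeI)
  ultimately show ?thesis using c by blast
qed

lemma lattice_cover_exists:
  assumes "X homeomorphic_space S2" "Y homeomorphic_space S2"
  obtains P T where "\<And>a b. a > 0 \<Longrightarrow> b > 0 \<Longrightarrow> lattice_cover X Y P T a b"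
proof -
  obtain P where P: "continuous_map euclidean X P" "range P = topspace X" "\<And>z w. P z = P w \<longleftrightarrow> pill z = pill w"
    using S2_present[OF assms(1) continuous_pill range_pill] by blast
  obtain T where T: "continuous_map euclidean Y T" "range T = topspace Y" "\<And>z w. T z = T w \<longleftrightarrow> theta z = theta w"
    using S2_present[OF assms(2) continuous_theta range_theta] by blast
  have "lattice_cover X Y P T a b" if "a > 0" "b > 0" for a b
    using assms P T that by (simp add: lattice_cover_def)
  then show ?thesis by (rule that)
qed

section \<open>The six families\<close>

definition six_families :: "nat \<Rightarrow> nat multiset multiset \<Rightarrow> bool" where
  "six_families d P \<longleftrightarrow> (\<exists>k\<ge>1. type1 k d P \<or> type2 k d P \<or> type3 k d P \<or> type4 k d P \<or> type5 k d P \<or> type6 k d P)"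

lemma dvd_4_cases:
  assumes "(x::nat) dvd 4"
  shows "x = 1 \<or> x = 2 \<or> x = 4"
proof -
  have "x \<le> 4" using assms by (rule dvd_imp_le) simp
  then have "x \<in> {0, 1, 2, 3, 4}" by auto
  then show ?thesis using assms by auto
qed

lemma mset_two_values:
  fixes M :: "'c multiset"
  assumes "\<And>x. x \<in># M \<Longrightarrow> x = \<alpha> \<or> x = \<beta>" "\<alpha> \<noteq> \<beta>"
  obtains m n where "M = replicate_mset m \<alpha> + replicate_mset n \<beta>"
proof -
  have "M = replicate_mset (count M \<alpha>) \<alpha> + replicate_mset (count M \<beta>) \<beta>"
  proof (rule multiset_eqI)
    fix x
    show "count M x = count (replicate_mset (count M \<alpha>) \<alpha> + replicate_mset (count M \<beta>) \<beta>) x"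
      using assms by (cases "x \<in># M") (auto simp: not_in_iff)
  qed
  then show ?thesis by (rule that)
qed

lemma cone_order_2_form:
  assumes "is_partition d p" "cone_order p = 2"
  obtains m n where "p = rep 2 m + rep 1 n" "m > 0"
proof -
  have dv: "x dvd 2" if "x \<in># p" for x using assms(2) that unfolding cone_order_def by (metis dvd_Lcm)
  have "x = 2 \<or> x = 1" if "x \<in># p" for x
    using dvd_imp_le[OF dv[OF that]] assms(1) that by (force simp: is_partition_def)
  then obtain m n where mn: "p = rep 2 m + rep 1 n" using mset_two_values[of p 2 1] by auto
  have "m > 0"
  proof (rule ccontr)
    assume "\<not> m > 0"
    then have "set_mset p \<subseteq> {1}" using mn by (auto simp: in_replicate_mset)
    then have "cone_order p dvd 1" unfolding cone_order_def by (intro Lcm_least) auto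
    then show False using assms(2) by simp
  qed
  then show ?thesis using that mn by blast
qed

text \<open>A part 1 would leave a source cone point of order 4; the third assumption, valid when
  all source orders are 2, rules it out.\<close>

lemma cone_order_4_form:
  assumes "is_partition d p" "cone_order p = 4" "\<And>x. x \<in># p \<Longrightarrow> 4 div x \<in> {1, 2}"
  obtains m n where "p = rep 4 m + rep 2 n" "m > 0"
proof -
  have dv: "x dvd 4" if "x \<in># p" for x using assms(2) that unfolding cone_order_def by (metis dvd_Lcm)
  have "x = 4 \<or> x = 2" if "x \<in># p" for x
    using dvd_4_cases[OF dv[OF that]] assms(3)[OF that] by auto
  then obtain m n where mn: "p = rep 4 m + rep 2 n" using mset_two_values[of p 4 2] by auto
  have "m > 0"
  proof (rule ccontr)
    assume "\<not> m > 0"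
    then have "set_mset p \<subseteq> {2}" using mn by (auto simp: in_replicate_mset)
    then have "cone_order p dvd 2" unfolding cone_order_def by (intro Lcm_least) auto
    then have "4 \<le> (2::nat)" unfolding assms(2) by (rule dvd_imp_le) simp
    then show False by simp
  qed
  then show ?thesis using that mn by blast
qed

lemma cone_order_rep:
  "m > 0 \<Longrightarrow> cone_order (rep 2 m + rep 1 n) = 2"
  "m > 0 \<Longrightarrow> cone_order (rep 4 m + rep 2 n) = 4"
  by (auto simp: cone_order_def in_replicate_mset Lcm_nat_insert)

definition cone_quotients :: "nat multiset \<Rightarrow> nat multiset" where
  "cone_quotients p = filter_mset (\<lambda>q. q \<noteq> 1) (image_mset (\<lambda>e. cone_order p div e) p)"

lemma induced_source_3:
  "snd (induced_source X {#p, q, r#}) = cone_quotients p + cone_quotients q + cone_quotients r"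
  unfolding induced_source_def cone_quotients_def by simp

lemma filter_replicate_mset:
  "filter_mset Q (replicate_mset n x) = (if Q x then replicate_mset n x else {#})"
  by (induction n) auto

lemma cone_quotients_rep:
  assumes "m > 0"
  shows "cone_quotients (rep 2 m + rep 1 n) = rep 2 n" "cone_quotients (rep 4 m + rep 2 n) = rep 2 n"
  unfolding cone_quotients_def cone_order_rep[OF assms] by (simp_all add: filter_replicate_mset)

lemma is_partition_two_values:
  assumes "\<alpha> > 0" "\<beta> > 0"
  shows "is_partition d (rep \<alpha> m + rep \<beta> n) \<longleftrightarrow> \<alpha> * m + \<beta> * n = d"
  using assms unfolding is_partition_def by (auto simp: mult.commute split: if_splits)

text \<open>\<open>n\<close>, \<open>n'\<close>, \<open>n''\<close> count the source cone points of
  order 2 over the target cone points of orders 2, 4, 4.\<close>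

definition triple :: "nat \<Rightarrow> nat \<Rightarrow> nat \<Rightarrow> nat \<Rightarrow> nat \<Rightarrow> nat \<Rightarrow> nat multiset multiset" where
  "triple m n m' n' m'' n'' = {# rep 2 m + rep 1 n, rep 4 m' + rep 2 n', rep 4 m'' + rep 2 n'' #}"

lemma triple_swap: "triple m n m' n' m'' n'' = triple m n m'' n'' m' n'"
  by (simp add: triple_def add_mset_commute)

lemma replicate_mset_small:
  "{#x, x, x, x#} = replicate_mset 4 x" "{#x, x, x#} = replicate_mset 3 x" "{#x, x#} = replicate_mset 2 x" "{#x#} = replicate_mset 1 x"
  by (simp_all add: numeral_eq_Suc)

lemma types_eq_triple:
  "type1 k d P \<longleftrightarrow> d = 4*k+4 \<and> P = triple (2*k) 4 (k+1) 0 (k+1) 0"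
  "type2 k d P \<longleftrightarrow> d = 4*k+4 \<and> P = triple (2*k+1) 2 k 2 (k+1) 0"
  "type3 k d P \<longleftrightarrow> d = 4*k+2 \<and> P = triple (2*k) 2 k 1 k 1"
  "type4 k d P \<longleftrightarrow> d = 4*k+4 \<and> P = triple (2*k+2) 0 k 2 k 2"
  "type5 k d P \<longleftrightarrow> d = 4*k+6 \<and> P = triple (2*k+3) 0 k 3 (k+1) 1"
  "type6 k d P \<longleftrightarrow> d = 4*k+8 \<and> P = triple (2*k+4) 0 k 4 (k+2) 0"
  unfolding type1_def type2_def type3_def type4_def type5_def type6_def triple_def replicate_mset_small[symmetric]
  by simp_all

text \<open>\<open>d\<close> is even, so \<open>n\<close> is 0, 2 or 4. With
  \<open>n'' \<le> n'\<close>, which the symmetry \<open>triple_swap\<close> allows, exactly six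
  distributions of four cone points remain.\<close>

lemma six_families_of_numbers:
  assumes d: "2 * m + n = d" "4 * m' + 2 * n' = d" "4 * m'' + 2 * n'' = d" and "n + n' + n'' = 4"
    and pos: "m' > 0" "m'' > 0" "m > 0" and le: "n'' \<le> n'"
  shows "six_families d (triple m n m' n' m'' n'')"
proof -
  have "n = 0 \<or> n = 2 \<or> n = 4" using d(1,2) assms(4) by presburger
  moreover have "n'' = 0 \<or> n'' = 1 \<or> n'' = 2" using assms(4) le by presburger
  moreover have "n' = 4 - n - n''" using assms(4) by simp
  ultimately consider "n = 4" "n' = 0" "n'' = 0" | "n = 2" "n' = 2" "n'' = 0" | "n = 2" "n' = 1" "n'' = 1"
    | "n = 0" "n' = 2" "n'' = 2" | "n = 0" "n' = 3" "n'' = 1" | "n = 0" "n' = 4" "n'' = 0"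
    using assms(4) le by (elim disjE; simp)
  then show ?thesis
  proof cases
    case 1
    \<comment> \<open>Type 1 has \<open>k = m' - 1\<close>, and \<open>k \<ge> 1\<close> comes from
      \<open>m > 0\<close>; in the other cases \<open>k = m'\<close>.\<close>
    then have "m' = (m' - 1) + 1" "m'' = (m' - 1) + 1" "m = 2 * (m' - 1)" "d = 4 * (m' - 1) + 4" using assms by auto
    moreover have "m' - 1 \<ge> 1" using calculation(3) pos by simp
    ultimately show ?thesis unfolding six_families_def types_eq_triple using 1 by metis
  next
    case 2
    then have "m'' = m' + 1" "m = 2 * m' + 1" "d = 4 * m' + 4" using assms by auto
    then show ?thesis unfolding six_families_def types_eq_triple using 2 pos by (metis Suc_leI One_nat_def)
  next
    case 3
    then have "m'' = m'" "m = 2 * m'" "d = 4 * m' + 2" using assms by auto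
    then show ?thesis unfolding six_families_def types_eq_triple using 3 pos by (metis Suc_leI One_nat_def)
  next
    case 4
    then have "m'' = m'" "m = 2 * m' + 2" "d = 4 * m' + 4" using assms by auto
    then show ?thesis unfolding six_families_def types_eq_triple using 4 pos by (metis Suc_leI One_nat_def)
  next
    case 5
    then have "m'' = m' + 1" "m = 2 * m' + 3" "d = 4 * m' + 6" using assms by auto
    then show ?thesis unfolding six_families_def types_eq_triple using 5 pos by (metis Suc_leI One_nat_def)
  next
    case 6
    then have "m'' = m' + 2" "m = 2 * m' + 4" "d = 4 * m' + 8" using assms by auto
    then show ?thesis unfolding six_families_def types_eq_triple using 6 pos by (metis Suc_leI One_nat_def)
  qed
qed

text \<open>The target orders sort the partitions into one of order 2 and two of order 4; the source
  orders exclude parts 1 in the latter and give \<open>n + n' + n'' = 4\<close>.\<close>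

lemma candidate_imp_six_families:
  assumes cc: "candidate_cover X Y d P"
    and io: "induces_orbifold_cover X Y P (S2, {#2, 2, 2, 2#}) (S2, {#2, 4, 4#})"
  shows "six_families d P"
proof -
  have src: "snd (induced_source X P) = {#2, 2, 2, 2#}" and tgt: "image_mset cone_order P = {#2, 4, 4#}"
    using io by (auto simp: induces_orbifold_cover_def same_orbifold_def induced_target_def)
  obtain p Q where pQ: "P = add_mset p Q" "cone_order p = 2" "image_mset cone_order Q = {#4, 4#}"
    using msed_map_invR[OF tgt] by blast
  obtain q R where qR: "Q = add_mset q R" "cone_order q = 4" "image_mset cone_order R = {#4#}"
    using msed_map_invR[OF pQ(3)] by blast
  obtain r R' where rR: "R = add_mset r R'" "cone_order r = 4" "image_mset cone_order R' = {#}"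
    using msed_map_invR[OF qR(3)] by blast
  have P: "P = {#p, q, r#}" using pQ qR rR by simp
  have part: "is_partition d p" "is_partition d q" "is_partition d r"
    using cc P by (auto simp: candidate_cover_def)
  have sum: "cone_quotients p + cone_quotients q + cone_quotients r = {#2, 2, 2, 2#}"
    using src unfolding P induced_source_3 .
  have two: "x = 2" if "x \<in># cone_quotients q \<or> x \<in># cone_quotients r" for x
  proof -
    have "x \<in># {#2, 2, 2, 2#}" unfolding sum[symmetric] using that by auto
    then show ?thesis by auto
  qed
  have q12: "4 div x \<in> {1, 2}" if "x \<in># q" for x
  proof (rule ccontr)
    assume n: "4 div x \<notin> {1, 2}"
    then have "4 div x \<in># cone_quotients q" using that qR(2) by (auto simp: cone_quotients_def)
    then show False using two n by blast
  qed
  have r12: "4 div x \<in> {1, 2}" if "x \<in># r" for x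
  proof (rule ccontr)
    assume n: "4 div x \<notin> {1, 2}"
    then have "4 div x \<in># cone_quotients r" using that rR(2) by (auto simp: cone_quotients_def)
    then show False using two n by blast
  qed
  obtain m n where p: "p = rep 2 m + rep 1 n" "m > 0" by (rule cone_order_2_form[OF part(1) pQ(2)])
  obtain m' n' where q: "q = rep 4 m' + rep 2 n'" "m' > 0" by (rule cone_order_4_form[OF part(2) qR(2) q12])
  obtain m'' n'' where r: "r = rep 4 m'' + rep 2 n''" "m'' > 0" by (rule cone_order_4_form[OF part(3) rR(2) r12])
  have "rep 2 n + rep 2 n' + rep 2 n'' = {#2, 2, 2, 2#}"
    using sum p q r cone_quotients_rep by simp
  then have n4: "n + n' + n'' = 4"
  proof -
    have "size (rep 2 n + rep 2 n' + rep 2 n'') = size {#2, 2, 2, 2 :: nat#}"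
      by (simp only: \<open>rep 2 n + rep 2 n' + rep 2 n'' = {#2, 2, 2, 2#}\<close>)
    then show ?thesis by simp
  qed
  have d: "2 * m + n = d" "4 * m' + 2 * n' = d" "4 * m'' + 2 * n'' = d"
    using part unfolding p(1) q(1) r(1) by (simp_all only: is_partition_two_values zero_less_numeral zero_less_one mult_1)
  have PT: "P = triple m n m' n' m'' n''" unfolding P p q r triple_def ..
  show ?thesis
  proof (cases "n'' \<le> n'")
    case True
    show ?thesis unfolding PT by (rule six_families_of_numbers[OF d n4 q(2) r(2) p(2) True])
  next
    case False
    have "n + n'' + n' = 4" using n4 by simp
    then show ?thesis unfolding PT triple_swap[of m n m' n'] 
      by (rule six_families_of_numbers[OF d(1,3,2) _ r(2) q(2) p(2)]) (use False in simp)
  qed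
qed

lemma triple_candidate:
  assumes X: "X homeomorphic_space S2" and Y: "Y homeomorphic_space S2"
    and d: "2 * m + n = d" "4 * m' + 2 * n' = d" "4 * m'' + 2 * n'' = d" and n: "n + n' + n'' = 4"
    and pos: "m > 0" "m' > 0" "m'' > 0"
  shows "candidate_cover X Y d (triple m n m' n' m'' n'') \<and>
    induces_orbifold_cover X Y (triple m n m' n' m'' n'') (S2, {#2, 2, 2, 2#}) (S2, {#2, 4, 4#})"
proof
  have part: "is_partition d (rep 2 m + rep 1 n)" "is_partition d (rep 4 m' + rep 2 n')" "is_partition d (rep 4 m'' + rep 2 n'')"
    using d by (simp_all only: is_partition_two_values zero_less_numeral zero_less_one mult_1)
  \<comment> \<open>For two spheres and three partitions, Riemann-Hurwitz says that the total length
    is \<open>d + 2\<close>.\<close>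
  have "m + n + m' + n' + m'' + n'' = d + 2" using d n by linarith
  then have "int (m + n + m' + n' + m'' + n'') = int d + 2" by simp
  then have "euler_char X - (\<Sum>p \<in># triple m n m' n' m'' n''. int (size p)) = int d * (euler_char Y - int (size (triple m n m' n' m'' n'')))"
    unfolding euler_char_S2[OF X] euler_char_S2[OF Y] by (simp add: triple_def)
  then show "candidate_cover X Y d (triple m n m' n' m'' n'')"
    unfolding candidate_cover_def using S2_closed_orientable_surface[OF X] S2_closed_orientable_surface[OF Y] part pos d
    by (auto simp: triple_def in_replicate_mset)
  have "rep 2 n + rep 2 n' + rep 2 n'' = {#2, 2, 2, 2#}"
  proof -
    have "rep 2 n + rep 2 n' + rep 2 n'' = rep 2 (n + n' + n'')" by (simp add: multiset_eq_iff)
    then show ?thesis unfolding n replicate_mset_small(1)[symmetric] .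
  qed
  then have src: "snd (induced_source X (triple m n m' n' m'' n'')) = {#2, 2, 2, 2#}"
    unfolding triple_def induced_source_3 cone_quotients_rep(1)[OF pos(1)] cone_quotients_rep(2)[OF pos(2)]
      cone_quotients_rep(2)[OF pos(3)] .
  have "image_mset cone_order (triple m n m' n' m'' n'') = {#2, 4, 4#}"
    unfolding triple_def by (simp only: image_mset_add_mset image_mset_empty cone_order_rep pos)
  then show "induces_orbifold_cover X Y (triple m n m' n' m'' n'') (S2, {#2, 2, 2, 2#}) (S2, {#2, 4, 4#})"
    unfolding induces_orbifold_cover_def same_orbifold_def src using X Y
    by (simp add: induced_target_def induced_source_def)
qed

lemma six_families_imp_candidate:
  assumes X: "X homeomorphic_space S2" and Y: "Y homeomorphic_space S2" and "six_families d P"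
  shows "candidate_cover X Y d P \<and> induces_orbifold_cover X Y P (S2, {#2, 2, 2, 2#}) (S2, {#2, 4, 4#})"
proof -
  obtain k where k: "k \<ge> 1" "type1 k d P \<or> type2 k d P \<or> type3 k d P \<or> type4 k d P \<or> type5 k d P \<or> type6 k d P"
    using assms(3) unfolding six_families_def by blast
  from k(2) show ?thesis
    unfolding types_eq_triple
    by (elim disjE conjE; hypsubst, intro triple_candidate[OF X Y]) (use k(1) in auto)
qed

section \<open>Obstructions for types 5 and 6\<close>

text \<open>Branching points form a set, so even equal partitions in the multiset belong to
  different points.\<close>

lemma realizable_tripleE:
  assumes X: "X homeomorphic_space S2" and Y: "Y homeomorphic_space S2"
    and "realizable X Y d {#p, q, r#}" "p \<noteq> {#}" "q \<noteq> {#}" "r \<noteq> {#}"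
  obtains f C A B where "S2_branched X Y f (local_degree X Y f)"
    "C \<in> topspace Y" "A \<in> topspace Y" "B \<in> topspace Y" "A \<noteq> B" "C \<noteq> A" "C \<noteq> B"
    "local_degrees_over X Y f C = p" "local_degrees_over X Y f A = q" "local_degrees_over X Y f B = r"
proof -
  obtain f where f: "branched_cover X Y f" "finite (branching_points X Y f)"
    "image_mset (local_degrees_over X Y f) (mset_set (branching_points X Y f)) = {#p, q, r#}"
    using assms(3) unfolding realizable_def by blast
  let ?M = "mset_set (branching_points X Y f)"
  obtain C M1 where C: "?M = add_mset C M1" "local_degrees_over X Y f C = p" "image_mset (local_degrees_over X Y f) M1 = {#q, r#}"
    using msed_map_invR[OF f(3)] by blast
  obtain A M2 where A: "M1 = add_mset A M2" "local_degrees_over X Y f A = q" "image_mset (local_degrees_over X Y f) M2 = {#r#}"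
    using msed_map_invR[OF C(3)] by blast
  obtain B M3 where B: "M2 = add_mset B M3" "local_degrees_over X Y f B = r"
    using msed_map_invR[OF A(3)] by blast
  have M: "?M = {#C, A, B#} + M3" using C A B by simp
  have le: "count ?M x \<le> 1" for x by (simp add: count_mset_set')
  have "A \<noteq> B" "C \<noteq> A" "C \<noteq> B"
    using le[of A] le[of C] unfolding M by (auto split: if_splits)
  moreover have "C \<in># ?M" "A \<in># ?M" "B \<in># ?M" unfolding M by auto
  then have "C \<in> topspace Y" "A \<in> topspace Y" "B \<in> topspace Y"
    using f(2) by (auto simp: branching_points_def)
  moreover have "S2_branched X Y f (local_degree X Y f)"
  proof
    show "continuous_map X Y f" using f(1) by (simp add: branched_cover_def)
    fix x assume "x \<in> topspace X"
    then obtain k where "locally_power_map X Y f x k" using f(1) by (auto simp: branched_cover_def)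
    then show "locally_power_map X Y f x (local_degree X Y f x)" using local_degree_eq by metis
  qed (use X Y in auto)
  ultimately show ?thesis using that C(2) A(2) B(2) by blast
qed

lemma (in S2_branched) local_degrees_overD:
  assumes "y \<in> topspace Y" "m = local_degree X Y f"
  shows "\<And>x. x \<in> topspace X \<Longrightarrow> f x = y \<Longrightarrow> m x \<in># local_degrees_over X Y f y"
    "size (local_degrees_over X Y f y) = card {x \<in> topspace X. f x = y}"
  using fibre_finite[OF assms(1,1)] assms(2) by (auto simp: local_degrees_over_def fibre_def)

text \<open>\<open>m\<close> is the cardinality of the fibre with all degrees 2, which
  \<open>even_card_fibre\<close> shows to be even; type 5 has \<open>m = 2 * k + 3\<close>.\<close>

lemma not_realizable_odd:
  assumes X: "X homeomorphic_space S2" and Y: "Y homeomorphic_space S2" and "odd m" "m' > 0" "m'' > 0"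
  shows "\<not> realizable X Y d (triple m 0 m' n' m'' n'')"
proof
  assume "realizable X Y d (triple m 0 m' n' m'' n'')"
  then have r: "realizable X Y d {#rep 2 m, rep 4 m' + rep 2 n', rep 4 m'' + rep 2 n''#}" by (simp add: triple_def)
  have "m > 0" using \<open>odd m\<close> by (cases m) auto
  obtain f C A B where f: "S2_branched X Y f (local_degree X Y f)"
    and CAB: "C \<in> topspace Y" "A \<in> topspace Y" "B \<in> topspace Y" "A \<noteq> B" "C \<noteq> A" "C \<noteq> B"
    and ld: "local_degrees_over X Y f C = rep 2 m" "local_degrees_over X Y f A = rep 4 m' + rep 2 n'" "local_degrees_over X Y f B = rep 4 m'' + rep 2 n''"
    by (rule realizable_tripleE[OF X Y r]) (use \<open>m > 0\<close> assms(4,5) in \<open>auto simp: replicate_mset_eq_empty_iff\<close>)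
  interpret S2_branched X Y f "local_degree X Y f" by (rule f)
  note LD = local_degrees_overD[OF _ refl]
  have "card {x \<in> topspace X. f x = B} > 0" using LD(2)[OF CAB(3)] unfolding ld(3) using assms(5) by simp
  then have "{x \<in> topspace X. f x = B} \<noteq> {}" by (metis card.empty less_irrefl)
  then obtain q where q: "q \<in> topspace X" "f q = B" by blast
  have "even (card {x \<in> topspace X. f x = C})"
  proof (rule even_card_fibre[OF CAB(2,3,1,4,5,6) q])
    show "even (local_degree X Y f x)" if "x \<in> topspace X" "f x = A \<or> f x = B" for x
      using LD(1)[OF CAB(2) that(1)] LD(1)[OF CAB(3) that(1)] that(2) unfolding ld by (auto split: if_splits)
    show "local_degree X Y f x = 2" if "x \<in> topspace X" "f x = C" for x
      using LD(1)[OF CAB(1) that] unfolding ld by (auto split: if_splits)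
  qed
  then show False using LD(2)[OF CAB(1)] ld(1) \<open>odd m\<close> by simp
qed

text \<open>In type 6 the degree is \<open>2 * m\<close>, so divisibility of \<open>m\<close> by 4
  becomes divisibility of \<open>d\<close> by 8.\<close>

lemma realizable_imp_four_dvd:
  assumes X: "X homeomorphic_space S2" and Y: "Y homeomorphic_space S2"
    and r: "realizable X Y d (triple m 0 m' n' m'' 0)" and pos: "m > 0" "m' > 0" "m'' > 0"
  shows "4 dvd m"
proof -
  have r: "realizable X Y d {#rep 2 m, rep 4 m' + rep 2 n', rep 4 m''#}" using r by (simp add: triple_def)
  obtain f C A B where f: "S2_branched X Y f (local_degree X Y f)"
    and CAB: "C \<in> topspace Y" "A \<in> topspace Y" "B \<in> topspace Y" "A \<noteq> B" "C \<noteq> A" "C \<noteq> B"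
    and ld: "local_degrees_over X Y f C = rep 2 m" "local_degrees_over X Y f A = rep 4 m' + rep 2 n'" "local_degrees_over X Y f B = rep 4 m''"
    by (rule realizable_tripleE[OF X Y r]) (use pos in \<open>auto simp: replicate_mset_eq_empty_iff\<close>)
  interpret S2_branched X Y f "local_degree X Y f" by (rule f)
  note LD = local_degrees_overD[OF _ refl]
  have "card {x \<in> topspace X. f x = B} > 0" using LD(2)[OF CAB(3)] unfolding ld(3) using pos by simp
  then have "{x \<in> topspace X. f x = B} \<noteq> {}" by (metis card.empty less_irrefl)
  then obtain q where q: "q \<in> topspace X" "f q = B" by blast
  have "4 dvd card {x \<in> topspace X. f x = C}"
  proof (rule four_dvd_card_fibre[OF CAB(2,3,1,4,5,6) q])
    show "even (local_degree X Y f x)" if "x \<in> topspace X" "f x = A" for x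
      using LD(1)[OF CAB(2) that] unfolding ld by (auto split: if_splits)
    show "local_degree X Y f x = 4" if "x \<in> topspace X" "f x = B" for x
      using LD(1)[OF CAB(3) that] unfolding ld by (auto split: if_splits)
    show "local_degree X Y f x = 2" if "x \<in> topspace X" "f x = C" for x
      using LD(1)[OF CAB(1) that] unfolding ld by (auto split: if_splits)
  qed
  then show ?thesis using LD(2)[OF CAB(1)] ld(1) by simp
qed

section \<open>Explicit lattice data for types 1, 2, 3, 4 and 6\<close>

lemma card_corner_set:
  "card {(i, j) \<in> {0, 1::int} \<times> {0, 1::int}. R i j} = of_bool (R 0 0) + of_bool (R 0 1) + of_bool (R 1 0) + of_bool (R 1 1)"
proof -
  have "{(i, j) \<in> {0, 1::int} \<times> {0, 1::int}. R i j} = {x \<in> {0, 1} \<times> {0, 1}. R (fst x) (snd x)}" by auto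
  also have "card \<dots> = (\<Sum>x\<in>{0, 1::int} \<times> {0, 1::int}. of_bool (R (fst x) (snd x)))"
    unfolding card_eq_sum of_bool_def by (rule sum.inter_filter) simp
  also have "{0, 1::int} \<times> {0, 1::int} = {(0, 0), (0, 1), (1, 0), (1, 1)}" by auto
  finally show ?thesis by (simp del: sum_of_bool_eq sum_mult_of_bool_eq sum_of_bool_mult_eq)
qed

lemma realizable_triple:
  fixes s g h :: int
  assumes X: "X homeomorphic_space S2" and Y: "Y homeomorphic_space S2"
    and ab: "a > 0" "b > 0" "2 * a * b > 4"
    and d: "4 * m' + 2 * n' = 2 * a * b" "4 * m'' + 2 * n'' = 2 * a * b" "2 * m + n = 2 * a * b"
    and n: "lattice_cover.corner_count a b s g h 1 0 = n" "lattice_cover.corner_count a b s g h 0 0 = n'"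
      "lattice_cover.corner_count a b s g h 1 1 = n''"
  shows "realizable X Y (2 * a * b) (triple m n m' n' m'' n'')"
proof -
  obtain P T where "\<And>a b. a > 0 \<Longrightarrow> b > 0 \<Longrightarrow> lattice_cover X Y P T a b"
    using lattice_cover_exists[OF X Y] by blast
  then have "lattice_cover X Y P T a b" using ab by blast
  from lattice_cover.realizable_cover[OF this ab(3), of m' s g h m'' m, unfolded n]
  show ?thesis unfolding triple_def using d by blast
qed

lemma realizable_types:
  assumes X: "X homeomorphic_space S2" and Y: "Y homeomorphic_space S2" and k: "k \<ge> 1"
    and t: "type1 k d P \<or> type2 k d P \<or> type3 k d P \<or> type4 k d P \<or> type6 k d P \<and> 8 dvd d"
  shows "realizable X Y d P"
proof -
  obtain P0 T0 where lc: "\<And>a b. a > 0 \<Longrightarrow> b > 0 \<Longrightarrow> lattice_cover X Y P0 T0 a b"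
    using lattice_cover_exists[OF X Y] by blast
  define R where "R a b s g h m n i j \<longleftrightarrow>
     even (int a * i + s * j + g - m) \<and> even (int b * j + h - n) \<or> even (int a * i + s * j + g - n) \<and> even (int b * j + h - m)"
    for a b :: nat and s g h m n i j :: int
  have cc: "lattice_cover.corner_count a b s g h m n = of_bool (R a b s g h m n 0 0) + of_bool (R a b s g h m n 0 1)
      + of_bool (R a b s g h m n 1 0) + of_bool (R a b s g h m n 1 1)" if "a > 0" "b > 0" for a b s g h m n
    unfolding lattice_cover.corner_count_def[OF lc[OF that]] theta_half_eq_iff R_def card_corner_set ..
  \<comment> \<open>Modulo 2 the corner (i, j) goes to (j + 1, j), always in the class of order 2;
    the translation is what moves all corners off the points of order 4.\<close>
  have 1: "realizable X Y (2 * (2*k+2) * 1) (triple (2*k) 4 (k+1) 0 (k+1) 0)"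
    by (rule realizable_triple[OF X Y, where s = 1 and g = 1 and h = 0]) (use k in \<open>simp_all add: cc R_def\<close>)
  \<comment> \<open>With \<open>a\<close> even and no shear the image is (0, j): two corners over
    (0,0), two over the class of (1,0).\<close>
  have 2: "realizable X Y (2 * (2*k+2) * 1) (triple (2*k+1) 2 k 2 (k+1) 0)"
    by (rule realizable_triple[OF X Y, where s = 0 and g = 0 and h = 0]) (use k in \<open>simp_all add: cc R_def\<close>)
  \<comment> \<open>With \<open>a\<close> and \<open>b\<close> odd the parities are unchanged: one
    corner over each of (0,0) and (1,1), two over the class of (1,0).\<close>
  have 3: "realizable X Y (2 * (2*k+1) * 1) (triple (2*k) 2 k 1 k 1)"
    by (rule realizable_triple[OF X Y, where s = 0 and g = 0 and h = 0]) (use k in \<open>simp_all add: cc R_def\<close>)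
  \<comment> \<open>The shear sends (i, j) to (j, j), so the two points of order 4 share the corners
    equally.\<close>
  have 4: "realizable X Y (2 * (2*k+2) * 1) (triple (2*k+2) 0 k 2 k 2)"
    by (rule realizable_triple[OF X Y, where s = 1 and g = 0 and h = 0]) (use k in \<open>simp_all add: cc R_def\<close>)
  \<comment> \<open>Both diagonal entries are even, so all corners land on (0,0). Evenness of
    \<open>k + 2\<close> is where divisibility of \<open>d\<close> by 8 enters.\<close>
  have 6: "realizable X Y (2 * (k+2) * 2) (triple (2*k+4) 0 k 4 (k+2) 0)" if "even k"
    by (rule realizable_triple[OF X Y, where s = 0 and g = 0 and h = 0]) (use that in \<open>simp_all add: cc R_def\<close>)
  have e: "2 * (2*k+2) * 1 = 4*k+4" "2 * (2*k+1) * 1 = 4*k+2" "2 * (k+2) * 2 = 4*k+8" by simp_all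
  have "even k" if "8 dvd 4 * k + 8"
    using that by presburger
  then show ?thesis
    using t 1 2 3 4 6 unfolding types_eq_triple e by (elim disjE conjE) (simp_all only:)
qed

theorem theorem3p9:
  fixes X :: "'a topology" and Y :: "'b topology"
    and d :: nat and P :: "nat multiset multiset"
  shows
    "(candidate_cover X Y d P \<and>
      induces_orbifold_cover X Y P (S2, {#2, 2, 2, 2#}) (S2, {#2, 4, 4#})
      \<longleftrightarrow>
      X homeomorphic_space S2 \<and> Y homeomorphic_space S2 \<and>
      (\<exists>k\<ge>1. type1 k d P \<or> type2 k d P \<or> type3 k d P \<or> type4 k d P \<or> type5 k d P \<or> type6 k d P))
     \<and>
     (X homeomorphic_space S2 \<and> Y homeomorphic_space S2 \<longrightarrow>
      (\<forall>k\<ge>1.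
        (type1 k d P \<or> type2 k d P \<or> type3 k d P \<or> type4 k d P \<longrightarrow> realizable X Y d P) \<and>
        (type5 k d P \<longrightarrow> \<not> realizable X Y d P) \<and>
        (type6 k d P \<longrightarrow> (realizable X Y d P \<longleftrightarrow> 8 dvd d))))"
proof (intro conjI impI allI)
  have S2: "X homeomorphic_space S2 \<and> Y homeomorphic_space S2"
    if "induces_orbifold_cover X Y P (S2, {#2, 2, 2, 2#}) (S2, {#2, 4, 4#})"
    using that by (simp add: induces_orbifold_cover_def same_orbifold_def induced_source_def induced_target_def)
  show "candidate_cover X Y d P \<and>
      induces_orbifold_cover X Y P (S2, {#2, 2, 2, 2#}) (S2, {#2, 4, 4#})
      \<longleftrightarrow>
      X homeomorphic_space S2 \<and> Y homeomorphic_space S2 \<and>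
      (\<exists>k\<ge>1. type1 k d P \<or> type2 k d P \<or> type3 k d P \<or> type4 k d P \<or> type5 k d P \<or> type6 k d P)"
    unfolding six_families_def[symmetric]
    using S2 candidate_imp_six_families six_families_imp_candidate by blast
next
  fix k :: nat
  assume XY: "X homeomorphic_space S2 \<and> Y homeomorphic_space S2" and k: "1 \<le> k"
  then have X: "X homeomorphic_space S2" and Y: "Y homeomorphic_space S2" by auto
  show "realizable X Y d P" if "type1 k d P \<or> type2 k d P \<or> type3 k d P \<or> type4 k d P"
    using realizable_types[OF X Y k] that by blast
  show "\<not> realizable X Y d P" if "type5 k d P"
    using not_realizable_odd[OF X Y, of "2*k+3" k "k+1"] that k unfolding types_eq_triple by simp
  show "realizable X Y d P \<longleftrightarrow> 8 dvd d" if t: "type6 k d P"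
  proof
    assume r: "realizable X Y d P"
    then have "4 dvd 2*k+4"
      using realizable_imp_four_dvd[OF X Y, of d "2*k+4" k 4 "k+2"] t k unfolding types_eq_triple by simp
    then show "8 dvd d" using t unfolding types_eq_triple by presburger
  next
    assume "8 dvd d"
    then show "realizable X Y d P" using realizable_types[OF X Y k] t by blast
  qed
qed

end
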